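(* Let $(N,h,J,\omega,\Omega)$ be a Calabi-Yau $6$-manifold and let $\beta\in\Lambda^2_8(N)$. Then \[ d\beta=\frac12\,J^*d^8_6\beta\wedge\omega+d^8_{12}\beta,\qquad d\star\beta=\star d^8_6\beta. \]
   Context: A Calabi-Yau 6-manifold $(N,h,J,\omega,\Omega)$ is a real 6-dimensional manifold with complex structure $J$, Kähler metric $h$, Kähler form $\omega=h(J\cdot,\cdot)$, and a holomorphic complex volume form $\Omega=\Omega^++i\Omega^-$ with $2\omega^3=3\,\Omega^+\wedge\Omega^-$ (so that $\omega,\Omega^\pm$ are parallel and at each point form an SU(3)-structure, with $\omega\wedge\Omega^\pm=0$ and $\Omega^-=J^*\Omega^+=\star\Omega^+$). The volume form is $\mathrm{vol}_h=\omega^3/6$; $\Lambda^k(N)$ is the space of smooth real $k$-forms, $\star$ the Hodge star, $d^*$ the formal adjoint of $d$, and $J^*\alpha=\alpha(J\cdot,\dots,J\cdot)$. Set $\Lambda^2_8(N)=\{\sigma\in\Lambda^2(N): J^*\sigma=\sigma,\ \sigma\wedge\omega^2=0\}$, $\Lambda^3_{12}(N)=\{\rho\in\Lambda^3(N):\rho\wedge\omega=0,\ \rho\wedge\Omega^\pm=0\}$, and let $\pi^3_{12}:\Lambda^3(N)\to\Lambda^3_{12}(N)$ be the pointwise orthogonal projection. For $\beta\in\Lambda^2_8(N)$ define $d^8_6\beta:=d^*\beta\in\Lambda^1(N)$ and $d^8_{12}\beta:=\pi^3_{12}(d\beta)$. *)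

theory Defs
  imports "HOL-Analysis.Analysis" "HOL-Combinatorics.Permutations"
begin

section \<open>Smooth and holomorphic functions on open subsets of a normed space\<close>

primrec Ck_on :: "nat \<Rightarrow> 'v::real_normed_vector set \<Rightarrow> ('v \<Rightarrow> 'w::real_normed_vector) \<Rightarrow> bool" where
  "Ck_on 0 S f \<longleftrightarrow> continuous_on S f"
| "Ck_on (Suc n) S f \<longleftrightarrow> (\<forall>x\<in>S. f differentiable (at x)) \<and>
      (\<forall>v. Ck_on n S (\<lambda>x. frechet_derivative f (at x) v))"

definition smooth_on :: "'v::real_normed_vector set \<Rightarrow> ('v \<Rightarrow> 'w::real_normed_vector) \<Rightarrow> bool" where
  "smooth_on S f \<longleftrightarrow> (\<forall>n. Ck_on n S f)"

definition holo_on :: "(complex^3) set \<Rightarrow> (complex^3 \<Rightarrow> complex) \<Rightarrow> bool" where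
  "holo_on S f \<longleftrightarrow> smooth_on S f \<and>
     (\<forall>x\<in>S. \<forall>v. frechet_derivative f (at x) (\<i> *s v) = \<i> * frechet_derivative f (at x) v)"


section \<open>Exterior algebra of the real vector space underlying complex 3-space\<close>

text \<open>A \<open>k\<close>-form takes its arguments as a sequence, of which only the first \<open>k\<close> entries matter.\<close>

type_synonym mform = "(nat \<Rightarrow> complex^3) \<Rightarrow> real"

definition alternating_form :: "nat \<Rightarrow> mform \<Rightarrow> bool" where
  "alternating_form k a \<longleftrightarrow>
     (\<forall>v w. (\<forall>i<k. v i = w i) \<longrightarrow> a v = a w) \<and>
     (\<forall>v. \<forall>i<k. linear (\<lambda>x. a (v(i := x)))) \<and>
     (\<forall>v. \<forall>i<k. \<forall>j<k. i \<noteq> j \<and> v i = v j \<longrightarrow> a v = 0)"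

text \<open>Normalised so that \<open>e\<^sup>1 \<and> e\<^sup>2 = e\<^sup>1 \<otimes> e\<^sup>2 - e\<^sup>2 \<otimes> e\<^sup>1\<close>.\<close>

definition wedge :: "nat \<Rightarrow> nat \<Rightarrow> mform \<Rightarrow> mform \<Rightarrow> mform" where
  "wedge k l a b = (\<lambda>v. (\<Sum>p | p permutes {..<k+l}.
      of_int (sign p) * a (\<lambda>i. v (p i)) * b (\<lambda>i. v (p (k + i)))) / (fact k * fact l))"

definition Jstar :: "mform \<Rightarrow> mform" where
  "Jstar a = (\<lambda>v. a (\<lambda>i. \<i> *s v i))"

type_synonym bform = "complex^3 \<Rightarrow> complex^3 \<Rightarrow> real"

definition hermitian_inner :: "bform \<Rightarrow> bool" where
  "hermitian_inner g \<longleftrightarrow> bilinear g \<and> (\<forall>v w. g v w = g w v) \<and> (\<forall>v. v \<noteq> 0 \<longrightarrow> g v v > 0) \<and>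
     (\<forall>v w. g (\<i> *s v) (\<i> *s w) = g v w)"

definition orthonormal_frame :: "bform \<Rightarrow> (nat \<Rightarrow> complex^3) \<Rightarrow> bool" where
  "orthonormal_frame g e \<longleftrightarrow> (\<forall>i<6. \<forall>j<6. g (e i) (e j) = (if i = j then 1 else 0))"

text \<open>The inner product for which the \<open>e\<^sup>I\<close> with \<open>I\<close> increasing are orthonormal; summing over all
  index tuples counts each \<open>I\<close> exactly \<open>k!\<close> times. It does not depend on the chosen frame.\<close>

definition form_inner :: "bform \<Rightarrow> nat \<Rightarrow> mform \<Rightarrow> mform \<Rightarrow> real" where
  "form_inner g k a b = (let e = (SOME e. orthonormal_frame g e) in
     (\<Sum>I \<in> {..<k} \<rightarrow>\<^sub>E {..<6}. a (\<lambda>i. e (I i)) * b (\<lambda>i. e (I i))) / fact k)"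

definition kahler_form :: "bform \<Rightarrow> mform" where
  "kahler_form g = (\<lambda>v. g (\<i> *s v 0) (v 1))"

definition kahler_sq :: "bform \<Rightarrow> mform" where
  "kahler_sq g = wedge 2 2 (kahler_form g) (kahler_form g)"

definition kahler_cube :: "bform \<Rightarrow> mform" where
  "kahler_cube g = wedge 4 2 (kahler_sq g) (kahler_form g)"

definition vol_form :: "bform \<Rightarrow> mform" where
  "vol_form g = (\<lambda>v. kahler_cube g v / 6)"

definition hodge :: "bform \<Rightarrow> nat \<Rightarrow> mform \<Rightarrow> mform" where
  "hodge g k b = (THE s. alternating_form (6 - k) s \<and>
     (\<forall>a. alternating_form k a \<longrightarrow>
        wedge k (6 - k) a s = (\<lambda>v. form_inner g k a b * vol_form g v)))"

type_synonym cform = "(nat \<Rightarrow> complex^3) \<Rightarrow> complex"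

definition re_form :: "cform \<Rightarrow> mform" where "re_form a = (\<lambda>v. Re (a v))"

definition im_form :: "cform \<Rightarrow> mform" where "im_form a = (\<lambda>v. Im (a v))"

definition dz123 :: cform where
  "dz123 = (\<lambda>v. det (vector [v 0, v 1, v 2] :: complex^3^3))"

definition L3_12 :: "bform \<Rightarrow> cform \<Rightarrow> mform set" where
  "L3_12 g W = {r. alternating_form 3 r \<and> wedge 3 2 r (kahler_form g) = (\<lambda>_. 0) \<and>
     wedge 3 3 r (re_form W) = (\<lambda>_. 0) \<and> wedge 3 3 r (im_form W) = (\<lambda>_. 0)}"

definition proj3_12 :: "bform \<Rightarrow> cform \<Rightarrow> mform \<Rightarrow> mform" where
  "proj3_12 g W r = (THE s. s \<in> L3_12 g W \<and>
     (\<forall>t \<in> L3_12 g W. form_inner g 3 (\<lambda>v. r v - s v) t = 0))"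


section \<open>Differential forms on open subsets of complex 3-space\<close>

definition smooth_form_on :: "nat \<Rightarrow> (complex^3) set \<Rightarrow> (complex^3 \<Rightarrow> mform) \<Rightarrow> bool" where
  "smooth_form_on k S \<alpha> \<longleftrightarrow>
     (\<forall>x\<in>S. alternating_form k (\<alpha> x)) \<and> (\<forall>v. smooth_on S (\<lambda>x. \<alpha> x v))"

definition ext_d :: "nat \<Rightarrow> (complex^3 \<Rightarrow> mform) \<Rightarrow> complex^3 \<Rightarrow> mform" where
  "ext_d k \<alpha> x v = (\<Sum>i\<le>k. (-1) ^ i *
     frechet_derivative (\<lambda>y. \<alpha> y (\<lambda>j. if j < i then v j else v (Suc j))) (at x) (v i))"

text \<open>The coordinate frame \<open>\<partial>x\<^sub>1, \<partial>y\<^sub>1, \<partial>x\<^sub>2, \<partial>y\<^sub>2, \<partial>x\<^sub>3, \<partial>y\<^sub>3\<close>, positively oriented for \<open>\<omega>\<^sup>3\<close>. The integral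
  of \<open>f vol\<close> over a coordinate domain is the Lebesgue integral of \<open>f\<close> times the density below.\<close>

definition vol_density :: "bform \<Rightarrow> real" where
  "vol_density g = vol_form g
     (\<lambda>i. [axis 1 1, axis 1 \<i>, axis 2 1, axis 2 \<i>, axis 3 1, axis 3 \<i>] ! i)"

definition test_form :: "nat \<Rightarrow> (complex^3) set \<Rightarrow> (complex^3 \<Rightarrow> mform) \<Rightarrow> bool" where
  "test_form k S \<alpha> \<longleftrightarrow> smooth_form_on k S \<alpha> \<and>
     (\<exists>K. compact K \<and> K \<subseteq> S \<and> (\<forall>x\<in>S - K. \<alpha> x = (\<lambda>_. 0)))"

text \<open>\<open>codiff_on k S g\<close> is the formal adjoint of \<open>d\<close> from \<open>k\<close>-forms to \<open>(k+1)\<close>-forms on the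
  Riemannian domain \<open>(S, g)\<close>. On \<open>S\<close> the adjoint is unique; off \<open>S\<close> its value is arbitrary.\<close>

definition is_codiff_on ::
  "nat \<Rightarrow> (complex^3) set \<Rightarrow> (complex^3 \<Rightarrow> bform) \<Rightarrow> (complex^3 \<Rightarrow> mform) \<Rightarrow> (complex^3 \<Rightarrow> mform) \<Rightarrow> bool"
  where
  "is_codiff_on k S g \<beta> \<gamma> \<longleftrightarrow> smooth_form_on k S \<gamma> \<and>
     (\<forall>\<alpha>. test_form k S \<alpha> \<longrightarrow>
        (LINT x:S|lborel. form_inner (g x) (Suc k) (ext_d k \<alpha> x) (\<beta> x) * vol_density (g x)) =
        (LINT x:S|lborel. form_inner (g x) k (\<alpha> x) (\<gamma> x) * vol_density (g x)))"

definition codiff_on ::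
  "nat \<Rightarrow> (complex^3) set \<Rightarrow> (complex^3 \<Rightarrow> bform) \<Rightarrow> (complex^3 \<Rightarrow> mform) \<Rightarrow> (complex^3 \<Rightarrow> mform)"
  where "codiff_on k S g \<beta> = (SOME \<gamma>. is_codiff_on k S g \<beta> \<gamma>)"


section \<open>Complex 3-manifolds\<close>

text \<open>A complex structure on the (second countable, Hausdorff) space \<open>'a\<close> is given by a
  holomorphic atlas; \<open>J\<close> is multiplication by \<open>\<i>\<close> in every chart.\<close>

type_synonym 'a chart = "'a set \<times> ('a \<Rightarrow> complex^3)"

definition cdom :: "'a chart \<Rightarrow> 'a set" where "cdom c = fst c"

definition cimg :: "'a chart \<Rightarrow> (complex^3) set" where "cimg c = snd c ` fst c"

definition overlap :: "'a chart \<Rightarrow> 'a chart \<Rightarrow> (complex^3) set" where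
  "overlap c c' = snd c ` (fst c \<inter> fst c')"

definition transition :: "'a chart \<Rightarrow> 'a chart \<Rightarrow> complex^3 \<Rightarrow> complex^3" where
  "transition c c' = snd c' \<circ> inv_into (fst c) (snd c)"

definition is_chart :: "('a::topological_space) chart \<Rightarrow> bool" where
  "is_chart c \<longleftrightarrow> open (cdom c) \<and> open (cimg c) \<and> (\<exists>\<psi>. homeomorphism (cdom c) (cimg c) (snd c) \<psi>)"

definition complex_atlas :: "('a::{t2_space,second_countable_topology}) chart set \<Rightarrow> bool" where
  "complex_atlas A \<longleftrightarrow> (\<forall>c\<in>A. is_chart c) \<and> (\<Union>c\<in>A. cdom c) = UNIV \<and>
     (\<forall>c\<in>A. \<forall>c'\<in>A. \<forall>j. holo_on (overlap c c') (\<lambda>x. transition c c' x $ j))"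

text \<open>A tensor field is the family of its coordinate representations, related by the
  transformation law under changes of charts; only values \<open>\<alpha> c x\<close> with \<open>x \<in> cimg c\<close> are
  meaningful. Algebraic and local differential operators act on each representation.\<close>

type_synonym 'a dform = "'a chart \<Rightarrow> complex^3 \<Rightarrow> mform"
type_synonym 'a dmetric = "'a chart \<Rightarrow> complex^3 \<Rightarrow> bform"
type_synonym 'a dcform = "'a chart \<Rightarrow> complex^3 \<Rightarrow> cform"

definition Forms :: "'a chart set \<Rightarrow> nat \<Rightarrow> 'a dform set" where
  "Forms A k = {\<alpha>. (\<forall>c\<in>A. smooth_form_on k (cimg c) (\<alpha> c)) \<and>
     (\<forall>c\<in>A. \<forall>c'\<in>A. \<forall>x\<in>overlap c c'. \<forall>v.
        \<alpha> c x v = \<alpha> c' (transition c c' x) (\<lambda>i. frechet_derivative (transition c c') (at x) (v i)))}"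

definition hermitian_metric :: "'a chart set \<Rightarrow> 'a dmetric \<Rightarrow> bool" where
  "hermitian_metric A h \<longleftrightarrow>
     (\<forall>c\<in>A. (\<forall>x\<in>cimg c. hermitian_inner (h c x)) \<and> (\<forall>v w. smooth_on (cimg c) (\<lambda>x. h c x v w))) \<and>
     (\<forall>c\<in>A. \<forall>c'\<in>A. \<forall>x\<in>overlap c c'. \<forall>v w.
        h c x v w = h c' (transition c c' x) (frechet_derivative (transition c c') (at x) v)
                                             (frechet_derivative (transition c c') (at x) w))"

definition eq_form :: "'a chart set \<Rightarrow> 'a dform \<Rightarrow> 'a dform \<Rightarrow> bool" where
  "eq_form A \<alpha> \<beta> \<longleftrightarrow> (\<forall>c\<in>A. \<forall>x\<in>cimg c. \<alpha> c x = \<beta> c x)"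

definition zero_form :: "'a dform" where
  "zero_form = (\<lambda>c x v. 0)"

definition add_form :: "'a dform \<Rightarrow> 'a dform \<Rightarrow> 'a dform" where
  "add_form \<alpha> \<beta> = (\<lambda>c x v. \<alpha> c x v + \<beta> c x v)"

definition scale_form :: "real \<Rightarrow> 'a dform \<Rightarrow> 'a dform" where
  "scale_form r \<alpha> = (\<lambda>c x v. r * \<alpha> c x v)"

definition Wedge :: "nat \<Rightarrow> nat \<Rightarrow> 'a dform \<Rightarrow> 'a dform \<Rightarrow> 'a dform" where
  "Wedge k l \<alpha> \<beta> = (\<lambda>c x. wedge k l (\<alpha> c x) (\<beta> c x))"

definition JStar :: "'a dform \<Rightarrow> 'a dform" where
  "JStar \<alpha> = (\<lambda>c x. Jstar (\<alpha> c x))"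

definition Ext_d :: "nat \<Rightarrow> 'a dform \<Rightarrow> 'a dform" where
  "Ext_d k \<alpha> = (\<lambda>c. ext_d k (\<alpha> c))"

definition Hodge :: "'a dmetric \<Rightarrow> nat \<Rightarrow> 'a dform \<Rightarrow> 'a dform" where
  "Hodge h k \<alpha> = (\<lambda>c x. hodge (h c x) k (\<alpha> c x))"

text \<open>The formal adjoint of a differential operator is a local operator: by partitions of unity it
  is determined by the test forms with compact support in a single coordinate domain.\<close>

definition Codiff :: "'a dmetric \<Rightarrow> nat \<Rightarrow> 'a dform \<Rightarrow> 'a dform" where
  "Codiff h k \<beta> = (\<lambda>c. codiff_on k (cimg c) (h c) (\<beta> c))"

definition Kahler :: "'a dmetric \<Rightarrow> 'a dform" where
  "Kahler h = (\<lambda>c x. kahler_form (h c x))"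

definition Re_form :: "'a dcform \<Rightarrow> 'a dform" where
  "Re_form \<Omega> = (\<lambda>c x. re_form (\<Omega> c x))"

definition Im_form :: "'a dcform \<Rightarrow> 'a dform" where
  "Im_form \<Omega> = (\<lambda>c x. im_form (\<Omega> c x))"

definition holomorphic_volume_form :: "'a chart set \<Rightarrow> 'a dcform \<Rightarrow> bool" where
  "holomorphic_volume_form A \<Omega> \<longleftrightarrow> Re_form \<Omega> \<in> Forms A 3 \<and> Im_form \<Omega> \<in> Forms A 3 \<and>
     (\<forall>c\<in>A. \<exists>f. holo_on (cimg c) f \<and>
        (\<forall>x\<in>cimg c. f x \<noteq> 0 \<and> (\<forall>v. \<Omega> c x v = f x * dz123 v)))"


section \<open>Calabi-Yau 6-manifolds\<close>

definition calabi_yau ::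
  "('a::{t2_space,second_countable_topology}) chart set \<Rightarrow> 'a dmetric \<Rightarrow> 'a dcform \<Rightarrow> bool" where
  "calabi_yau A h \<Omega> \<longleftrightarrow> complex_atlas A \<and> hermitian_metric A h \<and>
     eq_form A (Ext_d 2 (Kahler h)) zero_form \<and>
     holomorphic_volume_form A \<Omega> \<and>
     eq_form A (scale_form 2 (Wedge 4 2 (Wedge 2 2 (Kahler h) (Kahler h)) (Kahler h)))
               (scale_form 3 (Wedge 3 3 (Re_form \<Omega>) (Im_form \<Omega>)))"

definition Forms2_8 :: "'a chart set \<Rightarrow> 'a dmetric \<Rightarrow> 'a dform set" where
  "Forms2_8 A h = {\<sigma> \<in> Forms A 2. eq_form A (JStar \<sigma>) \<sigma> \<and>
     eq_form A (Wedge 2 4 \<sigma> (Wedge 2 2 (Kahler h) (Kahler h))) zero_form}"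

definition Proj3_12 :: "'a dmetric \<Rightarrow> 'a dcform \<Rightarrow> 'a dform \<Rightarrow> 'a dform" where
  "Proj3_12 h \<Omega> \<rho> = (\<lambda>c x. proj3_12 (h c x) (\<Omega> c x) (\<rho> c x))"

definition d8_6 :: "'a dmetric \<Rightarrow> 'a dform \<Rightarrow> 'a dform" where
  "d8_6 h \<beta> = Codiff h 1 \<beta>"

definition d8_12 :: "'a dmetric \<Rightarrow> 'a dcform \<Rightarrow> 'a dform \<Rightarrow> 'a dform" where
  "d8_12 h \<Omega> \<beta> = Proj3_12 h \<Omega> (Ext_d 2 \<beta>)"

end

theory Submission
  imports Defs
begin

text \<open>
  For a primitive (1,1)-form \<open>\<beta>\<close> one has \<open>\<star>\<beta> = - \<beta> \<and> \<omega>\<close>, and for a 1-form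
  \<open>\<star>\<gamma> = - J\<^sup>*\<gamma> \<and> \<omega>\<^sup>2 / 2\<close>; both are finite computations in a unitary frame. Integration by parts
  identifies \<open>\<gamma> = d\<^sup>*\<beta>\<close> as the 1-form with \<open>\<star>\<gamma> = d\<star>\<beta>\<close>, which is \<open>- d\<beta> \<and> \<omega>\<close> since \<open>\<omega>\<close> is closed.
  Hence \<open>\<rho> = d\<beta> - J\<^sup>*\<gamma> \<and> \<omega> / 2\<close> satisfies \<open>\<rho> \<and> \<omega> = 0\<close>. By type, \<open>\<beta> \<and> \<Omega>\<close> and \<open>\<omega> \<and> \<Omega>\<close> vanish,
  and \<open>\<Omega>\<close> is closed, so \<open>\<rho> \<and> \<Omega> = 0\<close> as well. Finally the forms \<open>X \<and> \<omega>\<close> are orthogonal to those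
  annihilated by \<open>\<omega>\<close>, so \<open>\<rho>\<close> is the projection of \<open>d\<beta>\<close>.
\<close>

subsection \<open>Antisymmetrisation and the wedge product\<close>

text \<open>Four notions rest on choice operators: \<open>hodge\<close> and \<open>proj3_12\<close>
  on THE, \<open>codiff_on\<close> on SOME, and \<open>form_inner\<close> on a SOME frame. Each must
  be freed from the choice: the star by nondegeneracy of the wedge product, the projection by
  positivity of the inner product, the inner product by invariance of traces under change of
  orthonormal frame, the codifferential by testing against bump forms. The adjoint exists because an
  explicit candidate satisfies its defining relation. A frame chosen separately at each point need
  not vary continuously, so continuity of an inner product of one-forms is read off from the smooth
  top form \<alpha> \<and> \<star>\<gamma> instead. The finite computations become rewriting once
  forms are read as functions on lists of frame indices. The constant 1/2 of the theorem stems from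
  \<omega> \<and> \<omega> having components 2, not 1, on a unitary frame.\<close>

definition Alt :: "nat \<Rightarrow> ((nat \<Rightarrow> 'v) \<Rightarrow> real) \<Rightarrow> (nat \<Rightarrow> 'v) \<Rightarrow> real" where
  "Alt n F v = (\<Sum>p | p permutes {..<n}. of_int (sign p) * F (\<lambda>i. v (p i)))"

text \<open>Reduces identities between wedge products to identities between antisymmetrised tensors;
  \<open>Alt\<close> carries no factor 1/n!, so all normalising constants stay outside.\<close>

lemma wedge_Alt:
  "wedge k l a b v = Alt (k + l) (\<lambda>w. a w * b (\<lambda>i. w (k + i))) v / (fact k * fact l)"
  by (simp add: wedge_def Alt_def mult.assoc)

lemma sign_comp_permutes:
  assumes "p permutes {..<n::nat}" "q permutes {..<n}"
  shows "sign (p \<circ> q) = sign p * sign q"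
  using assms by (metis finite_lessThan permutation_permutes sign_compose)

lemma Alt_permute_args:
  assumes q: "q permutes {..<n}"
  shows "Alt n F (\<lambda>i. v (q i)) = of_int (sign q) * Alt n F v"
proof -
  have "Alt n F v = (\<Sum>p | p permutes {..<n}. of_int (sign (q \<circ> p)) * F (\<lambda>i. v ((q \<circ> p) i)))"
    unfolding Alt_def by (rule setum_permutations_compose_left[OF q])
  also have "\<dots> = (\<Sum>p | p permutes {..<n}. of_int (sign q) * (of_int (sign p) * F (\<lambda>i. v (q (p i)))))"
    using q by (intro sum.cong)
      (auto simp: sign_comp_permutes)
  finally have "Alt n F v = of_int (sign q) * Alt n F (\<lambda>i. v (q i))"
    by (simp add: Alt_def sum_distrib_left)
  then show ?thesis
    by (simp flip: mult.assoc of_int_mult)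
qed

text \<open>Here the slots of the tensor are permuted instead of the arguments, so the sum is
  reindexed by composition on the right instead of the left.\<close>

lemma Alt_permute_fun:
  assumes q: "q permutes {..<n}"
  shows "Alt n (\<lambda>w. F (\<lambda>i. w (q i))) v = of_int (sign q) * Alt n F v"
proof -
  have "Alt n F v = (\<Sum>p | p permutes {..<n}. of_int (sign (p \<circ> q)) * F (\<lambda>i. v ((p \<circ> q) i)))"
    unfolding Alt_def by (rule sum_permutations_compose_right[OF q])
  also have "\<dots> = (\<Sum>p | p permutes {..<n}. of_int (sign q) * (of_int (sign p) * F (\<lambda>i. v (p (q i)))))"
    using q by (intro sum.cong)
      (auto simp: sign_comp_permutes)
  finally have "Alt n F v = of_int (sign q) * Alt n (\<lambda>w. F (\<lambda>i. w (q i))) v"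
    by (simp add: Alt_def sum_distrib_left)
  then show ?thesis
    by (simp flip: mult.assoc of_int_mult)
qed

lemma Alt_add: "Alt n (\<lambda>w. F w + G w) v = Alt n F v + Alt n G v"
  by (simp add: Alt_def algebra_simps sum.distrib)

lemma Alt_cmult: "Alt n (\<lambda>w. c * F w) v = c * Alt n F v"
  by (simp add: Alt_def sum_distrib_left mult.left_commute)

lemma Alt_divide: "Alt n (\<lambda>w. F w / c) v = Alt n F v / c"
  by (simp add: Alt_def sum_divide_distrib)

lemma Alt_sum: "Alt n (\<lambda>w. \<Sum>x\<in>X. F x w) v = (\<Sum>x\<in>X. Alt n (F x) v)"
  by (simp add: Alt_def sum_distrib_left) (rule sum.swap)

text \<open>Each summand is a slot permutation of \<open>F\<close> weighted by its own sign. The two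
  signs cancel, so every element of \<open>Q\<close> contributes one copy of
  \<open>Alt n F v\<close>. Applied below to permutations of the first or of the last block of
  slots.\<close>

lemma Alt_sum_permutes:
  assumes "finite Q" "\<And>q. q \<in> Q \<Longrightarrow> r q permutes {..<n}"
  shows "Alt n (\<lambda>w. \<Sum>q\<in>Q. of_int (sign (r q)) * F (\<lambda>i. w (r q i))) v = card Q * Alt n F v"
proof -
  have "Alt n (\<lambda>w. \<Sum>q\<in>Q. of_int (sign (r q)) * F (\<lambda>i. w (r q i))) v =
      (\<Sum>q\<in>Q. of_int (sign (r q)) * (of_int (sign (r q)) * Alt n F v))"
    by (simp add: Alt_sum Alt_cmult Alt_permute_fun assms)
  then show ?thesis
    by (simp flip: mult.assoc of_int_mult)
qed

text \<open>The embedding of the permutations of m letters as those fixing the first k slots; it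
  acts on the arguments of the right factor of a wedge product.\<close>

definition shift_perm :: "nat \<Rightarrow> (nat \<Rightarrow> nat) \<Rightarrow> nat \<Rightarrow> nat" where
  "shift_perm k q i = (if i < k then i else k + q (i - k))"

lemma shift_perm_simps [simp]:
  "i < k \<Longrightarrow> shift_perm k q i = i" "shift_perm k q (k + i) = k + q i"
  by (auto simp: shift_perm_def)

lemma bij_betw_plus: "bij_betw ((+) k) {..<m} {k..<k + m :: nat}"
  by (rule bij_betw_byWitness[where f' = "\<lambda>i. i - k"]) auto

text \<open>Identifies the shifted permutation with the transport of \<open>q\<close> along
  \<open>(+) k\<close>, from which the permutation property and the sign are inherited.\<close>

lemma shift_perm_eq_map_permutation:
  assumes "q permutes {..<m}"
  shows "shift_perm k q = map_permutation {..<m} ((+) k) q"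
proof
  fix i
  consider "i < k" | j where "i = k + j" "j < m" | j where "i = k + j" "\<not> j < m"
    by (metis le_Suc_ex not_le_imp_less)
  then show "shift_perm k q i = map_permutation {..<m} ((+) k) q i"
  proof cases
    case 1
    then show ?thesis by (auto simp: map_permutation_def restrict_id_def)
  next
    case 2
    then show ?thesis by (simp add: map_permutation_apply inj_on_def)
  next
    case 3
    then show ?thesis using permutes_not_in[OF assms, of j]
      by (auto simp: map_permutation_def restrict_id_def)
  qed
qed

lemma shift_perm_permutes:
  assumes "q permutes {..<m}"
  shows "shift_perm k q permutes {k..<k + m}" "shift_perm k q permutes {..<k + m}"
proof -
  show *: "shift_perm k q permutes {k..<k + m}"
    unfolding shift_perm_eq_map_permutation[OF assms]
    by (rule map_permutation_permutes[OF bij_betw_plus assms])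
  show "shift_perm k q permutes {..<k + m}"
    by (rule permutes_subset[OF *]) auto
qed

lemma sign_shift_perm:
  assumes "q permutes {..<m}"
  shows "sign (shift_perm k q) = sign q"
  unfolding shift_perm_eq_map_permutation[OF assms]
  by (rule sign_map_permutation) (use assms in \<open>auto simp: inj_on_def\<close>)

lemma sum_shift_perm:
  "(\<Sum>p | p permutes {k..<k + m}. f p) = (\<Sum>q | q permutes {..<m}. f (shift_perm k q))"
proof -
  have "(\<Sum>q | q permutes {..<m}.
      f (\<lambda>x. if x \<in> {k..<k + m} then k + q (inv_into {..<m} ((+) k) x) else x)) =
      (\<Sum>p | p permutes {k..<k + m}. f p)"
    by (rule sum.reindex_bij_betw[OF bij_betw_permutations[OF bij_betw_plus]])
  moreover have "(\<lambda>x. if x \<in> {k..<k + m} then k + q (inv_into {..<m} ((+) k) x) else x) = shift_perm k q"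
    if "q permutes {..<m}" for q
    unfolding shift_perm_eq_map_permutation[OF that]
    by (rule ext) (use bij_betw_imp_surj_on[OF bij_betw_plus[of k m]] in
        \<open>auto simp: map_permutation_def restrict_id_def\<close>)
  ultimately show ?thesis
    by simp
qed

text \<open>Nested antisymmetrisations collapse; this is what makes the wedge product associative.\<close>

lemma Alt_Alt_left:
  "Alt (k + m) (\<lambda>w. Alt k F w * c (\<lambda>i. w (k + i))) v
     = fact k * Alt (k + m) (\<lambda>w. F w * c (\<lambda>i. w (k + i))) v"
proof -
  let ?Q = "{q. q permutes {..<k}}"
  have "(\<lambda>w. Alt k F w * c (\<lambda>i. w (k + i))) =
     (\<lambda>w. \<Sum>q\<in>?Q. of_int (sign q) * (F (\<lambda>i. w (q i)) * c (\<lambda>i. w (q (k + i)))))"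
    by (auto simp: Alt_def sum_distrib_right permutes_not_in mult.assoc intro!: sum.cong ext)
  moreover have "q permutes {..<k + m}" if "q \<in> ?Q" for q
    using that by (auto intro: permutes_subset)
  ultimately show ?thesis
    using Alt_sum_permutes[of ?Q "\<lambda>q. q" "k + m" "\<lambda>w. F w * c (\<lambda>i. w (k + i))" v]
    by (simp add: finite_permutations card_permutations)
qed

text \<open>Shifted permutations move only the arguments of the right factor; the hypothesis says
  that \<open>a\<close> does not look at these.\<close>

lemma Alt_Alt_right:
  assumes a: "\<And>v w. (\<And>i. i < k \<Longrightarrow> v i = w i) \<Longrightarrow> a v = a w"
  shows "Alt (k + m) (\<lambda>w. a w * Alt m G (\<lambda>i. w (k + i))) v
     = fact m * Alt (k + m) (\<lambda>w. a w * G (\<lambda>i. w (k + i))) v"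
proof -
  let ?Q = "{q. q permutes {..<m}}"
  have "a (\<lambda>i. w (shift_perm k q i)) = a w" for w q
    by (rule a) simp
  then have "(\<lambda>w. a w * Alt m G (\<lambda>i. w (k + i))) =
     (\<lambda>w. \<Sum>q\<in>?Q. of_int (sign (shift_perm k q)) *
        (a (\<lambda>i. w (shift_perm k q i)) * G (\<lambda>i. w (shift_perm k q (k + i)))))"
    by (auto simp: Alt_def sum_distrib_left sign_shift_perm mult.assoc mult.left_commute
        intro!: sum.cong ext)
  then show ?thesis
    using Alt_sum_permutes[of ?Q "shift_perm k" "k + m" "\<lambda>w. a w * G (\<lambda>i. w (k + i))" v]
    by (auto simp: finite_permutations card_permutations shift_perm_permutes)
qed

text \<open>Both sides equal one antisymmetrisation of the triple tensor product, divided by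
  \<open>fact k * fact l * fact m\<close>.\<close>

lemma wedge_assoc:
  assumes "\<And>v w. (\<And>i. i < k \<Longrightarrow> v i = w i) \<Longrightarrow> a v = a w"
  shows "wedge (k + l) m (wedge k l a b) c = wedge k (l + m) a (wedge l m b c)"
proof
  fix v
  have "wedge (k + l) m (wedge k l a b) c v =
     Alt (k + l + m) (\<lambda>w. a w * b (\<lambda>i. w (k + i)) * c (\<lambda>i. w (k + l + i))) v
       / (fact k * fact l * fact m)"
    by (simp add: wedge_Alt Alt_divide Alt_Alt_left)
  also have "\<dots> = wedge k (l + m) a (wedge l m b c) v"
    using Alt_Alt_right[of k a "l + m" "\<lambda>w. b w * c (\<lambda>i. w (l + i))" v, OF assms]
    by (simp add: wedge_Alt Alt_divide add.assoc mult.assoc)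
  finally show "wedge (k + l) m (wedge k l a b) c v = wedge k (l + m) a (wedge l m b c) v" .
qed

subsection \<open>Expansion along the first argument\<close>

definition omit :: "nat \<Rightarrow> (nat \<Rightarrow> 'v) \<Rightarrow> nat \<Rightarrow> 'v" where
  "omit i v j = (if j < i then v j else v (Suc j))"

text \<open>The cycle that pulls entry i to position 0 and keeps the order of the others; it is a
  product of i adjacent transpositions.\<close>

definition front :: "nat \<Rightarrow> nat \<Rightarrow> nat" where
  "front i j = (case j of 0 \<Rightarrow> i | Suc m \<Rightarrow> if m < i then m else j)"

lemma front_simps [simp]: "front i 0 = i"
  "front i (Suc j) = (if j < i then j else Suc j)"
  by (auto simp: front_def)

lemma front_Suc: "front (Suc i) = Transposition.transpose i (Suc i) \<circ> front i"
  by (auto simp: fun_eq_iff front_def Transposition.transpose_def split: nat.split)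

lemma front_permutes: "i < n \<Longrightarrow> front i permutes {..<n}"
proof (induction i)
  case 0
  have "front 0 = id" by (auto simp: fun_eq_iff front_def split: nat.split)
  then show ?case by (simp only: permutes_id)
next
  case (Suc i)
  then show ?case unfolding front_Suc
    by (intro permutes_compose permutes_swap_id) auto
qed

lemma sign_front: "sign (front i) = (-1) ^ i"
proof (induction i)
  case 0
  have "front 0 = id" by (auto simp: fun_eq_iff front_def split: nat.split)
  then show ?case by simp
next
  case (Suc i)
  have "permutation (front i)"
    using front_permutes[of i "Suc i"] by (metis lessI permutation_permutes finite_lessThan)
  then have "sign (front (Suc i)) = sign (Transposition.transpose i (Suc i)) * sign (front i)"
    unfolding front_Suc by (intro sign_compose permutation_swap_id)
  then show ?case
    by (simp add: sign_swap_id Suc)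
qed

text \<open>Laplace expansion: the permutations are split by the image of 0. The coset
  representatives at hand are the transpositions of 0 and b; they are replaced by the cycles
  \<open>front b\<close>, which leave the remaining arguments in the order that \<open>omit\<close>
  gives them.\<close>

lemma Alt_Suc:
  "Alt (Suc n) F v = (\<Sum>i\<le>n. (-1) ^ i * Alt n (\<lambda>w. F (case_nat (v i) w)) (omit i v))"
proof -
  let ?f = "\<lambda>p. of_int (sign p) * F (\<lambda>i. v (p i))"
  let ?S = "{1..<1 + n}"
  have ins: "{..<Suc n} = insert 0 ?S" by auto
  have "Alt (Suc n) F v = (\<Sum>b\<in>insert 0 ?S. \<Sum>q | q permutes ?S. ?f (Transposition.transpose 0 b \<circ> q))"
    unfolding Alt_def ins by (rule sum_over_permutations_insert) auto
  also have "\<dots> = (\<Sum>b\<le>n. \<Sum>q | q permutes ?S. ?f (Transposition.transpose 0 b \<circ> q))"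
    by (rule sum.cong) auto
  also have "\<dots> = (\<Sum>b\<le>n. \<Sum>q | q permutes ?S. ?f (front b \<circ> q))"
  proof (rule sum.cong[OF refl])
    fix b assume "b \<in> {..n}"
    \<comment> \<open>\<open>r\<close> fixes 0, since \<open>front b\<close> sends 0 to b and the
      transposition sends b back. Hence it permutes the other slots, and the inner sum absorbs the
      change of coset representative.\<close>
    define r where "r = Transposition.transpose 0 b \<circ> front b"
    have "r permutes insert 0 ?S"
      unfolding r_def using \<open>b \<in> {..n}\<close>
      by (intro permutes_compose front_permutes[of b "Suc n", unfolded ins] permutes_swap_id) auto
    then have "r permutes ?S"
      by (rule permutes_superset) (auto simp: r_def)
    then have "(\<Sum>q | q permutes ?S. ?f (Transposition.transpose 0 b \<circ> q)) =
        (\<Sum>q | q permutes ?S. ?f (Transposition.transpose 0 b \<circ> (r \<circ> q)))"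
      by (rule setum_permutations_compose_left[where f = "\<lambda>q. ?f (Transposition.transpose 0 b \<circ> q)"])
    moreover have "Transposition.transpose 0 b \<circ> (r \<circ> q) = front b \<circ> q" for q :: "nat \<Rightarrow> nat"
      by (simp add: r_def fun_eq_iff)
    ultimately show "(\<Sum>q | q permutes ?S. ?f (Transposition.transpose 0 b \<circ> q)) = (\<Sum>q | q permutes ?S. ?f (front b \<circ> q))"
      by (simp only:)
  qed
  also have "\<dots> = (\<Sum>b\<le>n. \<Sum>q | q permutes {..<n}. ?f (front b \<circ> shift_perm 1 q))"
    by (rule sum.cong[OF refl sum_shift_perm])
  also have "\<dots> = (\<Sum>i\<le>n. (-1) ^ i * Alt n (\<lambda>w. F (case_nat (v i) w)) (omit i v))"
  proof (rule sum.cong[OF refl])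
    fix b assume b: "b \<in> {..n}"
    have "?f (front b \<circ> shift_perm 1 q) =
      (-1) ^ b * (of_int (sign q) * F (case_nat (v b) (\<lambda>i. omit b v (q i))))"
      if q: "q permutes {..<n}" for q
    proof -
      have "sign (front b \<circ> shift_perm 1 q) = (-1) ^ b * sign q"
        using b front_permutes[of b "Suc n"] shift_perm_permutes(2)[OF q, of 1]
        by (simp add: sign_comp_permutes sign_front sign_shift_perm[OF q])
      moreover have "(\<lambda>i. v ((front b \<circ> shift_perm 1 q) i)) = case_nat (v b) (\<lambda>i. omit b v (q i))"
        by (auto simp: fun_eq_iff omit_def shift_perm_def split: nat.split)
      ultimately show ?thesis by simp
    qed
    then show "(\<Sum>q | q permutes {..<n}. ?f (front b \<circ> shift_perm 1 q)) =
       (-1) ^ b * Alt n (\<lambda>w. F (case_nat (v b) w)) (omit b v)"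
      by (auto simp: Alt_def sum_distrib_left intro!: sum.cong)
  qed
  finally show ?thesis .
qed

text \<open>Only the first argument of \<open>a\<close> is expanded. Over all stages the divisions
  by \<open>Suc k\<close> remove the repeated orderings of the arguments of
  \<open>a\<close>.\<close>

lemma wedge_Suc:
  "wedge (Suc k) l a b v =
     (\<Sum>i\<le>k + l. (-1) ^ i * wedge k l (\<lambda>w. a (case_nat (v i) w)) b (omit i v)) / Suc k"
  by (simp add: wedge_Alt Alt_Suc sum_divide_distrib ac_simps)

lemma Alt_eq_fact_mult:
  assumes "\<And>p. p permutes {..<n} \<Longrightarrow> F (\<lambda>i. v (p i)) = of_int (sign p) * F v"
  shows "Alt n F v = fact n * F v"
proof -
  have "Alt n F v = (\<Sum>p | p permutes {..<n}. F v)"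
    unfolding Alt_def by (rule sum.cong) (auto simp: assms simp flip: mult.assoc of_int_mult)
  then show ?thesis by (simp add: card_permutations)
qed

subsection \<open>Alternating forms\<close>

text \<open>The part of \<open>alternating_form\<close> that survives tensor products, which are
  what \<open>Alt\<close> is applied to.\<close>

definition multilinear_form :: "nat \<Rightarrow> ((nat \<Rightarrow> 'v::real_vector) \<Rightarrow> real) \<Rightarrow> bool" where
  "multilinear_form n F \<longleftrightarrow> (\<forall>v w. (\<forall>i<n. v i = w i) \<longrightarrow> F v = F w) \<and>
     (\<forall>v. \<forall>i<n. linear (\<lambda>x. F (v(i := x))))"

lemma multilinear_form_cong:
  "multilinear_form n F \<Longrightarrow> (\<And>i. i < n \<Longrightarrow> v i = w i) \<Longrightarrow> F v = F w"
  by (auto simp: multilinear_form_def)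

lemma multilinear_form_linear:
  "multilinear_form n F \<Longrightarrow> i < n \<Longrightarrow> linear (\<lambda>x. F (v(i := x)))"
  by (auto simp: multilinear_form_def)

lemma alternating_form_iff:
  "alternating_form k a \<longleftrightarrow> multilinear_form k a \<and>
     (\<forall>v. \<forall>i<k. \<forall>j<k. i \<noteq> j \<and> v i = v j \<longrightarrow> a v = 0)"
  by (auto simp: alternating_form_def multilinear_form_def)

lemma alternating_imp_multilinear: "alternating_form k a \<Longrightarrow> multilinear_form k a"
  by (simp add: alternating_form_iff)

lemma alternating_form_eq_0:
  "alternating_form k a \<Longrightarrow> i < k \<Longrightarrow> j < k \<Longrightarrow> i \<noteq> j \<Longrightarrow> v i = v j \<Longrightarrow> a v = 0"
  by (auto simp: alternating_form_iff)

lemma linear_cmult_left: "linear f \<Longrightarrow> linear (\<lambda>x. c * f x :: real)"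
  by (auto simp: linear_iff algebra_simps)

lemma linear_cmult_right: "linear f \<Longrightarrow> linear (\<lambda>x. f x * c :: real)"
  by (auto simp: linear_iff algebra_simps)

lemma alternating_form_Alt:
  assumes F: "multilinear_form n F"
  shows "alternating_form n (Alt n F)"
  unfolding alternating_form_iff multilinear_form_def
proof (intro conjI allI impI)
  fix v w :: "nat \<Rightarrow> complex^3" assume vw: "\<forall>i<n. v i = w i"
  have "F (\<lambda>i. v (p i)) = F (\<lambda>i. w (p i))" if "p permutes {..<n}" for p
    by (rule multilinear_form_cong[OF F]) (use vw permutes_in_image[OF that] in auto)
  then show "Alt n F v = Alt n F w"
    by (simp add: Alt_def)
next
  fix v :: "nat \<Rightarrow> complex^3" and i assume i: "i < n"
  \<comment> \<open>Slot i of \<open>v\<close> is read by slot \<open>inv p i\<close> of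
    \<open>F\<close>.\<close>
  have *: "(\<lambda>j. (v(i := x)) (p j)) = (\<lambda>j. v (p j))(inv p i := x)" if "p permutes {..<n}" for p x
    using permutes_inverses[OF that] by (auto simp: fun_eq_iff)
  have "linear (\<lambda>x. F ((\<lambda>j. v (p j))(inv p i := x)))" if p: "p permutes {..<n}" for p
    by (rule multilinear_form_linear[OF F])
      (use i permutes_in_image[OF permutes_inv[OF p], of i] in auto)
  then have "linear (\<lambda>x. \<Sum>p | p permutes {..<n}. of_int (sign p) * F ((\<lambda>j. v (p j))(inv p i := x)))"
    by (intro linear_compose_sum ballI linear_cmult_left) simp
  moreover have "Alt n F (v(i := x)) =
      (\<Sum>p | p permutes {..<n}. of_int (sign p) * F ((\<lambda>j. v (p j))(inv p i := x)))" for x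
    unfolding Alt_def by (rule sum.cong) (simp_all only: * mem_Collect_eq)
  ultimately show "linear (\<lambda>x. Alt n F (v(i := x)))"
    by (simp only:)
next
  fix v :: "nat \<Rightarrow> complex^3" and i j assume ij: "i < n" "j < n" "i \<noteq> j \<and> v i = v j"
  \<comment> \<open>The transposition of the two equal arguments fixes \<open>v\<close> but has sign
    -1, so the value equals its own negative.\<close>
  have "(\<lambda>m. v (Transposition.transpose i j m)) = v"
    using ij by (auto simp: fun_eq_iff Transposition.transpose_def)
  then show "Alt n F v = 0"
    using Alt_permute_args[of "Transposition.transpose i j" n F v] ij
    by (simp add: permutes_swap_id sign_swap_id)
qed

lemma multilinear_form_tensor:
  assumes a: "multilinear_form k a" and b: "multilinear_form l b"
  shows "multilinear_form (k + l) (\<lambda>w. a w * b (\<lambda>i. w (k + i)))"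
  unfolding multilinear_form_def
proof (intro conjI allI impI)
  fix v w :: "nat \<Rightarrow> 'a" assume "\<forall>i<k + l. v i = w i"
  then show "a v * b (\<lambda>i. v (k + i)) = a w * b (\<lambda>i. w (k + i))"
    using multilinear_form_cong[OF a, of v w]
      multilinear_form_cong[OF b, of "\<lambda>i. v (k + i)" "\<lambda>i. w (k + i)"] by simp
next
  fix v :: "nat \<Rightarrow> 'a" and i assume i: "i < k + l"
  show "linear (\<lambda>x. a (v(i := x)) * b (\<lambda>j. (v(i := x)) (k + j)))"
  proof (cases "i < k")
    case True
    then have "(\<lambda>j. (v(i := x)) (k + j)) = (\<lambda>j. v (k + j))" for x
      by auto
    then show ?thesis
      using linear_cmult_right[OF multilinear_form_linear[OF a True]] by simp
  next
    case False
    then have "(\<lambda>j. (v(i := x)) (k + j)) = (\<lambda>j. v (k + j))(i - k := x)" for x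
      by (auto simp: fun_eq_iff)
    moreover have "a (v(i := x)) = a v" for x
      using False by (intro multilinear_form_cong[OF a]) auto
    ultimately show ?thesis
      using linear_cmult_left[OF multilinear_form_linear[OF b], of "i - k"] False i by simp
  qed
qed

lemma multilinear_form_cmult: "multilinear_form k a \<Longrightarrow> multilinear_form k (\<lambda>v. c * a v)"
  unfolding multilinear_form_def by (intro conjI allI impI linear_cmult_left) auto

lemma alternating_form_cmult: "alternating_form k a \<Longrightarrow> alternating_form k (\<lambda>v. c * a v)"
  unfolding alternating_form_iff by (auto intro!: multilinear_form_cmult)

lemma alternating_form_add:
  "alternating_form k a \<Longrightarrow> alternating_form k b \<Longrightarrow> alternating_form k (\<lambda>v. a v + b v)"
  unfolding alternating_form_iff multilinear_form_def
  by (intro conjI allI impI linear_compose_add) (simp_all add: alternating_form_def, metis)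

lemma alternating_form_uminus: "alternating_form k a \<Longrightarrow> alternating_form k (\<lambda>v. - a v)"
  using alternating_form_cmult[of k a "-1"] by simp

lemma alternating_form_diff:
  "alternating_form k a \<Longrightarrow> alternating_form k b \<Longrightarrow> alternating_form k (\<lambda>v. a v - b v)"
  using alternating_form_add[OF _ alternating_form_uminus, of k a b] by simp

lemma alternating_form_zero: "alternating_form k (\<lambda>v. 0)"
  by (auto simp: alternating_form_def linear_iff)

lemma alternating_form_wedge:
  assumes "multilinear_form k a" "multilinear_form l b"
  shows "alternating_form (k + l) (wedge k l a b)"
proof -
  have *: "wedge k l a b =
      (\<lambda>v. (1 / (fact k * fact l)) * Alt (k + l) (\<lambda>w. a w * b (\<lambda>i. w (k + i))) v)"
    by (simp add: wedge_Alt fun_eq_iff)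
  show ?thesis
    unfolding * by (rule alternating_form_cmult[OF alternating_form_Alt[OF multilinear_form_tensor[OF assms]]])
qed

text \<open>Polarisation: vanishing on repeated arguments, applied to the sum of the two entries,
  gives antisymmetry.\<close>

lemma alternating_form_swap:
  assumes a: "alternating_form k a" and ij: "i < k" "j < k" "i \<noteq> j"
  shows "a (\<lambda>m. v (Transposition.transpose i j m)) = - a v"
proof -
  define f where "f x y = a (v(i := x, j := y))" for x y
  have lin1: "linear (\<lambda>x. f x y)" for y
  proof -
    have "(\<lambda>x. f x y) = (\<lambda>x. a ((v(j := y))(i := x)))"
      using ij by (simp add: f_def fun_upd_twist)
    then show ?thesis
      using multilinear_form_linear[OF alternating_imp_multilinear[OF a] ij(1)] by metis
  qed
  have lin2: "linear (\<lambda>y. f x y)" for x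
    unfolding f_def by (rule multilinear_form_linear[OF alternating_imp_multilinear[OF a] ij(2)])
  have diag: "f x x = 0" for x
    unfolding f_def by (rule alternating_form_eq_0[OF a ij]) (use ij in simp)
  have "0 = f (v i + v j) (v i + v j)"
    by (simp add: diag)
  also have "\<dots> = f (v i) (v j) + f (v j) (v i)"
    unfolding linear_add[OF lin1] linear_add[OF lin2] diag[of "v i"] diag[of "v j"] by simp
  finally have "f (v j) (v i) = - f (v i) (v j)" by simp
  moreover have "v(i := v j, j := v i) = (\<lambda>m. v (Transposition.transpose i j m))"
    by (auto simp: fun_eq_iff Transposition.transpose_def)
  ultimately show ?thesis by (simp add: f_def)
qed

lemma alternating_form_permute:
  assumes a: "alternating_form k a" and p: "p permutes {..<k}"
  shows "a (\<lambda>i. v (p i)) = of_int (sign p) * a v"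
  using p finite_lessThan
proof (induction arbitrary: v rule: permutes_induct)
  case id
  then show ?case by simp
next
  case (swap x y p)
  have "sign (Transposition.transpose x y \<circ> p) = - sign p"
    using swap sign_comp_permutes[of "Transposition.transpose x y" k p] by (simp add: permutes_swap_id sign_swap_id)
  moreover have "a (\<lambda>i. v ((Transposition.transpose x y \<circ> p) i)) =
      of_int (sign p) * a (\<lambda>m. v (Transposition.transpose x y m))"
    using swap.IH[of "\<lambda>m. v (Transposition.transpose x y m)"] by simp
  ultimately show ?case
    using alternating_form_swap[OF a, of x y v] swap(1-3) by (simp only: of_int_minus) simp
qed

lemma Alt_alternating_form: "alternating_form k a \<Longrightarrow> Alt k a v = fact k * a v"
  by (rule Alt_eq_fact_mult) (rule alternating_form_permute)

text \<open>Arguments are freed from \<open>B\<close> one slot at a time, by linearity in that slot;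
  \<open>m\<close> counts the slots that are already arbitrary.\<close>

lemma multilinear_form_eq_0:
  assumes s: "multilinear_form k s" and B: "span B = UNIV"
    and 0: "\<And>v. (\<And>i. i < k \<Longrightarrow> v i \<in> B) \<Longrightarrow> s v = 0"
  shows "s v = 0"
proof -
  have "\<forall>v. (\<forall>i. m \<le> i \<and> i < k \<longrightarrow> v i \<in> B) \<longrightarrow> s v = 0" if "m \<le> k" for m
    using that
  proof (induction m)
    case (Suc m)
    show ?case
    proof (intro allI impI)
      fix v assume v: "\<forall>i. Suc m \<le> i \<and> i < k \<longrightarrow> v i \<in> B"
      have "linear (\<lambda>x. s (v(m := x)))"
        using Suc.prems by (intro multilinear_form_linear[OF s]) auto
      moreover have "s (v(m := x)) = 0" if "x \<in> B" for x
        using Suc v that by (auto simp: not_less_eq_eq le_less_Suc_eq Suc_le_eq)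
      ultimately have "s (v(m := v m)) = 0"
        using linear_eq_0_on_span[of "\<lambda>x. s (v(m := x))" B "v m"] B by auto
      then show "s v = 0" by simp
    qed
  qed (use 0 in auto)
  then show ?thesis by fastforce
qed

text \<open>Components are indexed by lists so that they can be computed by rewriting on literal
  lists. An out-of-range \<open>xs ! i\<close> is unspecified, but a form of degree
  \<open>length xs\<close> never reads it.\<close>

definition eval_frame :: "(nat \<Rightarrow> 'v) \<Rightarrow> ((nat \<Rightarrow> 'v) \<Rightarrow> real) \<Rightarrow> nat list \<Rightarrow> real" where
  "eval_frame e a xs = a (\<lambda>i. e (xs ! i))"

lemma alternating_form_eq_0_frame:
  assumes s: "alternating_form k s" and e: "span (e ` {..<n}) = UNIV"
    and 0: "\<And>xs. length xs = k \<Longrightarrow> distinct xs \<Longrightarrow> set xs \<subseteq> {..<n} \<Longrightarrow> eval_frame e s xs = 0"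
  shows "s v = 0"
proof (rule multilinear_form_eq_0[OF alternating_imp_multilinear[OF s] e])
  fix v assume "\<And>i. i < k \<Longrightarrow> v i \<in> e ` {..<n}"
  then obtain f where f: "\<And>i. i < k \<Longrightarrow> f i < n \<and> v i = e (f i)"
    unfolding image_iff by (metis lessThan_iff)
  define xs where "xs = map f [0..<k]"
  have v: "s v = eval_frame e s xs"
    unfolding eval_frame_def xs_def
    by (rule multilinear_form_cong[OF alternating_imp_multilinear[OF s]]) (use f in auto)
  show "s v = 0"
  proof (cases "distinct xs")
    case True
    then show ?thesis unfolding v using f by (intro 0) (auto simp: xs_def)
  next
    case False
    then obtain i j where "i < k" "j < k" "i \<noteq> j" "f i = f j"
      by (auto simp: distinct_conv_nth xs_def)
    then show ?thesis
      using f by (intro alternating_form_eq_0[OF s, of i j]) auto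
  qed
qed

lemma eval_frame_distinct:
  assumes s: "alternating_form n s"
    and xs: "length xs = n" "distinct xs" "set xs \<subseteq> {..<n}"
  obtains p where "p permutes {..<n}" "eval_frame e s xs = of_int (sign p) * s e"
proof -
  define p where "p i = (if i < n then xs ! i else i)" for i
  have "inj_on p {..<n}"
    using xs by (auto simp: p_def inj_on_def nth_eq_iff_index_eq)
  moreover have "p ` {..<n} \<subseteq> {..<n}"
    using xs nth_mem by (force simp: p_def)
  ultimately have "bij_betw p {..<n} {..<n}"
    using endo_inj_surj[of "{..<n}" p] by (auto simp: bij_betw_def)
  then have p: "p permutes {..<n}"
    by (rule bij_imp_permutes) (auto simp: p_def)
  have "eval_frame e s xs = s (\<lambda>i. e (p i))"
    unfolding eval_frame_def
    by (rule multilinear_form_cong[OF alternating_imp_multilinear[OF s]]) (simp add: p_def)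
  then show ?thesis
    using that[OF p] alternating_form_permute[OF s p, of e] by simp
qed

text \<open>The space of top forms is one-dimensional: on a list of distinct frame indices the value
  is, up to sign, the value on the frame itself.\<close>

lemma top_form_eq:
  assumes s: "alternating_form n s" and t: "alternating_form n t"
    and e: "span (e ` {..<n}) = UNIV" and eq: "s e = t e"
  shows "s = t"
proof
  fix v
  have d: "alternating_form n (\<lambda>v. s v - t v)"
    by (rule alternating_form_diff[OF s t])
  have "s v - t v = 0"
  proof (rule alternating_form_eq_0_frame[OF d e])
    fix xs assume xs: "length xs = n" "distinct xs" "set xs \<subseteq> {..<n}"
    obtain p where "p permutes {..<n}"
      "eval_frame e (\<lambda>v. s v - t v) xs = of_int (sign p) * (s e - t e)"
      by (rule eval_frame_distinct[OF d xs])
    then show "eval_frame e (\<lambda>v. s v - t v) xs = 0"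
      using eq by simp
  qed
  then show "s v = t v" by simp
qed

subsection \<open>Evaluation of wedge products on a frame\<close>

definition delete_nth :: "nat \<Rightarrow> 'b list \<Rightarrow> 'b list" where
  "delete_nth i xs = take i xs @ drop (Suc i) xs"

text \<open>The expansion \<open>wedge_Suc\<close> transported to components. The base case takes
  \<open>B\<close> as it stands, which is right when the second form is already alternating.\<close>

primrec wedge_list :: "nat \<Rightarrow> (nat list \<Rightarrow> real) \<Rightarrow> (nat list \<Rightarrow> real) \<Rightarrow> nat list \<Rightarrow> real" where
  "wedge_list 0 A B xs = A [] * B xs"
| "wedge_list (Suc k) A B xs =
     (\<Sum>i<length xs. (-1) ^ i * wedge_list k (\<lambda>ys. A (xs ! i # ys)) B (delete_nth i xs)) / Suc k"

lemma wedge_cong_args: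
  assumes "multilinear_form k a" "multilinear_form l b" "\<And>i. i < k + l \<Longrightarrow> v i = w i"
  shows "wedge k l a b v = wedge k l a b w"
  by (rule multilinear_form_cong[OF alternating_imp_multilinear[OF alternating_form_wedge]])
    (use assms in auto)

lemma multilinear_form_case_nat:
  assumes a: "multilinear_form (Suc k) a"
  shows "multilinear_form k (\<lambda>w. a (case_nat x w))"
  unfolding multilinear_form_def
proof (intro conjI allI impI)
  fix v w :: "nat \<Rightarrow> 'a" assume "\<forall>i<k. v i = w i"
  then show "a (case_nat x v) = a (case_nat x w)"
    by (intro multilinear_form_cong[OF a]) (auto split: nat.split)
next
  fix v :: "nat \<Rightarrow> 'a" and i assume i: "i < k"
  have "case_nat x (v(i := y)) = (case_nat x v)(Suc i := y)" for y
    by (auto simp: fun_eq_iff split: nat.split)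
  then show "linear (\<lambda>y. a (case_nat x (v(i := y))))"
    using multilinear_form_linear[OF a, of "Suc i" "case_nat x v"] i by simp
qed

lemma eval_frame_wedge:
  assumes "multilinear_form k a" "alternating_form l b" "length xs = k + l"
  shows "eval_frame e (wedge k l a b) xs = wedge_list k (eval_frame e a) (eval_frame e b) xs"
  using assms
proof (induction k arbitrary: a xs)
  case 0
  \<comment> \<open>A 0-form is constant in its arguments, and antisymmetrising the alternating
    \<open>b\<close> gives \<open>fact l\<close> copies, which cancel the normalisation.\<close>
  have "a (\<lambda>w. e (xs ! p w)) = a (\<lambda>i. e ([] ! i))" for p
    by (rule multilinear_form_cong[OF 0(1)]) simp
  then show ?case
    using Alt_alternating_form[OF 0(2), of "\<lambda>i. e (xs ! i)"]
    by (simp add: eval_frame_def wedge_Alt Alt_def mult.left_commute[of _ "a _"] flip: sum_distrib_left)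
next
  case (Suc k)
  have "wedge k l (\<lambda>w. a (case_nat (e (xs ! i)) w)) b (omit i (\<lambda>j. e (xs ! j))) =
      wedge_list k (\<lambda>ys. eval_frame e a (xs ! i # ys)) (eval_frame e b) (delete_nth i xs)"
    if i: "i \<le> k + l" for i
  proof -
    have "wedge k l (\<lambda>w. a (case_nat (e (xs ! i)) w)) b (omit i (\<lambda>j. e (xs ! j))) =
       eval_frame e (wedge k l (\<lambda>w. a (case_nat (e (xs ! i)) w)) b) (delete_nth i xs)"
      unfolding eval_frame_def
      by (rule wedge_cong_args)
        (use Suc.prems i in \<open>auto simp: omit_def delete_nth_def nth_append multilinear_form_case_nat
            alternating_imp_multilinear\<close>)
    also have "\<dots> = wedge_list k (eval_frame e (\<lambda>w. a (case_nat (e (xs ! i)) w))) (eval_frame e b)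
        (delete_nth i xs)"
      using Suc.prems i by (intro Suc.IH) (auto simp: multilinear_form_case_nat delete_nth_def)
    also have "eval_frame e (\<lambda>w. a (case_nat (e (xs ! i)) w)) = (\<lambda>ys. eval_frame e a (xs ! i # ys))"
    proof
      fix ys
      have "case_nat (e (xs ! i)) (\<lambda>j. e (ys ! j)) = (\<lambda>j. e ((xs ! i # ys) ! j))"
        by (auto simp: fun_eq_iff split: nat.split)
      then show "eval_frame e (\<lambda>w. a (case_nat (e (xs ! i)) w)) ys = eval_frame e a (xs ! i # ys)"
        by (simp add: eval_frame_def)
    qed
    finally show ?thesis .
  qed
  moreover have "{..k + l} = {..<length xs}" using Suc.prems by auto
  ultimately show ?case
    unfolding eval_frame_def[of e "wedge (Suc k) l a b" xs]
    unfolding wedge_Suc wedge_list.simps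
    by (intro arg_cong2[where f = "(/)"] sum.cong) auto
qed

subsection \<open>Unitary frames\<close>

lemma hermitian_innerD:
  assumes "hermitian_inner g"
  shows "bilinear g" "g v w = g w v" "v \<noteq> 0 \<Longrightarrow> g v v > 0" "g (\<i> *s v) (\<i> *s w) = g v w"
  using assms by (auto simp: hermitian_inner_def)

lemma i_smult_linear: "linear (\<lambda>v::complex^3. \<i> *s v)"
  by (auto simp: linear_iff vec_eq_iff algebra_simps scaleR_conv_of_real)

lemma i_smult_i_smult [simp]: "\<i> *s (\<i> *s v) = - (v::complex^3)"
  by (simp add: vec_eq_iff)

lemma linear_eq_inner:
  fixes f :: "'v::euclidean_space \<Rightarrow> real"
  assumes "linear f"
  shows "f x = (\<Sum>b\<in>Basis. f b *\<^sub>R b) \<bullet> x"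
proof -
  have "f x = f (\<Sum>b\<in>Basis. (x \<bullet> b) *\<^sub>R b)"
    by (simp add: euclidean_representation)
  also have "\<dots> = (\<Sum>b\<in>Basis. (x \<bullet> b) * f b)"
    by (simp add: linear_sum[OF assms] linear_cmul[OF assms])
  finally show ?thesis
    by (simp add: inner_sum_left mult.commute inner_commute[of x])
qed

text \<open>Dimension count: the vectors \<open>L w\<close>, which represent g(w, .) in the
  Euclidean inner product, span fewer than six real dimensions, so some nonzero vector is orthogonal
  to all of them.\<close>

lemma exists_unit_orthogonal:
  assumes g: "hermitian_inner g" and W: "finite W" "card W < 6"
  obtains u where "g u u = 1" "\<And>w. w \<in> W \<Longrightarrow> g w u = 0"
proof -
  define L where "L w = (\<Sum>b\<in>Basis. g w b *\<^sub>R b)" for w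
  have L: "g w x = L w \<bullet> x" for w x
    unfolding L_def using hermitian_innerD(1)[OF g]
    by (intro linear_eq_inner) (auto simp: bilinear_def)
  have "dim (L ` W) \<le> card W"
    using W by (meson card_image_le dim_le_card' finite_imageI order_trans)
  then have "dim (L ` W) < DIM(complex^3)"
    using W by simp
  then obtain x where x: "x \<noteq> 0" "\<And>y. y \<in> span (L ` W) \<Longrightarrow> orthogonal x y"
    by (metis orthogonal_to_subspace_exists)
  define u where "u = (1 / sqrt (g x x)) *\<^sub>R x"
  have "g u u = 1"
    using hermitian_innerD(3)[OF g x(1)] hermitian_innerD(1)[OF g]
    by (simp add: u_def bilinear_lmul bilinear_rmul)
  moreover have "g w u = 0" if "w \<in> W" for w
    using x(2)[of "L w"] that L[of w x] hermitian_innerD(1)[OF g]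
    by (simp add: u_def bilinear_rmul orthogonal_def inner_commute span_base)
  ultimately show ?thesis using that by blast
qed

lemma less_6_iff: "i < (6::nat) \<longleftrightarrow> i = 0 \<or> i = 1 \<or> i = 2 \<or> i = 3 \<or> i = 4 \<or> i = 5"
  by auto

definition unitary_frame :: "bform \<Rightarrow> (nat \<Rightarrow> complex^3) \<Rightarrow> bool" where
  "unitary_frame g e \<longleftrightarrow> orthonormal_frame g e \<and>
     e 1 = \<i> *s e 0 \<and> e 3 = \<i> *s e 2 \<and> e 5 = \<i> *s e 4"

text \<open>Complex Gram-Schmidt: a unit vector is chosen orthogonal to the earlier vectors and
  their multiples by \<i>. Its own multiple by \<i> then fits automatically, because multiplication
  by \<i> is an isometry and skew for \<open>g\<close>.\<close>

lemma exists_unitary_frame: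
  assumes g: "hermitian_inner g"
  obtains e where "unitary_frame g e"
proof -
  note bil = hermitian_innerD(1)[OF g]
  have sym: "g v w = g w v" and J: "g (\<i> *s v) (\<i> *s w) = g v w" for v w
    using hermitian_innerD[OF g] by auto
  have J2: "g v (\<i> *s w) = - g (\<i> *s v) w" for v w
    using J[of v "\<i> *s w"] by (simp add: bilinear_rneg[OF bil])
  have J0: "g (\<i> *s v) v = 0" for v
    using J2[of v v] sym[of v "\<i> *s v"] by simp
  obtain a where a: "g a a = 1"
    using exists_unit_orthogonal[OF g, of "{}"] by auto
  have "card {a, \<i> *s a} < 6"
    by (rule le_less_trans[OF card_insert_le_m1[of 2]]) (auto simp: card_insert_if)
  then obtain b where b: "g b b = 1" "\<And>w. w \<in> {a, \<i> *s a} \<Longrightarrow> g w b = 0"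
    using exists_unit_orthogonal[OF g, of "{a, \<i> *s a}"] by blast
  have "card {a, \<i> *s a, b, \<i> *s b} < 6"
    by (simp add: card_insert_if)
  then obtain c where c: "g c c = 1" "\<And>w. w \<in> {a, \<i> *s a, b, \<i> *s b} \<Longrightarrow> g w c = 0"
    using exists_unit_orthogonal[OF g, of "{a, \<i> *s a, b, \<i> *s b}"] by blast
  define e where "e = (\<lambda>i::nat. [a, \<i> *s a, b, \<i> *s b, c, \<i> *s c] ! i)"
  have zero: "g x y = 0 \<and> g y x = 0 \<and> g (\<i> *s x) y = 0 \<and> g (\<i> *s y) x = 0"
    if "g x y = 0" "g (\<i> *s x) y = 0" for x y
    using that sym[of y x] sym[of "\<i> *s y" x] J2[of x y] by simp
  have "orthonormal_frame g e"
    unfolding orthonormal_frame_def less_6_iff e_def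
    using a b(1) c(1) zero[of a b] zero[of a c] zero[of b c] b(2)[of a] b(2)[of "\<i> *s a"]
      c(2)[of a] c(2)[of "\<i> *s a"] c(2)[of b] c(2)[of "\<i> *s b"]
    by (simp add: J J2 J0 bilinear_lneg[OF bil])
  then show ?thesis
    using that[of e] by (simp add: unitary_frame_def e_def)
qed

lemma orthonormal_frame_expansion:
  assumes g: "hermitian_inner g" and e: "orthonormal_frame g e"
  shows "span (e ` {..<6}) = UNIV" "v = (\<Sum>i<6. g (e i) v *\<^sub>R e i)"
proof -
  note bil = hermitian_innerD(1)[OF g]
  have e': "g (e i) (e j) = (if i = j then 1 else 0)" if "i < 6" "j < 6" for i j
    using e that by (auto simp: orthonormal_frame_def)
  have lin: "linear (g x)" for x
    using bil by (auto simp: bilinear_def)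
  have inj: "inj_on e {..<6}"
    by (rule inj_onI) (metis e' lessThan_iff zero_neq_one)
  have "independent (e ` {..<6})"
  proof (rule independent_if_scalars_zero)
    fix f x assume 0: "(\<Sum>x\<in>e ` {..<6}. f x *\<^sub>R x) = 0" and "x \<in> e ` {..<6}"
    then obtain i where i: "i < 6" "x = e i" by auto
    have "0 = g x (\<Sum>j<6. f (e j) *\<^sub>R e j)"
      using 0 linear_0[OF lin] by (simp add: sum.reindex[OF inj])
    also have "\<dots> = (\<Sum>j<6. f (e j) * g x (e j))"
      by (simp add: linear_sum[OF lin] linear_cmul[OF lin])
    also have "\<dots> = (\<Sum>j<6. if j = i then f (e j) else 0)"
      using i by (intro sum.cong) (auto simp: e')
    finally show "f x = 0" using i by simp
  qed auto
  then show sp: "span (e ` {..<6}) = UNIV"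
    using card_image[OF inj] by (intro top.extremum_uniqueI[OF card_ge_dim_independent]) (auto simp: dim_UNIV)
  define d where "d = v - (\<Sum>i<6. g (e i) v *\<^sub>R e i)"
  have "g (e j) d = 0" if "j < 6" for j
  proof -
    have "g (e j) d = g (e j) v - (\<Sum>i<6. g (e i) v * g (e j) (e i))"
      by (simp add: d_def linear_diff[OF lin] linear_sum[OF lin] linear_cmul[OF lin])
    also have "(\<Sum>i<6. g (e i) v * g (e j) (e i)) = (\<Sum>i<6. if i = j then g (e i) v else 0)"
      using that by (intro sum.cong) (auto simp: e')
    finally show ?thesis using that by simp
  qed
  then have "g d x = 0" if "x \<in> e ` {..<6}" for x
    using that hermitian_innerD(2)[OF g, of d x] by auto
  then have "g d d = 0"
    using linear_eq_0_on_span[OF lin, of "e ` {..<6}" d d] sp by auto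
  then have "d = 0" using hermitian_innerD(3)[OF g, of d] by force
  then show "v = (\<Sum>i<6. g (e i) v *\<^sub>R e i)" by (simp add: d_def)
qed

text \<open>The trace of \<open>B\<close> relative to \<open>g\<close>. Expanding e' in e produces
  the coefficients g(e_j, e'_i), whose rows are orthonormal by Parseval.\<close>

lemma trace_frame_eq:
  assumes g: "hermitian_inner g" and e: "orthonormal_frame g e" and e': "orthonormal_frame g e'"
    and B: "bilinear B"
  shows "(\<Sum>i<6. B (e i) (e i)) = (\<Sum>i<6. B (e' i) (e' i) :: real)"
proof -
  note bil = hermitian_innerD(1)[OF g]
  have "(\<Sum>i<6. g (e j) (e' i) * g (e k) (e' i)) = g (e j) (e k)" for j k
  proof -
    have "g (e j) (e k) = g (e j) (\<Sum>i<6. g (e' i) (e k) *\<^sub>R e' i)"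
      using orthonormal_frame_expansion(2)[OF g e'] by metis
    then show ?thesis
      using bil by (auto simp: linear_sum linear_cmul bilinear_def mult.commute
          hermitian_innerD(2)[OF g, of _ "e k"])
  qed
  then have *: "(\<Sum>i<6. g (e j) (e' i) * g (e k) (e' i)) = (if j = k then 1 else 0)"
    if "j < 6" "k < 6" for j k
    using e that by (simp add: orthonormal_frame_def)
  have "(\<Sum>i<6. B (e' i) (e' i)) =
      (\<Sum>i<6. \<Sum>j<6. \<Sum>k<6. g (e j) (e' i) * g (e k) (e' i) * B (e j) (e k))"
  proof (rule sum.cong[OF refl])
    fix i
    have "B (e' i) (e' i) = B (\<Sum>j<6. g (e j) (e' i) *\<^sub>R e j) (\<Sum>k<6. g (e k) (e' i) *\<^sub>R e k)"
      using orthonormal_frame_expansion(2)[OF g e, of "e' i"] by simp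
    also have "\<dots> = (\<Sum>j<6. \<Sum>k<6. g (e j) (e' i) * g (e k) (e' i) * B (e j) (e k))"
      by (simp add: bilinear_sum[OF B] bilinear_lmul[OF B] bilinear_rmul[OF B]
          sum.cartesian_product ac_simps)
    finally show "B (e' i) (e' i) = \<dots>" .
  qed
  also have "\<dots> = (\<Sum>j<6. \<Sum>i<6. \<Sum>k<6. g (e j) (e' i) * g (e k) (e' i) * B (e j) (e k))"
    by (rule sum.swap)
  also have "\<dots> = (\<Sum>j<6. \<Sum>k<6. \<Sum>i<6. g (e j) (e' i) * g (e k) (e' i) * B (e j) (e k))"
    by (rule sum.cong[OF refl sum.swap])
  also have "\<dots> = (\<Sum>j<6. \<Sum>k<6. (\<Sum>i<6. g (e j) (e' i) * g (e k) (e' i)) * B (e j) (e k))"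
    by (simp add: sum_distrib_right)
  also have "\<dots> = (\<Sum>j<6. \<Sum>k<6. if j = k then B (e j) (e k) else 0)"
    by (intro sum.cong refl) (auto simp: *)
  finally show ?thesis by simp
qed

subsection \<open>The inner product of forms in a frame\<close>

definition frame_sum :: "(nat \<Rightarrow> 'v) \<Rightarrow> nat \<Rightarrow> ((nat \<Rightarrow> 'v) \<Rightarrow> real) \<Rightarrow> real" where
  "frame_sum e k F = (\<Sum>I \<in> {..<k} \<rightarrow>\<^sub>E {..<6}. F (\<lambda>i. e (I i)))"

lemma frame_sum_0: "frame_sum e 0 F = F (\<lambda>i. e undefined)"
  by (simp add: frame_sum_def)

lemma frame_sum_Suc:
  "frame_sum e (Suc k) F = (\<Sum>i<6. frame_sum e k (\<lambda>w. F (case_nat (e i) w)))"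
proof -
  have "bij_betw (\<lambda>(i, I). case_nat i I) ({..<6} \<times> ({..<k} \<rightarrow>\<^sub>E {..<6})) ({..<Suc k} \<rightarrow>\<^sub>E {..<6::nat})"
    by (rule bij_betw_byWitness[where f' = "\<lambda>I. (I 0, \<lambda>i. I (Suc i))"])
      (auto simp: fun_eq_iff PiE_def extensional_def Pi_def split: nat.split)
  from sum.reindex_bij_betw[OF this, of "\<lambda>I. F (\<lambda>m. e (I m))", symmetric]
  have "frame_sum e (Suc k) F =
      (\<Sum>(i, I) \<in> {..<6} \<times> ({..<k} \<rightarrow>\<^sub>E {..<6}). F (\<lambda>m. e (case_nat i I m)))"
    by (simp add: frame_sum_def case_prod_unfold)
  moreover have "(\<lambda>m. e (case_nat i I m)) = case_nat (e i) (\<lambda>m. e (I m))" for i I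
    by (auto simp: fun_eq_iff split: nat.split)
  ultimately show ?thesis
    by (simp add: frame_sum_def sum.cartesian_product)
qed

lemma multilinear_form_case_nat_linear:
  assumes a: "multilinear_form (Suc k) a"
  shows "linear (\<lambda>x. a (case_nat x w))"
proof -
  have "(case_nat y w)(0 := x) = case_nat x w" for x y
    by (auto simp: fun_eq_iff split: nat.split)
  then show ?thesis
    using multilinear_form_linear[OF a, of 0 "case_nat 0 w"] by simp
qed

text \<open>Frees \<open>form_inner\<close> from its chosen frame. The sum over the first slot is a
  trace, hence frame independent; the remaining slots follow by induction on partially evaluated
  forms.\<close>

lemma frame_sum_frame_eq:
  assumes g: "hermitian_inner g" and e: "orthonormal_frame g e" and e': "orthonormal_frame g e'"
    and "multilinear_form k a" "multilinear_form k b"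
  shows "frame_sum e k (\<lambda>w. a w * b w) = frame_sum e' k (\<lambda>w. a w * b w)"
  using assms(4,5)
proof (induction k arbitrary: a b)
  case 0
  have "a v = a w" "b v = b w" for v w
    using 0 by (auto intro: multilinear_form_cong)
  then show ?case unfolding frame_sum_0 by metis
next
  case (Suc k)
  define B where "B x y = frame_sum e' k (\<lambda>w. a (case_nat x w) * b (case_nat y w))" for x y
  note lin = multilinear_form_case_nat_linear[OF Suc.prems(1)] multilinear_form_case_nat_linear[OF Suc.prems(2)]
  have "bilinear B"
    unfolding bilinear_def B_def frame_sum_def
    by (auto intro!: linear_compose_sum linear_cmult_left linear_cmult_right lin)
  then have "(\<Sum>i<6. B (e i) (e i)) = (\<Sum>i<6. B (e' i) (e' i))"
    by (rule trace_frame_eq[OF g e e'])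
  moreover have "frame_sum e (Suc k) (\<lambda>w. a w * b w) = (\<Sum>i<6. B (e i) (e i))"
    unfolding frame_sum_Suc B_def using Suc.prems
    by (intro sum.cong refl Suc.IH multilinear_form_case_nat)
  ultimately show ?case by (simp add: frame_sum_Suc B_def)
qed

text \<open>Runs over all index tuples, hence gives \<open>fact k\<close> times the inner product on
  alternating forms.\<close>

primrec inner_list :: "nat \<Rightarrow> (nat list \<Rightarrow> real) \<Rightarrow> (nat list \<Rightarrow> real) \<Rightarrow> real" where
  "inner_list 0 A B = A [] * B []"
| "inner_list (Suc k) A B = (\<Sum>i<6. inner_list k (\<lambda>ys. A (i # ys)) (\<lambda>ys. B (i # ys)))"

lemma eval_frame_case_nat:
  "eval_frame e (\<lambda>w. a (case_nat (e i) w)) ys = eval_frame e a (i # ys)"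
proof -
  have "case_nat (e i) (\<lambda>j. e (ys ! j)) = (\<lambda>j. e ((i # ys) ! j))"
    by (auto simp: fun_eq_iff split: nat.split)
  then show ?thesis by (simp add: eval_frame_def)
qed

lemma frame_sum_eq_inner_list:
  assumes "multilinear_form k a" "multilinear_form k b"
  shows "frame_sum e k (\<lambda>w. a w * b w) = inner_list k (eval_frame e a) (eval_frame e b)"
  using assms
proof (induction k arbitrary: a b)
  case 0
  have "a v = a w" "b v = b w" for v w
    using 0 by (auto intro: multilinear_form_cong)
  then show ?case by (metis frame_sum_0 eval_frame_def inner_list.simps(1))
next
  case (Suc k)
  then show ?case
    by (simp add: frame_sum_Suc multilinear_form_case_nat eval_frame_case_nat[abs_def])
qed

lemma form_inner_frame:
  assumes g: "hermitian_inner g" and e: "orthonormal_frame g e"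
    and ab: "multilinear_form k a" "multilinear_form k b"
  shows "form_inner g k a b = inner_list k (eval_frame e a) (eval_frame e b) / fact k"
proof -
  have "orthonormal_frame g (SOME e. orthonormal_frame g e)"
    by (rule someI[of "orthonormal_frame g", OF e])
  then have "frame_sum (SOME e. orthonormal_frame g e) k (\<lambda>w. a w * b w) =
      inner_list k (eval_frame e a) (eval_frame e b)"
    using frame_sum_frame_eq[OF g _ e ab] frame_sum_eq_inner_list[OF ab] by simp
  then show ?thesis
    by (simp add: form_inner_def frame_sum_def Let_def)
qed

subsection \<open>The Hodge star\<close>

lemma wedge_zero_right [simp]: "wedge k l a (\<lambda>_. 0) = (\<lambda>_. 0)"
  by (simp add: wedge_Alt fun_eq_iff Alt_def)

lemma wedge_zero_left [simp]: "wedge k l (\<lambda>_. 0) b = (\<lambda>_. 0)"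
  by (simp add: wedge_Alt fun_eq_iff Alt_def)

lemma wedge_diff_right: "wedge k l a (\<lambda>v. b v - c v) = (\<lambda>v. wedge k l a b v - wedge k l a c v)"
  by (simp add: wedge_def fun_eq_iff right_diff_distrib sum_subtractf diff_divide_distrib)

lemma wedge_diff_left: "wedge k l (\<lambda>v. a v - b v) c = (\<lambda>v. wedge k l a c v - wedge k l b c v)"
  by (simp add: wedge_def fun_eq_iff right_diff_distrib left_diff_distrib sum_subtractf diff_divide_distrib)

lemma wedge_cmult_left: "wedge k l (\<lambda>v. r * a v) b = (\<lambda>v. r * wedge k l a b v)"
  by (simp add: wedge_def fun_eq_iff sum_distrib_left ac_simps)

lemma alternating_form_1: "linear f \<Longrightarrow> alternating_form 1 (\<lambda>v. f (v 0))"
  by (auto simp: alternating_form_def linear_iff)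

lemma multilinear_form_1: "linear f \<Longrightarrow> multilinear_form 1 (\<lambda>v. f (v 0))"
  by (auto simp: multilinear_form_def linear_iff)

text \<open>As l < 6, every list of l indices misses some j; evaluating the product of the j-th
  coframe form with \<open>d\<close> on j followed by the list returns that component of
  \<open>d\<close>.\<close>

lemma wedge_one_forms_inject:
  assumes g: "hermitian_inner g" and e: "orthonormal_frame g e"
    and d: "alternating_form l d" and l: "l < 6"
    and 0: "\<And>j. j < 6 \<Longrightarrow> wedge 1 l (\<lambda>v. g (e j) (v 0)) d = (\<lambda>_. 0)"
  shows "d = (\<lambda>_. 0)"
proof
  fix v
  show "d v = 0"
  proof (rule alternating_form_eq_0_frame[OF d orthonormal_frame_expansion(1)[OF g e]])
    fix xs :: "nat list" assume xs: "length xs = l" "distinct xs" "set xs \<subseteq> {..<6}"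
    have "card (set xs) < card {..<6::nat}"
      using xs l by (simp add: distinct_card)
    then obtain j where j: "j < 6" "j \<notin> set xs"
      by (metis card_mono finite_set lessThan_iff not_le subsetI)
    have ge: "g (e j) (e i) = (if i = j then 1 else 0)" if "i \<in> insert j (set xs)" for i
      using that e j xs by (auto simp: orthonormal_frame_def)
    have "linear (g (e j))"
      using hermitian_innerD(1)[OF g] by (simp add: bilinear_def)
    then have "eval_frame e (wedge 1 l (\<lambda>v. g (e j) (v 0)) d) (j # xs) =
        wedge_list 1 (eval_frame e (\<lambda>v. g (e j) (v 0))) (eval_frame e d) (j # xs)"
      by (intro eval_frame_wedge multilinear_form_1 d) (auto simp: xs)
    also have "\<dots> = (\<Sum>i<Suc l. (-1) ^ i * g (e j) (e ((j # xs) ! i)) * eval_frame e d (delete_nth i (j # xs)))"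
      by (simp add: xs mult.assoc eval_frame_def[of e "\<lambda>v. g (e j) (v 0)"])
    \<comment> \<open>The j-th coframe form vanishes on every entry but the leading one.\<close>
    also have "\<dots> = (\<Sum>i<Suc l. if i = 0 then eval_frame e d xs else 0)"
      using xs j nth_mem by (intro sum.cong) (fastforce simp: ge delete_nth_def nth_Cons')+
    finally show "eval_frame e d xs = 0"
      using 0[OF j(1)] by (simp add: eval_frame_def split: if_splits)
  qed
qed

text \<open>Makes the definite description in \<open>hodge\<close> usable: the difference of two
  candidates is annihilated by all one-forms, hence zero.\<close>

lemma hodge_1_eqI:
  assumes g: "hermitian_inner g" and s: "alternating_form 5 s"
    and eq: "\<And>a. alternating_form 1 a \<Longrightarrow> wedge 1 5 a s = (\<lambda>v. form_inner g 1 a b * vol_form g v)"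
  shows "hodge g 1 b = s"
  unfolding hodge_def
proof (rule the_equality)
  show "alternating_form (6 - 1) s \<and>
    (\<forall>a. alternating_form 1 a \<longrightarrow> wedge 1 (6 - 1) a s = (\<lambda>v. form_inner g 1 a b * vol_form g v))"
    using s eq by simp
next
  fix t assume t: "alternating_form (6 - 1) t \<and>
    (\<forall>a. alternating_form 1 a \<longrightarrow> wedge 1 (6 - 1) a t = (\<lambda>v. form_inner g 1 a b * vol_form g v))"
  obtain e where e: "orthonormal_frame g e"
    using exists_unitary_frame[OF g] by (auto simp: unitary_frame_def)
  have "(\<lambda>v. t v - s v) = (\<lambda>_. 0)"
  proof (rule wedge_one_forms_inject[OF g e, of 5])
    fix j
    have "linear (g (e j))"
      using hermitian_innerD(1)[OF g] by (simp add: bilinear_def)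
    then show "wedge 1 5 (\<lambda>v. g (e j) (v 0)) (\<lambda>v. t v - s v) = (\<lambda>_. 0)"
      using t eq[OF alternating_form_1[of "g (e j)"]] alternating_form_1[of "g (e j)"]
      by (simp add: wedge_diff_right)
  qed (use t s in \<open>auto intro: alternating_form_diff\<close>)
  then show "t = s" by (simp add: fun_eq_iff)
qed

text \<open>The defining property is tested on products of two one-forms. Associativity peels these
  off one at a time, so the injectivity lemma is used twice, in degrees 5 and 4.\<close>

lemma hodge_2_eqI:
  assumes g: "hermitian_inner g" and s: "alternating_form 4 s"
    and eq: "\<And>a. alternating_form 2 a \<Longrightarrow> wedge 2 4 a s = (\<lambda>v. form_inner g 2 a b * vol_form g v)"
  shows "hodge g 2 b = s"
  unfolding hodge_def
proof (rule the_equality)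
  show "alternating_form (6 - 2) s \<and>
    (\<forall>a. alternating_form 2 a \<longrightarrow> wedge 2 (6 - 2) a s = (\<lambda>v. form_inner g 2 a b * vol_form g v))"
    using s eq by simp
next
  fix t assume t: "alternating_form (6 - 2) t \<and>
    (\<forall>a. alternating_form 2 a \<longrightarrow> wedge 2 (6 - 2) a t = (\<lambda>v. form_inner g 2 a b * vol_form g v))"
  let ?d = "\<lambda>v. t v - s v"
  have d: "alternating_form 4 ?d"
    using t s by (auto intro: alternating_form_diff)
  obtain e where e: "orthonormal_frame g e"
    using exists_unitary_frame[OF g] by (auto simp: unitary_frame_def)
  let ?f = "\<lambda>j v. g (e j) (v 0)"
  have lin: "linear (g (e j))" for j
    using hermitian_innerD(1)[OF g] by (simp add: bilinear_def)
  have "?d = (\<lambda>_. 0)"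
  proof (rule wedge_one_forms_inject[OF g e d])
    fix k
    have "alternating_form (1 + 4) (wedge 1 4 (?f k) ?d)"
      by (intro alternating_form_wedge multilinear_form_1 lin alternating_imp_multilinear[OF d])
    then show "wedge 1 4 (?f k) ?d = (\<lambda>_. 0)"
    proof (rule wedge_one_forms_inject[OF g e])
      fix j
      have a: "alternating_form (1 + 1) (wedge 1 1 (?f j) (?f k))"
        by (intro alternating_form_wedge multilinear_form_1 lin)
      have "wedge 1 (1 + 4) (?f j) (wedge 1 4 (?f k) ?d) = wedge (1 + 1) 4 (wedge 1 1 (?f j) (?f k)) ?d"
        by (rule wedge_assoc[symmetric]) simp
      also have "\<dots> = (\<lambda>_. 0)"
        using t eq[of "wedge 1 1 (?f j) (?f k)"] a
        by (simp add: wedge_diff_right numeral_2_eq_2)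
      finally show "wedge 1 (1 + 4) (?f j) (wedge 1 4 (?f k) ?d) = (\<lambda>_. 0)" .
    qed simp
  qed simp
  then show "t = s" by (simp add: fun_eq_iff)
qed

subsection \<open>Computations in a unitary frame\<close>

lemma delete_nth_simps [simp]:
  "delete_nth 0 (x # xs) = xs"
  "delete_nth (Suc i) (x # xs) = x # delete_nth i xs"
  "delete_nth (numeral n) (x # xs) = x # delete_nth (pred_numeral n) xs"
  by (simp_all add: delete_nth_def numeral_eq_Suc)

lemma sum_lessThan_numerals:
  "(\<Sum>i<1. f i) = f (0::nat)"
  "(\<Sum>i<2. f i) = f (0::nat) + f 1"
  "(\<Sum>i<3. f i) = f (0::nat) + f 1 + f 2"
  "(\<Sum>i<4. f i) = f (0::nat) + f 1 + f 2 + f 3"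
  "(\<Sum>i<5. f i) = f (0::nat) + f 1 + f 2 + f 3 + f 4"
  "(\<Sum>i<6. f i) = f (0::nat) + f 1 + f 2 + f 3 + f 4 + f 5"
  for f :: "nat \<Rightarrow> 'b::comm_monoid_add"
  by (simp_all add: eval_nat_numeral add.assoc)

lemma eval_frame_swap:
  assumes a: "alternating_form k a" and xs: "length xs = k" and ij: "i < k" "j < k" "i \<noteq> j"
  shows "eval_frame e a (xs[i := xs ! j, j := xs ! i]) = - eval_frame e a xs"
proof -
  have "eval_frame e a (xs[i := xs ! j, j := xs ! i]) =
      a (\<lambda>m. e (xs ! Transposition.transpose i j m))"
    unfolding eval_frame_def using xs ij
    by (intro multilinear_form_cong[OF alternating_imp_multilinear[OF a]])
      (auto simp: nth_list_update Transposition.transpose_def)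
  then show ?thesis
    using alternating_form_swap[OF a ij, of "\<lambda>m. e (xs ! m)"] by (simp add: eval_frame_def)
qed

lemma eval_frame_2_swap:
  "alternating_form 2 a \<Longrightarrow> eval_frame e a [j, i] = - eval_frame e a [i, j]"
  using eval_frame_swap[of 2 a "[i, j]" 0 1 e] by simp

lemma eval_frame_2_same:
  "alternating_form 2 a \<Longrightarrow> eval_frame e a [i, i] = 0"
  using eval_frame_2_swap[of a e i i] by simp

lemma eval_frame_3_swap:
  assumes "alternating_form 3 a"
  shows "eval_frame e a [j, i, k] = - eval_frame e a [i, j, k]"
    "eval_frame e a [i, k, j] = - eval_frame e a [i, j, k]"
  using eval_frame_swap[of 3 a "[i, j, k]" 0 1 e] eval_frame_swap[of 3 a "[i, j, k]" 1 2 e] assms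
  by (simp_all add: numeral_eq_Suc)

lemma eval_frame_3_same:
  assumes "alternating_form 3 a"
  shows "eval_frame e a [i, i, k] = 0" "eval_frame e a [i, k, k] = 0" "eval_frame e a [i, k, i] = 0"
  using eval_frame_3_swap(1)[OF assms, of e i i k] eval_frame_3_swap(2)[OF assms, of e i k k]
    eval_frame_3_swap(2)[OF assms, of e i k i] by simp_all

lemma wedge_list_2:
  "wedge_list 2 A B xs = (\<Sum>i<length xs. (-1) ^ i * (\<Sum>j<length (delete_nth i xs). (-1) ^ j *
     (A [xs ! i, delete_nth i xs ! j] * B (delete_nth j (delete_nth i xs))))) / 2"
  by (simp add: numeral_2_eq_2 sum_divide_distrib)

lemma wedge_list_3:
  "wedge_list 3 A B xs = (\<Sum>i<length xs. (-1) ^ i *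
     wedge_list 2 (\<lambda>ys. A (xs ! i # ys)) B (delete_nth i xs)) / 3"
  by (simp add: eval_nat_numeral)

section \<open>Shuffle expansions of wedge products of low degree\<close>

lemma eval_wedge_1_2:
  assumes "multilinear_form 1 a" "alternating_form 2 b"
  shows "eval_frame e (wedge 1 2 a b) [p, q, r] =
    eval_frame e a [p] * eval_frame e b [q, r] - eval_frame e a [q] * eval_frame e b [p, r]
    + eval_frame e a [r] * eval_frame e b [p, q]"
  using eval_frame_wedge[OF assms, of "[p, q, r]" e] by (simp add: lessThan_Suc)

lemma eval_wedge_1_4:
  assumes "multilinear_form 1 a" "alternating_form 4 b"
  shows "eval_frame e (wedge 1 4 a b) [p, q, r, s, t] =
    eval_frame e a [p] * eval_frame e b [q, r, s, t] - eval_frame e a [q] * eval_frame e b [p, r, s, t]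
    + eval_frame e a [r] * eval_frame e b [p, q, s, t] - eval_frame e a [s] * eval_frame e b [p, q, r, t]
    + eval_frame e a [t] * eval_frame e b [p, q, r, s]"
  using eval_frame_wedge[OF assms, of "[p, q, r, s, t]" e] by (simp add: lessThan_Suc)

lemma eval_wedge_1_5:
  assumes "multilinear_form 1 a" "alternating_form 5 b"
  shows "eval_frame e (wedge 1 5 a b) [p, q, r, s, t, u] =
    eval_frame e a [p] * eval_frame e b [q, r, s, t, u] - eval_frame e a [q] * eval_frame e b [p, r, s, t, u]
    + eval_frame e a [r] * eval_frame e b [p, q, s, t, u] - eval_frame e a [s] * eval_frame e b [p, q, r, t, u]
    + eval_frame e a [t] * eval_frame e b [p, q, r, s, u] - eval_frame e a [u] * eval_frame e b [p, q, r, s, t]"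
  using eval_frame_wedge[OF assms, of "[p, q, r, s, t, u]" e] by (simp add: lessThan_Suc)

lemma eval_wedge_2_2:
  assumes a: "alternating_form 2 a" and b: "alternating_form 2 b"
  shows "eval_frame e (wedge 2 2 a b) [p, q, r, s] =
    eval_frame e a [p, q] * eval_frame e b [r, s] - eval_frame e a [p, r] * eval_frame e b [q, s]
    + eval_frame e a [p, s] * eval_frame e b [q, r] + eval_frame e a [q, r] * eval_frame e b [p, s]
    - eval_frame e a [q, s] * eval_frame e b [p, r] + eval_frame e a [r, s] * eval_frame e b [p, q]"
  using eval_frame_wedge[OF alternating_imp_multilinear[OF a] b, of "[p, q, r, s]" e]
    eval_frame_2_swap[OF a, of e q p] eval_frame_2_swap[OF a, of e r p] eval_frame_2_swap[OF a, of e s p]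
    eval_frame_2_swap[OF a, of e r q] eval_frame_2_swap[OF a, of e s q] eval_frame_2_swap[OF a, of e s r]
  by (simp add: wedge_list_2 lessThan_Suc)

lemma eval_wedge_2_3:
  assumes a: "alternating_form 2 a" and b: "alternating_form 3 b"
  shows "eval_frame e (wedge 2 3 a b) [p, q, r, s, t] =
    eval_frame e a [p, q] * eval_frame e b [r, s, t] - eval_frame e a [p, r] * eval_frame e b [q, s, t]
    + eval_frame e a [p, s] * eval_frame e b [q, r, t] - eval_frame e a [p, t] * eval_frame e b [q, r, s]
    + eval_frame e a [q, r] * eval_frame e b [p, s, t] - eval_frame e a [q, s] * eval_frame e b [p, r, t]
    + eval_frame e a [q, t] * eval_frame e b [p, r, s] + eval_frame e a [r, s] * eval_frame e b [p, q, t]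
    - eval_frame e a [r, t] * eval_frame e b [p, q, s] + eval_frame e a [s, t] * eval_frame e b [p, q, r]"
  using eval_frame_wedge[OF alternating_imp_multilinear[OF a] b, of "[p, q, r, s, t]" e]
    eval_frame_2_swap[OF a, of e q p] eval_frame_2_swap[OF a, of e r p] eval_frame_2_swap[OF a, of e s p]
    eval_frame_2_swap[OF a, of e r q] eval_frame_2_swap[OF a, of e s q] eval_frame_2_swap[OF a, of e s r]
    eval_frame_2_swap[OF a, of e t p] eval_frame_2_swap[OF a, of e t q] eval_frame_2_swap[OF a, of e t r]
    eval_frame_2_swap[OF a, of e t s]
  by (simp add: wedge_list_2 lessThan_Suc)

lemma eval_wedge_2_4:
  assumes a: "alternating_form 2 a" and b: "alternating_form 4 b"
  shows "eval_frame e (wedge 2 4 a b) [p, q, r, s, t, u] =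
    eval_frame e a [p, q] * eval_frame e b [r, s, t, u] - eval_frame e a [p, r] * eval_frame e b [q, s, t, u]
    + eval_frame e a [p, s] * eval_frame e b [q, r, t, u] - eval_frame e a [p, t] * eval_frame e b [q, r, s, u]
    + eval_frame e a [p, u] * eval_frame e b [q, r, s, t]
    + eval_frame e a [q, r] * eval_frame e b [p, s, t, u] - eval_frame e a [q, s] * eval_frame e b [p, r, t, u]
    + eval_frame e a [q, t] * eval_frame e b [p, r, s, u] - eval_frame e a [q, u] * eval_frame e b [p, r, s, t]
    + eval_frame e a [r, s] * eval_frame e b [p, q, t, u] - eval_frame e a [r, t] * eval_frame e b [p, q, s, u]
    + eval_frame e a [r, u] * eval_frame e b [p, q, s, t]
    + eval_frame e a [s, t] * eval_frame e b [p, q, r, u] - eval_frame e a [s, u] * eval_frame e b [p, q, r, t]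
    + eval_frame e a [t, u] * eval_frame e b [p, q, r, s]"
  using eval_frame_wedge[OF alternating_imp_multilinear[OF a] b, of "[p, q, r, s, t, u]" e]
    eval_frame_2_swap[OF a, of e q p] eval_frame_2_swap[OF a, of e r p] eval_frame_2_swap[OF a, of e s p]
    eval_frame_2_swap[OF a, of e r q] eval_frame_2_swap[OF a, of e s q] eval_frame_2_swap[OF a, of e s r]
    eval_frame_2_swap[OF a, of e t p] eval_frame_2_swap[OF a, of e t q] eval_frame_2_swap[OF a, of e t r]
    eval_frame_2_swap[OF a, of e t s] eval_frame_2_swap[OF a, of e u p] eval_frame_2_swap[OF a, of e u q]
    eval_frame_2_swap[OF a, of e u r] eval_frame_2_swap[OF a, of e u s] eval_frame_2_swap[OF a, of e u t]
  by (simp add: wedge_list_2 lessThan_Suc)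

lemma eval_frame_3_permute:
  assumes "alternating_form 3 a"
  shows "eval_frame e a [q, p, r] = - eval_frame e a [p, q, r]"
    "eval_frame e a [p, r, q] = - eval_frame e a [p, q, r]"
    "eval_frame e a [r, q, p] = - eval_frame e a [p, q, r]"
    "eval_frame e a [q, r, p] = eval_frame e a [p, q, r]"
    "eval_frame e a [r, p, q] = eval_frame e a [p, q, r]"
  using eval_frame_3_swap[OF assms, of e] by metis+

lemma eval_wedge_3_2:
  assumes a: "alternating_form 3 a" and b: "alternating_form 2 b"
  shows "eval_frame e (wedge 3 2 a b) [p, q, r, s, t] =
    eval_frame e a [p, q, r] * eval_frame e b [s, t] - eval_frame e a [p, q, s] * eval_frame e b [r, t]
    + eval_frame e a [p, q, t] * eval_frame e b [r, s] + eval_frame e a [p, r, s] * eval_frame e b [q, t]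
    - eval_frame e a [p, r, t] * eval_frame e b [q, s] + eval_frame e a [p, s, t] * eval_frame e b [q, r]
    - eval_frame e a [q, r, s] * eval_frame e b [p, t] + eval_frame e a [q, r, t] * eval_frame e b [p, s]
    - eval_frame e a [q, s, t] * eval_frame e b [p, r] + eval_frame e a [r, s, t] * eval_frame e b [p, q]"
  using eval_frame_wedge[OF alternating_imp_multilinear[OF a] b, of "[p, q, r, s, t]" e]
    eval_frame_3_permute[OF a, of e p q r] eval_frame_3_permute[OF a, of e p q s]
    eval_frame_3_permute[OF a, of e p q t] eval_frame_3_permute[OF a, of e p r s]
    eval_frame_3_permute[OF a, of e p r t] eval_frame_3_permute[OF a, of e p s t]
    eval_frame_3_permute[OF a, of e q r s] eval_frame_3_permute[OF a, of e q r t]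
    eval_frame_3_permute[OF a, of e q s t] eval_frame_3_permute[OF a, of e r s t]
  by (simp add: wedge_list_3 wedge_list_2 lessThan_Suc ac_simps) (simp add: field_simps)

section \<open>Complex structure, Kaehler form and volume form on a unitary frame\<close>

lemma multilinear_form_nth_uminus:
  assumes a: "multilinear_form k a" and "length vs = k" "i < k"
  shows "a (\<lambda>m. (vs[i := - x]) ! m) = - a (\<lambda>m. (vs[i := x]) ! m)"
proof -
  have *: "a (\<lambda>m. (vs[i := y]) ! m) = a ((\<lambda>m. vs ! m)(i := y))" for y
    using assms by (intro multilinear_form_cong[OF a]) (auto simp: nth_list_update)
  show ?thesis
    unfolding * using linear_neg[OF multilinear_form_linear[OF a]] assms by blast
qed

lemma Jstar_eval:
  assumes a: "multilinear_form k a" and "length xs = k"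
  shows "eval_frame e (Jstar a) xs = a (\<lambda>m. map (\<lambda>i. \<i> *s e i) xs ! m)"
  unfolding eval_frame_def Jstar_def using assms
  by (intro multilinear_form_cong[OF a]) auto

lemma multilinear_form_Jstar: "multilinear_form k a \<Longrightarrow> multilinear_form k (Jstar a)"
  unfolding multilinear_form_def
proof (intro conjI allI impI; elim conjE)
  fix v w :: "nat \<Rightarrow> complex^3"
  assume "\<forall>v w. (\<forall>i<k. v i = w i) \<longrightarrow> a v = a w" "\<forall>i<k. v i = w i"
  then show "Jstar a v = Jstar a w" by (simp add: Jstar_def)
next
  fix v :: "nat \<Rightarrow> complex^3" and i
  assume lin: "\<forall>v. \<forall>i<k. linear (\<lambda>x. a (v(i := x)))" and i: "i < k"
  have "(\<lambda>m. \<i> *s (v(i := x)) m) = (\<lambda>m. \<i> *s v m)(i := \<i> *s x)" for x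
    by auto
  then have "(\<lambda>x. Jstar a (v(i := x))) = (\<lambda>x. a ((\<lambda>m. \<i> *s v m)(i := x))) \<circ> (\<lambda>x. \<i> *s x)"
    by (simp only: Jstar_def o_def)
  then show "linear (\<lambda>x. Jstar a (v(i := x)))"
    using linear_compose[OF i_smult_linear] lin i by metis
qed

lemma alternating_form_Jstar: "alternating_form k a \<Longrightarrow> alternating_form k (Jstar a)"
  unfolding alternating_form_iff by (auto simp: multilinear_form_Jstar) (auto simp: Jstar_def)

lemma alternating_form_kahler:
  assumes g: "hermitian_inner g"
  shows "alternating_form 2 (kahler_form g)"
  unfolding alternating_form_def
proof (intro conjI allI impI)
  fix v :: "nat \<Rightarrow> complex^3" and i :: nat assume "i < 2"
  then consider "i = 0" | "i = 1" by linarith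
  then show "linear (\<lambda>x. kahler_form g (v(i := x)))"
  proof cases
    case 1
    have "linear (\<lambda>x. g x (v 1))"
      using hermitian_innerD(1)[OF g] by (simp add: bilinear_def)
    then show ?thesis
      using 1 linear_compose[OF i_smult_linear] by (fastforce simp: kahler_form_def o_def)
  next
    case 2
    then show ?thesis
      using hermitian_innerD(1)[OF g] by (simp add: kahler_form_def bilinear_def)
  qed
next
  fix v :: "nat \<Rightarrow> complex^3" and i j :: nat
  assume "i < 2" "j < 2" "i \<noteq> j \<and> v i = v j"
  then have "v 1 = v 0" by (auto simp: less_2_cases_iff)
  moreover have "g (\<i> *s x) x = 0" for x
    using hermitian_innerD(4)[OF g, of "\<i> *s x" x] hermitian_innerD(2)[OF g, of x "\<i> *s x"]
    by (simp add: bilinear_lneg[OF hermitian_innerD(1)[OF g]])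
  ultimately show "kahler_form g v = 0" by (simp add: kahler_form_def)
qed (simp add: kahler_form_def)

lemma Jstar_kahler: "hermitian_inner g \<Longrightarrow> Jstar (kahler_form g) = kahler_form g"
  by (simp only: Jstar_def kahler_form_def hermitian_innerD(4))

lemma unitary_frameD:
  assumes e: "unitary_frame g e"
  shows "orthonormal_frame g e" "\<i> *s e 0 = e 1" "\<i> *s e 1 = - e 0" "\<i> *s e 2 = e 3"
    "\<i> *s e 3 = - e 2" "\<i> *s e 4 = e 5" "\<i> *s e 5 = - e 4"
  using e by (simp_all add: unitary_frame_def del: One_nat_def)

lemma unitary_frame_ortho:
  assumes e: "unitary_frame g e" and "i < 6" "j < 6"
  shows "g (e i) (e j) = (if i = j then 1 else 0)"
  using unitary_frameD(1)[OF e] assms by (simp add: orthonormal_frame_def)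

lemma eval_kahler:
  assumes g: "hermitian_inner g" and e: "unitary_frame g e"
  shows "eval_frame e (kahler_form g) [0, 1] = 1" "eval_frame e (kahler_form g) [2, 3] = 1"
    "eval_frame e (kahler_form g) [4, 5] = 1"
    "eval_frame e (kahler_form g) [0, 2] = 0" "eval_frame e (kahler_form g) [0, 3] = 0"
    "eval_frame e (kahler_form g) [0, 4] = 0" "eval_frame e (kahler_form g) [0, 5] = 0"
    "eval_frame e (kahler_form g) [1, 2] = 0" "eval_frame e (kahler_form g) [1, 3] = 0"
    "eval_frame e (kahler_form g) [1, 4] = 0" "eval_frame e (kahler_form g) [1, 5] = 0"
    "eval_frame e (kahler_form g) [2, 4] = 0" "eval_frame e (kahler_form g) [2, 5] = 0"
    "eval_frame e (kahler_form g) [3, 4] = 0" "eval_frame e (kahler_form g) [3, 5] = 0"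
  by (simp_all add: eval_frame_def kahler_form_def unitary_frameD[OF e] unitary_frame_ortho[OF e]
      bilinear_lneg[OF hermitian_innerD(1)[OF g]] del: One_nat_def)

lemma eval_frame_top:
  assumes "multilinear_form 6 s"
  shows "eval_frame e s [0, 1, 2, 3, 4, 5] = s e"
  unfolding eval_frame_def
  by (rule multilinear_form_cong[OF assms]) (auto simp: less_6_iff)

lemma alternating_form_kahler_sq:
  "hermitian_inner g \<Longrightarrow> alternating_form 4 (kahler_sq g)"
  using alternating_form_wedge[OF alternating_imp_multilinear alternating_imp_multilinear,
      OF alternating_form_kahler alternating_form_kahler, of g g]
  by (simp add: kahler_sq_def)

text \<open>Regrouped so that the expansion \<open>eval_wedge_2_4\<close> applies to the
  cube.\<close>

lemma kahler_cube_eq: "kahler_cube g = wedge 2 4 (kahler_form g) (kahler_sq g)"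
proof -
  have "wedge (2 + 2) 2 (wedge 2 2 (kahler_form g) (kahler_form g)) (kahler_form g) =
      wedge 2 (2 + 2) (kahler_form g) (wedge 2 2 (kahler_form g) (kahler_form g))"
    by (rule wedge_assoc) (simp add: kahler_form_def)
  then show ?thesis
    by (simp add: kahler_cube_def kahler_sq_def)
qed

lemma eval_kahler_sq:
  assumes g: "hermitian_inner g" and e: "unitary_frame g e"
  shows "eval_frame e (kahler_sq g) [0,1,2,3] = 2" "eval_frame e (kahler_sq g) [0,1,4,5] = 2"
    "eval_frame e (kahler_sq g) [2,3,4,5] = 2"
    "eval_frame e (kahler_sq g) [0,1,2,4] = 0" "eval_frame e (kahler_sq g) [0,1,2,5] = 0"
    "eval_frame e (kahler_sq g) [0,1,3,4] = 0" "eval_frame e (kahler_sq g) [0,1,3,5] = 0"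
    "eval_frame e (kahler_sq g) [0,2,3,4] = 0" "eval_frame e (kahler_sq g) [0,2,3,5] = 0"
    "eval_frame e (kahler_sq g) [0,2,4,5] = 0" "eval_frame e (kahler_sq g) [0,3,4,5] = 0"
    "eval_frame e (kahler_sq g) [1,2,3,4] = 0" "eval_frame e (kahler_sq g) [1,2,3,5] = 0"
    "eval_frame e (kahler_sq g) [1,2,4,5] = 0" "eval_frame e (kahler_sq g) [1,3,4,5] = 0"
  unfolding kahler_sq_def
  by (simp_all add: eval_wedge_2_2 alternating_form_kahler[OF g] eval_kahler[OF g e] del: One_nat_def)

lemma vol_form_props:
  assumes g: "hermitian_inner g"
  shows "alternating_form 6 (vol_form g)" "unitary_frame g e \<Longrightarrow> vol_form g e = 1"
proof -
  note alt = alternating_form_kahler[OF g] alternating_form_kahler_sq[OF g]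
  have cube: "alternating_form 6 (kahler_cube g)"
    using alternating_form_wedge[OF alternating_imp_multilinear alternating_imp_multilinear, OF alt]
    by (simp add: kahler_cube_eq)
  then show "alternating_form 6 (vol_form g)"
    using alternating_form_cmult[of 6 "kahler_cube g" "1 / 6"] by (simp add: vol_form_def[abs_def])
  assume e: "unitary_frame g e"
  \<comment> \<open>Only the index pairs 01, 23 and 45 contribute, each against a component 2 of the
    square; hence the 6 in \<open>vol_form\<close>.\<close>
  have "kahler_cube g e = 6"
    using eval_frame_top[OF alternating_imp_multilinear[OF cube], of e]
    by (simp add: kahler_cube_eq eval_wedge_2_4 alt eval_kahler[OF g e] eval_kahler_sq[OF g e] del: One_nat_def)
  then show "vol_form g e = 1" by (simp add: vol_form_def)
qed

lemma eval_frame_cmult_vol: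
  assumes g: "hermitian_inner g" and e: "unitary_frame g e"
  shows "eval_frame e (\<lambda>v. c * vol_form g v) [0, 1, 2, 3, 4, 5] = c"
  using eval_frame_top[OF alternating_imp_multilinear[OF vol_form_props(1)[OF g]], of e] vol_form_props(2)[OF g e]
  by (simp add: eval_frame_def)

lemma inner_list_1: "inner_list 1 A B = (\<Sum>i<6. A [i] * B [i])"
  by simp

lemma inner_list_2: "inner_list 2 A B = (\<Sum>i<6. \<Sum>j<6. A [i, j] * B [i, j])"
  by (simp add: numeral_2_eq_2)

lemma inner_list_3: "inner_list 3 A B = (\<Sum>i<6. \<Sum>j<6. \<Sum>k<6. A [i, j, k] * B [i, j, k])"
  by (simp add: numeral_3_eq_3)

section \<open>Type (1,1), primitivity and the star operator\<close>

lemma eval_type_11: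
  assumes s: "alternating_form 2 s" and J: "Jstar s = s" and e: "unitary_frame g e"
  shows "eval_frame e s [1, 3] = eval_frame e s [0, 2]" "eval_frame e s [1, 2] = - eval_frame e s [0, 3]"
    "eval_frame e s [1, 5] = eval_frame e s [0, 4]" "eval_frame e s [1, 4] = - eval_frame e s [0, 5]"
    "eval_frame e s [3, 5] = eval_frame e s [2, 4]" "eval_frame e s [3, 4] = - eval_frame e s [2, 5]"
proof -
  note ml = alternating_imp_multilinear[OF s]
  have neg: "s (\<lambda>m. [x, - y] ! m) = - s (\<lambda>m. [x, y] ! m)" for x y
    using multilinear_form_nth_uminus[OF ml, of "[x, y]" 1 y] by simp
  have ev: "eval_frame e s [i, j] = s (\<lambda>m. [e i, e j] ! m)" for i j
    unfolding eval_frame_def by (rule multilinear_form_cong[OF ml]) (auto simp: less_2_cases_iff)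
  have Jev: "eval_frame e s [i, j] = s (\<lambda>m. [\<i> *s e i, \<i> *s e j] ! m)" for i j
    using Jstar_eval[OF ml, of "[i, j]" e] J by simp
  show "eval_frame e s [1, 3] = eval_frame e s [0, 2]" "eval_frame e s [1, 2] = - eval_frame e s [0, 3]"
    "eval_frame e s [1, 5] = eval_frame e s [0, 4]" "eval_frame e s [1, 4] = - eval_frame e s [0, 5]"
    "eval_frame e s [3, 5] = eval_frame e s [2, 4]" "eval_frame e s [3, 4] = - eval_frame e s [2, 5]"
    unfolding Jev[of 0] Jev[of 2] by (simp_all add: unitary_frameD[OF e] ev neg del: One_nat_def)
qed

lemma top_form_eq_eval_frame:
  assumes g: "hermitian_inner g" and e: "unitary_frame g e"
    and "alternating_form 6 s" "alternating_form 6 t"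
    and "eval_frame e s [0, 1, 2, 3, 4, 5] = eval_frame e t [0, 1, 2, 3, 4, 5]"
  shows "s = t"
  using assms top_form_eq[of 6 s t e] orthonormal_frame_expansion(1)[OF g unitary_frameD(1)[OF e]]
  by (simp add: eval_frame_top alternating_imp_multilinear del: One_nat_def)

text \<open>Type (1,1) imposes six relations on the fifteen components of \<open>s\<close> and
  primitivity a seventh, leaving eight. Modulo these, the top component of the left side is the sum
  of a_ij s_ij over i < j, which is half the sum over all ordered pairs.\<close>

lemma wedge_primitive_11:
  assumes g: "hermitian_inner g" and s: "alternating_form 2 s" and J: "Jstar s = s"
    and prim: "wedge 2 4 s (kahler_sq g) = (\<lambda>_. 0)" and a: "alternating_form 2 a"
  shows "wedge 2 4 a (\<lambda>v. - wedge 2 2 s (kahler_form g) v) = (\<lambda>v. form_inner g 2 a s * vol_form g v)"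
proof -
  obtain e where e: "unitary_frame g e" by (rule exists_unitary_frame[OF g])
  note alt = alternating_form_kahler[OF g] alternating_form_kahler_sq[OF g]
  have w4: "alternating_form 4 (wedge 2 2 s (kahler_form g))"
    using alternating_form_wedge[OF alternating_imp_multilinear alternating_imp_multilinear, OF s alt(1)] by simp
  have top: "alternating_form 6 (wedge 2 4 a (\<lambda>v. - wedge 2 2 s (kahler_form g) v))"
    using alternating_form_wedge[OF alternating_imp_multilinear alternating_imp_multilinear, OF a alternating_form_uminus[OF w4]] by simp
  \<comment> \<open>Evaluated on the frame, primitivity is the vanishing of s_01 + s_23 +
    s_45.\<close>
  have tr: "eval_frame e s [4, 5] = - eval_frame e s [0, 1] - eval_frame e s [2, 3]"
    using arg_cong[OF prim, of "\<lambda>f. eval_frame e f [0, 1, 2, 3, 4, 5]"]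
    by (simp add: eval_wedge_2_4 s alt eval_kahler_sq[OF g e] eval_frame_def[of e "\<lambda>_. 0"] del: One_nat_def)
  note facts = tr eval_type_11[OF s J e]
  \<comment> \<open>The guard i < j orients the rewriting, so that index pairs get sorted without
    looping.\<close>
  have swap: "eval_frame e c [j, i] = - eval_frame e c [i, j]" if "i < j" "alternating_form 2 c" for i j c
    using that by (simp add: eval_frame_2_swap[of c e i j])
  have "eval_frame e (\<lambda>v. - wedge 2 2 s (kahler_form g) v) xs = - eval_frame e (wedge 2 2 s (kahler_form g)) xs" for xs
    by (simp add: eval_frame_def)
  then have 1: "eval_frame e (wedge 2 4 a (\<lambda>v. - wedge 2 2 s (kahler_form g) v)) [0, 1, 2, 3, 4, 5] =
      inner_list 2 (eval_frame e a) (eval_frame e s) / 2"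
    by (simp add: eval_wedge_2_4 a s alt alternating_form_uminus[OF w4] eval_wedge_2_2 eval_kahler[OF g e]
        facts inner_list_2 sum_lessThan_numerals eval_frame_2_same swap del: One_nat_def)
      (simp add: algebra_simps)
  show ?thesis
  proof (rule top_form_eq_eval_frame[OF g e top])
    show "alternating_form 6 (\<lambda>v. form_inner g 2 a s * vol_form g v)"
      by (intro alternating_form_cmult vol_form_props g)
    show "eval_frame e (wedge 2 4 a (\<lambda>v. - wedge 2 2 s (kahler_form g) v)) [0, 1, 2, 3, 4, 5] =
       eval_frame e (\<lambda>v. form_inner g 2 a s * vol_form g v) [0, 1, 2, 3, 4, 5]"
      unfolding 1 eval_frame_cmult_vol[OF g e]
      using form_inner_frame[OF g unitary_frameD(1)[OF e], of 2 a s] a s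
      by (simp add: alternating_imp_multilinear)
  qed
qed

lemma hodge_primitive_11:
  assumes g: "hermitian_inner g" and s: "alternating_form 2 s" and J: "Jstar s = s"
    and prim: "wedge 2 4 s (kahler_sq g) = (\<lambda>_. 0)"
  shows "hodge g 2 s = (\<lambda>v. - wedge 2 2 s (kahler_form g) v)"
proof (rule hodge_2_eqI[OF g _ wedge_primitive_11[OF assms]])
  show "alternating_form 4 (\<lambda>v. - wedge 2 2 s (kahler_form g) v)"
    using alternating_form_wedge[OF alternating_imp_multilinear alternating_imp_multilinear,
        OF s alternating_form_kahler[OF g]]
    by (simp add: alternating_form_uminus)
qed

text \<open>The components of \<open>Jstar c\<close> on a unitary frame are c_1, -c_0, c_3, -c_2,
  c_5, -c_4. This accounts for the overall minus sign, while the division by 2 offsets the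
  components 2 of \<open>kahler_sq g\<close>.\<close>

lemma wedge_hodge_1:
  assumes g: "hermitian_inner g" and c: "alternating_form 1 c" and a: "alternating_form 1 a"
  shows "wedge 1 5 a (\<lambda>v. - wedge 1 4 (Jstar c) (kahler_sq g) v / 2) = (\<lambda>v. form_inner g 1 a c * vol_form g v)"
proof -
  obtain e where e: "unitary_frame g e" by (rule exists_unitary_frame[OF g])
  note alt = alternating_form_kahler[OF g] alternating_form_kahler_sq[OF g] alternating_form_Jstar[OF c]
  note ml = alternating_imp_multilinear
  define s where "s = (\<lambda>v. - wedge 1 4 (Jstar c) (kahler_sq g) v / 2)"
  have w5: "alternating_form 5 (wedge 1 4 (Jstar c) (kahler_sq g))"
    using alternating_form_wedge[OF ml ml, OF alt(3,2)] by simp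
  have s: "alternating_form 5 s"
    using alternating_form_cmult[OF w5, of "- 1 / 2"] by (simp add: s_def)
  have top: "alternating_form 6 (wedge 1 5 a s)"
    using alternating_form_wedge[OF ml ml, OF a s] by simp
  have neg: "c (\<lambda>m. [- x] ! m) = - c (\<lambda>m. [x] ! m)" for x
    using multilinear_form_nth_uminus[OF ml[OF c], of "[x]" 0 x] by simp
  have ev: "eval_frame e c [i] = c (\<lambda>m. [e i] ! m)" for i
    unfolding eval_frame_def by (rule multilinear_form_cong[OF ml[OF c]]) auto
  have "eval_frame e (Jstar c) [i] = c (\<lambda>m. [\<i> *s e i] ! m)" for i
    using Jstar_eval[OF ml[OF c], of "[i]" e] by simp
  then have Jc: "eval_frame e (Jstar c) [0] = eval_frame e c [1]"
    "eval_frame e (Jstar c) [1] = - eval_frame e c [0]"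
    "eval_frame e (Jstar c) [2] = eval_frame e c [3]" "eval_frame e (Jstar c) [3] = - eval_frame e c [2]"
    "eval_frame e (Jstar c) [4] = eval_frame e c [5]" "eval_frame e (Jstar c) [5] = - eval_frame e c [4]"
    by (simp_all add: unitary_frameD[OF e] ev neg del: One_nat_def)
  have "eval_frame e s xs = - eval_frame e (wedge 1 4 (Jstar c) (kahler_sq g)) xs / 2" for xs
    by (simp add: eval_frame_def s_def)
  then have 1: "eval_frame e (wedge 1 5 a s) [0, 1, 2, 3, 4, 5] =
      inner_list 1 (eval_frame e a) (eval_frame e c)"
    by (simp add: eval_wedge_1_5 ml[OF a] s eval_wedge_1_4 ml[OF alt(3)] alt(2) eval_kahler_sq[OF g e]
        Jc inner_list_1 sum_lessThan_numerals del: One_nat_def inner_list.simps)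
  show ?thesis
    unfolding s_def[symmetric]
  proof (rule top_form_eq_eval_frame[OF g e top])
    show "alternating_form 6 (\<lambda>v. form_inner g 1 a c * vol_form g v)"
      by (intro alternating_form_cmult vol_form_props g)
    show "eval_frame e (wedge 1 5 a s) [0, 1, 2, 3, 4, 5] =
       eval_frame e (\<lambda>v. form_inner g 1 a c * vol_form g v) [0, 1, 2, 3, 4, 5]"
      unfolding 1 eval_frame_cmult_vol[OF g e]
      using form_inner_frame[OF g unitary_frameD(1)[OF e], of 1 a c] a c
      by (simp add: ml)
  qed
qed

lemma alternating_form_hodge_1:
  assumes g: "hermitian_inner g" and c: "alternating_form 1 c"
  shows "alternating_form 5 (\<lambda>v. - wedge 1 4 (Jstar c) (kahler_sq g) v / 2)"
  using alternating_form_cmult[OF alternating_form_wedge[OF alternating_imp_multilinear alternating_imp_multilinear,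
      OF alternating_form_Jstar[OF c] alternating_form_kahler_sq[OF g]], of "- 1 / 2"]
  by simp

lemma hodge_1:
  assumes g: "hermitian_inner g" and c: "alternating_form 1 c"
  shows "hodge g 1 c = (\<lambda>v. - wedge 1 4 (Jstar c) (kahler_sq g) v / 2)"
  by (rule hodge_1_eqI[OF g alternating_form_hodge_1[OF assms] wedge_hodge_1[OF assms]])

text \<open>The hypothesis on \<open>P\<close> says that it is the real part of a form of type
  (3,0), so the product would have type (4,1) + (1,4), and there is none in complex dimension three.
  On the frame, every component of \<open>P\<close> is zero or, up to sign, the one at 024 or at
  025.\<close>

lemma wedge_11_type_30_eq_0:
  assumes g: "hermitian_inner g" and s: "alternating_form 2 s" and J: "Jstar s = s"
    and P: "alternating_form 3 P"
    and JP: "\<And>x y z. P (\<lambda>m. [\<i> *s x, \<i> *s y, z] ! m) = - P (\<lambda>m. [x, y, z] ! m)"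
  shows "wedge 2 3 s P = (\<lambda>_. 0)"
proof -
  obtain e where e: "unitary_frame g e" by (rule exists_unitary_frame[OF g])
  note ml = alternating_imp_multilinear
  have neg: "P (\<lambda>m. [x, - y, z] ! m) = - P (\<lambda>m. [x, y, z] ! m)" for x y z
    using multilinear_form_nth_uminus[OF ml[OF P], of "[x, y, z]" 1 y] by simp
  have ev: "eval_frame e P [i, j, k] = P (\<lambda>m. [e i, e j, e k] ! m)" for i j k
    unfolding eval_frame_def by (rule multilinear_form_cong[OF ml[OF P]]) (auto simp: less_Suc_eq numeral_3_eq_3)
  have A: "eval_frame e P [i', j', k] = - eval_frame e P [i, j, k]"
    if "e i' = \<i> *s e i" "e j' = \<i> *s e j" for i i' j j' k
    unfolding ev that by (rule JP)
  \<comment> \<open>\<open>JP\<close> is applied with the multiple of e_j by \<i> in the second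
    slot; the sign from the square of \<i> cancels the sign in \<open>JP\<close>.\<close>
  have B: "eval_frame e P [i', j, k] = eval_frame e P [i, j', k]"
    if "e i' = \<i> *s e i" "e j' = \<i> *s e j" for i i' j j' k
    using JP[of "e i" "\<i> *s e j" "e k"] by (simp add: ev that neg)
  have u: "e 1 = \<i> *s e 0" "e 3 = \<i> *s e 2" "e 5 = \<i> *s e 4"
    by (simp_all add: unitary_frameD[OF e])
  note perm = eval_frame_3_permute[OF P]
  have AA: "eval_frame e P [1, 3, k] = - eval_frame e P [0, 2, k]"
      "eval_frame e P [1, 5, k] = - eval_frame e P [0, 4, k]"
      "eval_frame e P [3, 5, k] = - eval_frame e P [2, 4, k]"
      "eval_frame e P [1, 2, k] = eval_frame e P [0, 3, k]"
      "eval_frame e P [1, 4, k] = eval_frame e P [0, 5, k]"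
      "eval_frame e P [3, 4, k] = eval_frame e P [2, 5, k]" for k
    using A[OF u(1,2)] A[OF u(1,3)] A[OF u(2,3)] B[OF u(1,2)] B[OF u(1,3)] B[OF u(2,3)] by auto
  have zero: "eval_frame e P [0, 1, k] = 0" "eval_frame e P [2, 3, k] = 0" "eval_frame e P [4, 5, k] = 0" for k
    using B[OF u(1) u(1), of k] B[OF u(2) u(2), of k] B[OF u(3) u(3), of k]
      perm(1)[where e = e and p = 0 and q = 1 and r = k] perm(1)[where e = e and p = 2 and q = 3 and r = k]
      perm(1)[where e = e and p = 4 and q = 5 and r = k]
    by simp_all
  have zero': "eval_frame e P [k, 0, 1] = 0" "eval_frame e P [k, 2, 3] = 0" "eval_frame e P [k, 4, 5] = 0" for k
    using zero[of k] perm(5) by metis+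
  have AA': "eval_frame e P [0, 3, 5] = - eval_frame e P [0, 2, 4]"
      "eval_frame e P [0, 3, 4] = eval_frame e P [0, 2, 5]"
    using AA(3)[of 0] AA(6)[of 0] perm(5)[of e 0] by metis+
  have d: "alternating_form 5 (wedge 2 3 s P)"
    using alternating_form_wedge[OF ml ml, OF s P] by simp
  have top: "alternating_form 6 (wedge 1 5 (\<lambda>v. g (e j) (v 0)) (wedge 2 3 s P))" for j
    using alternating_form_wedge[OF multilinear_form_1[of "g (e j)"] ml[OF d]] hermitian_innerD(1)[OF g]
    by (simp add: bilinear_def)
  have ml1: "multilinear_form 1 (\<lambda>v. g (e j) (v 0))" for j
    using multilinear_form_1[of "g (e j)"] hermitian_innerD(1)[OF g] by (simp add: bilinear_def)
  show ?thesis
  \<comment> \<open>A 5-form is zero once its products with the six coframe forms vanish, and those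
    are top forms with a single component to check.\<close>
  proof (rule wedge_one_forms_inject[OF g unitary_frameD(1)[OF e] d])
    fix j
    show "wedge 1 5 (\<lambda>v. g (e j) (v 0)) (wedge 2 3 s P) = (\<lambda>_. 0)"
      by (rule top_form_eq_eval_frame[OF g e top alternating_form_zero])
        (simp add: eval_wedge_1_5 ml1 d eval_wedge_2_3 s P AA AA' zero zero' eval_type_11[OF s J e]
          eval_frame_def[of e "\<lambda>_. 0"] del: One_nat_def)
  qed simp
qed

section \<open>The coordinate volume density and inverting the star on 5-forms\<close>

definition coord_frame :: "nat \<Rightarrow> complex^3" where
  "coord_frame i = [axis 1 1, axis 1 \<i>, axis 2 1, axis 2 \<i>, axis 3 1, axis 3 \<i>] ! i"

lemma vol_density_eq: "vol_density g = vol_form g coord_frame"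
  by (simp add: vol_density_def coord_frame_def[abs_def])

lemma span_coord_frame: "span (coord_frame ` {..<6}) = UNIV"
proof (rule UNIV_eq_I[symmetric])
  fix v :: "complex^3"
  have base: "coord_frame i \<in> span (coord_frame ` {..<6})" if "i < 6" for i
    using that by (intro span_base) auto
  have v: "v = Re (v $ 1) *\<^sub>R coord_frame 0 + Im (v $ 1) *\<^sub>R coord_frame 1
      + Re (v $ 2) *\<^sub>R coord_frame 2 + Im (v $ 2) *\<^sub>R coord_frame 3
      + Re (v $ 3) *\<^sub>R coord_frame 4 + Im (v $ 3) *\<^sub>R coord_frame 5"
    by (simp add: vec_eq_iff forall_3 coord_frame_def axis_def complex_eq_iff)
  show "v \<in> span (coord_frame ` {..<6})"
    by (subst v) (intro span_add span_scale base; simp)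
qed

text \<open>Zero density would make the volume form vanish on a basis, hence identically, against
  its value 1 on a unitary frame. The density can therefore serve as a divisor in
  \<open>hodge_inv_5\<close>, and its square as a positive weight.\<close>

lemma vol_density_nonzero:
  assumes g: "hermitian_inner g"
  shows "vol_density g \<noteq> 0"
proof
  assume "vol_density g = 0"
  then have "vol_form g = (\<lambda>_. 0)"
    by (intro top_form_eq[OF vol_form_props(1)[OF g] alternating_form_zero span_coord_frame])
      (simp add: vol_density_eq)
  then show False
    using exists_unitary_frame[OF g] vol_form_props(2)[OF g] by (metis zero_neq_one)
qed

text \<open>If \<open>\<star>\<gamma> = s\<close> then \<open>g(v, \<cdot>) \<and> s = \<gamma>(v) vol\<close>, which determines \<open>\<gamma>\<close> without reference to the inverse
  metric, so that smoothness of \<open>\<gamma>\<close> is immediate.\<close>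

definition hodge_inv_5 :: "bform \<Rightarrow> mform \<Rightarrow> mform" where
  "hodge_inv_5 g s = (\<lambda>v. wedge 1 5 (\<lambda>w. g (v 0) (w 0)) s coord_frame / vol_density g)"

lemma wedge_sum_left: "wedge k l (\<lambda>v. \<Sum>i\<in>I. r i * a i v) b v = (\<Sum>i\<in>I. r i * wedge k l (a i) b v)"
proof (induction I rule: infinite_finite_induct)
  case (insert x F)
  have "wedge k l (\<lambda>v. f v + g v) b v = wedge k l f b v + wedge k l g b v" for f g
    by (simp add: wedge_def algebra_simps sum.distrib add_divide_distrib)
  then show ?case
    using insert by (simp add: wedge_cmult_left)
qed (simp_all)

lemma alternating_form_hodge_inv_5:
  assumes g: "hermitian_inner g"
  shows "alternating_form 1 (hodge_inv_5 g s)"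
proof -
  have g': "g (x + y) z = g x z + g y z" "g (r *\<^sub>R x) z = r * g x z" for x y z r
    using hermitian_innerD(1)[OF g] by (simp_all add: bilinear_ladd bilinear_lmul)
  have "linear (\<lambda>x. wedge 1 5 (\<lambda>w. g x (w 0)) s coord_frame / vol_density g)"
    by (simp add: linear_iff wedge_def g' algebra_simps sum.distrib add_divide_distrib sum_distrib_left)
  from alternating_form_1[OF this] show ?thesis
    by (simp add: hodge_inv_5_def)
qed

text \<open>Both sides are linear in \<open>a\<close>. For the coframe form g(e_i, .) the
  coefficient is by construction the i-th component of \<open>hodge_inv_5 g s\<close>, so
  \<open>a\<close> is expanded in an orthonormal frame.\<close>

lemma wedge_hodge_inv_5:
  assumes g: "hermitian_inner g" and s: "alternating_form 5 s" and a: "alternating_form 1 a"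
  shows "wedge 1 5 a s = (\<lambda>v. form_inner g 1 a (hodge_inv_5 g s) * vol_form g v)"
proof (rule top_form_eq[OF _ _ span_coord_frame])
  note ml = alternating_imp_multilinear
  show "alternating_form 6 (wedge 1 5 a s)"
    using alternating_form_wedge[OF ml ml, OF a s] by simp
  show "alternating_form 6 (\<lambda>v. form_inner g 1 a (hodge_inv_5 g s) * vol_form g v)"
    by (intro alternating_form_cmult vol_form_props g)
  obtain e where e: "orthonormal_frame g e"
    using exists_unitary_frame[OF g] unitary_frameD(1) by metis
  have lin: "linear (\<lambda>x. a (\<lambda>_. x))"
  proof -
    have "a ((\<lambda>_. 0)(0 := x)) = a (\<lambda>_. x)" for x
      by (rule multilinear_form_cong[OF ml[OF a]]) simp
    then show ?thesis
      using multilinear_form_linear[OF ml[OF a], of 0 "\<lambda>_. 0"] by simp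
  qed
  have "a v = (\<Sum>i<6. eval_frame e a [i] * g (e i) (v 0))" for v
  proof -
    have "a v = a (\<lambda>_. v 0)"
      by (rule multilinear_form_cong[OF ml[OF a]]) simp
    also have "\<dots> = a (\<lambda>_. \<Sum>i<6. g (e i) (v 0) *\<^sub>R e i)"
      using orthonormal_frame_expansion(2)[OF g e, of "v 0"] by simp
    also have "\<dots> = (\<Sum>i<6. g (e i) (v 0) * a (\<lambda>_. e i))"
      by (simp add: linear_sum[OF lin] linear_cmul[OF lin])
    finally have "a v = \<dots>" .
    moreover have "a (\<lambda>_. e i) = eval_frame e a [i]" for i
      unfolding eval_frame_def by (rule multilinear_form_cong[OF ml[OF a]]) simp
    ultimately show ?thesis by (simp add: mult.commute)
  qed
  then have "wedge 1 5 a s coord_frame =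
      wedge 1 5 (\<lambda>v. \<Sum>i<6. eval_frame e a [i] * g (e i) (v 0)) s coord_frame"
    by (intro arg_cong[of a _ "\<lambda>a. wedge 1 5 a s coord_frame"] ext)
  also have "\<dots> = (\<Sum>i<6. eval_frame e a [i] * wedge 1 5 (\<lambda>v. g (e i) (v 0)) s coord_frame)"
    by (rule wedge_sum_left)
  also have "\<dots> = (\<Sum>i<6. eval_frame e a [i] * eval_frame e (hodge_inv_5 g s) [i]) * vol_density g"
    using vol_density_nonzero[OF g] by (simp add: hodge_inv_5_def eval_frame_def sum_distrib_right)
  also have "\<dots> = form_inner g 1 a (hodge_inv_5 g s) * vol_form g coord_frame"
    using form_inner_frame[OF g e ml ml, OF a alternating_form_hodge_inv_5[OF g]]
    by (simp add: vol_density_eq)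
  finally show "wedge 1 5 a s coord_frame = form_inner g 1 a (hodge_inv_5 g s) * vol_form g coord_frame" .
qed

lemma hodge_hodge_inv_5:
  assumes g: "hermitian_inner g" and s: "alternating_form 5 s"
  shows "hodge g 1 (hodge_inv_5 g s) = s"
  by (rule hodge_1_eqI[OF g s wedge_hodge_inv_5[OF g s]])

section \<open>Positivity of the inner product and the projection to \<open>L3_12\<close>\<close>

lemma inner_list_nonneg: "inner_list k A A \<ge> 0"
  by (induction k arbitrary: A) (auto intro!: sum_nonneg)

lemma inner_list_self_eq_0:
  assumes "inner_list k A A = 0" "length xs = k" "set xs \<subseteq> {..<6}"
  shows "A xs = 0"
  using assms
proof (induction k arbitrary: A xs)
  case (Suc k)
  then obtain x ys where xs: "xs = x # ys" by (cases xs) auto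
  have "inner_list k (\<lambda>ys. A (x # ys)) (\<lambda>ys. A (x # ys)) = 0"
    using Suc.prems xs inner_list_nonneg[of k]
    by (simp add: sum_nonneg_eq_0_iff)
  then show ?case using Suc xs by fastforce
qed simp

lemma form_inner_self_nonneg:
  assumes g: "hermitian_inner g" and a: "alternating_form k a"
  shows "form_inner g k a a \<ge> 0"
  using form_inner_frame[OF g _ alternating_imp_multilinear alternating_imp_multilinear, OF _ a a]
    exists_unitary_frame[OF g] inner_list_nonneg unitary_frameD(1)
  by (metis divide_nonneg_nonneg fact_ge_zero)

lemma form_inner_self_eq_0:
  assumes g: "hermitian_inner g" and a: "alternating_form k a" and 0: "form_inner g k a a = 0"
  shows "a = (\<lambda>_. 0)"
proof
  fix v
  obtain e where e: "orthonormal_frame g e"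
    using exists_unitary_frame[OF g] unitary_frameD(1) by metis
  have "inner_list k (eval_frame e a) (eval_frame e a) = 0"
    using form_inner_frame[OF g e alternating_imp_multilinear alternating_imp_multilinear, OF a a] 0 by simp
  then show "a v = 0"
    by (intro alternating_form_eq_0_frame[OF a orthonormal_frame_expansion(1)[OF g e]])
      (auto dest: inner_list_self_eq_0)
qed

lemma form_inner_diff_left:
  "form_inner g k (\<lambda>v. a v - b v) c = form_inner g k a c - form_inner g k b c"
  by (simp add: form_inner_def Let_def left_diff_distrib sum_subtractf diff_divide_distrib)

text \<open>Wedging with the Kaehler form is adjoint to contracting with it, and for a 3-form
  \<open>prim\<close> says that this contraction vanishes. The relations \<open>rel\<close> are the
  components of the contraction, one for each of the six frame indices.\<close>

lemma form_inner_wedge_kahler: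
  assumes g: "hermitian_inner g" and X: "alternating_form 1 X" and t: "alternating_form 3 t"
    and prim: "wedge 3 2 t (kahler_form g) = (\<lambda>_. 0)"
  shows "form_inner g 3 (wedge 1 2 X (kahler_form g)) t = 0"
proof -
  obtain e where e: "unitary_frame g e" by (rule exists_unitary_frame[OF g])
  note ml = alternating_imp_multilinear
  note K = alternating_form_kahler[OF g]
  have w: "alternating_form 3 (wedge 1 2 X (kahler_form g))"
    using alternating_form_wedge[OF ml ml, OF X K] by (simp add: numeral_3_eq_3)
  have 0: "eval_frame e (wedge 3 2 t (kahler_form g)) xs = 0" for xs
    by (simp add: prim eval_frame_def)
  have sw: "eval_frame e (kahler_form g) [j, i] = - eval_frame e (kahler_form g) [i, j]" if "i < j" for i j
    using that by (simp add: eval_frame_2_swap[OF K, of e i j])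
  have st: "i < j \<Longrightarrow> eval_frame e t [j, i, k] = - eval_frame e t [i, j, k]"
    "i < j \<Longrightarrow> eval_frame e t [k, j, i] = - eval_frame e t [k, i, j]" for i j k
    by (rule eval_frame_3_swap[OF t])+
  have rel: "eval_frame e t [0, 2, 3] = - eval_frame e t [0, 4, 5]"
    "eval_frame e t [1, 2, 3] = - eval_frame e t [1, 4, 5]"
    "eval_frame e t [0, 1, 2] = - eval_frame e t [2, 4, 5]"
    "eval_frame e t [0, 1, 3] = - eval_frame e t [3, 4, 5]"
    "eval_frame e t [0, 1, 4] = - eval_frame e t [2, 3, 4]"
    "eval_frame e t [0, 1, 5] = - eval_frame e t [2, 3, 5]"
    using 0[of "[0,2,3,4,5]"] 0[of "[1,2,3,4,5]"] 0[of "[0,1,2,4,5]"] 0[of "[0,1,3,4,5]"]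
      0[of "[0,1,2,3,4]"] 0[of "[0,1,2,3,5]"]
    by (simp_all add: eval_wedge_3_2[OF t K] eval_kahler[OF g e] del: One_nat_def)
  have "inner_list 3 (eval_frame e (wedge 1 2 X (kahler_form g))) (eval_frame e t) = 0"
    by (simp add: inner_list_3 sum_lessThan_numerals eval_wedge_1_2[OF ml[OF X] K] eval_kahler[OF g e]
        sw st eval_frame_2_same[OF K] eval_frame_3_same[OF t] rel del: One_nat_def)
  then show ?thesis
    using form_inner_frame[OF g unitary_frameD(1)[OF e] ml ml, OF w t] by simp
qed

lemma L3_12_diff: "r \<in> L3_12 g W \<Longrightarrow> s \<in> L3_12 g W \<Longrightarrow> (\<lambda>v. r v - s v) \<in> L3_12 g W"
  by (simp add: L3_12_def wedge_diff_left alternating_form_diff)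

text \<open>Existence is the orthogonality of X \<and> \<omega> to \<open>L3_12\<close>. For
  uniqueness, the difference of two candidates lies in \<open>L3_12\<close> and is orthogonal to
  itself.\<close>

lemma proj3_12_eqI:
  assumes g: "hermitian_inner g" and X: "alternating_form 1 X"
    and s: "s \<in> L3_12 g W" and r: "\<And>v. r v = wedge 1 2 X (kahler_form g) v + s v"
  shows "proj3_12 g W r = s"
  unfolding proj3_12_def
proof (rule the_equality)
  have rs: "(\<lambda>v. r v - s v) = wedge 1 2 X (kahler_form g)"
    by (simp add: r fun_eq_iff)
  have orth: "form_inner g 3 (\<lambda>v. r v - s v) t = 0" if "t \<in> L3_12 g W" for t
    unfolding rs using that by (intro form_inner_wedge_kahler[OF g X]) (auto simp: L3_12_def)
  then show "s \<in> L3_12 g W \<and> (\<forall>t\<in>L3_12 g W. form_inner g 3 (\<lambda>v. r v - s v) t = 0)"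
    using s by blast
  fix s' assume s': "s' \<in> L3_12 g W \<and> (\<forall>t\<in>L3_12 g W. form_inner g 3 (\<lambda>v. r v - s' v) t = 0)"
  define d where "d = (\<lambda>v. s' v - s v)"
  have d: "d \<in> L3_12 g W"
    unfolding d_def using s s' by (simp add: L3_12_diff)
  have "form_inner g 3 d d = form_inner g 3 (\<lambda>v. (r v - s v) - (r v - s' v)) d"
    by (simp add: d_def)
  also have "\<dots> = 0"
    unfolding form_inner_diff_left[of g 3 "\<lambda>v. r v - s v" "\<lambda>v. r v - s' v"]
    using orth[OF d] s' d by simp
  finally have "d = (\<lambda>_. 0)"
    by (rule form_inner_self_eq_0[OF g, rotated]) (use d in \<open>simp add: L3_12_def\<close>)
  then show "s' = s" by (simp add: d_def fun_eq_iff)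
qed

text \<open>The pointwise algebra of the theorem, with d\<beta> abstracted to \<open>t\<close> and
  its codifferential to \<open>c\<close>. Here \<open>star\<close> says that t \<and> \<omega> is
  half of \<open>Jstar c\<close> wedged with \<omega> \<and> \<omega>, so subtracting X \<and>
  \<omega>, with X half of \<open>Jstar c\<close>, leaves a form annihilated by \<omega>.\<close>

lemma three_form_decomposition:
  assumes g: "hermitian_inner g" and c: "alternating_form 1 c" and t: "alternating_form 3 t"
    and star: "hodge g 1 c = (\<lambda>v. - wedge 3 2 t (kahler_form g) v)"
    and W: "wedge 2 3 (kahler_form g) (re_form W) = (\<lambda>_. 0)" "wedge 2 3 (kahler_form g) (im_form W) = (\<lambda>_. 0)"
    and tW: "wedge 3 3 t (re_form W) = (\<lambda>_. 0)" "wedge 3 3 t (im_form W) = (\<lambda>_. 0)"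
  shows "t v = wedge 1 2 (\<lambda>v. 1 / 2 * Jstar c v) (kahler_form g) v + proj3_12 g W t v"
proof -
  note ml = alternating_imp_multilinear
  note K = alternating_form_kahler[OF g]
  define X where "X = (\<lambda>v. 1 / 2 * Jstar c v)"
  have X: "alternating_form 1 X"
    unfolding X_def by (intro alternating_form_cmult alternating_form_Jstar c)
  have XK: "alternating_form 3 (wedge 1 2 X (kahler_form g))"
    using alternating_form_wedge[OF ml ml, OF X K] by (simp add: numeral_3_eq_3)
  have dep: "X v = X w" if "\<And>i. i < 1 \<Longrightarrow> v i = w i" for v w
    using that by (rule multilinear_form_cong[OF ml[OF X]])
  define s where "s = (\<lambda>v. t v - wedge 1 2 X (kahler_form g) v)"
  have "wedge (1 + 2) 2 (wedge 1 2 X (kahler_form g)) (kahler_form g) = wedge 1 (2 + 2) X (kahler_sq g)"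
    unfolding kahler_sq_def by (rule wedge_assoc) (rule dep)
  then have XKK: "wedge 3 2 (wedge 1 2 X (kahler_form g)) (kahler_form g) = wedge 1 4 X (kahler_sq g)"
    by (simp add: eval_nat_numeral)
  have "wedge 1 4 (Jstar c) (kahler_sq g) v / 2 = wedge 3 2 t (kahler_form g) v" for v
    using fun_cong[OF star, of v] unfolding hodge_1[OF g c] by simp
  then have sK: "wedge 3 2 s (kahler_form g) = (\<lambda>_. 0)"
    unfolding s_def wedge_diff_left XKK
    unfolding X_def wedge_cmult_left by simp
  have sW: "wedge 3 3 s P = (\<lambda>_. 0)"
    if P: "wedge 2 3 (kahler_form g) P = (\<lambda>_. 0)" "wedge 3 3 t P = (\<lambda>_. 0)" for P
  proof -
    have "wedge (1 + 2) 3 (wedge 1 2 X (kahler_form g)) P = wedge 1 (2 + 3) X (wedge 2 3 (kahler_form g) P)"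
      by (rule wedge_assoc) (rule dep)
    then have "wedge (1 + 2) 3 (wedge 1 2 X (kahler_form g)) P = (\<lambda>_. 0)"
      by (simp only: P wedge_zero_right)
    then have "wedge 3 3 (wedge 1 2 X (kahler_form g)) P = (\<lambda>_. 0)"
      by (simp add: numeral_3_eq_3)
    then show ?thesis
      by (simp add: s_def wedge_diff_left P)
  qed
  have "s \<in> L3_12 g W"
    unfolding L3_12_def using sK sW[OF W(1) tW(1)] sW[OF W(2) tW(2)] alternating_form_diff[OF t XK]
    by (simp add: s_def)
  then have "proj3_12 g W t = s"
    by (rule proj3_12_eqI[OF g X]) (simp add: s_def)
  then show ?thesis
    by (simp add: s_def X_def)
qed

subsection \<open>Calculus of smooth functions\<close>

text \<open>Derivatives at points of an open set depend only on nearby values. The derivative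
  formulas below hold on \<open>S\<close> alone, and this transfers smoothness across them.\<close>

lemma Ck_on_cong:
  assumes S: "open S" and eq: "\<And>x. x \<in> S \<Longrightarrow> f x = g x" and f: "Ck_on n S f"
  shows "Ck_on n S g"
  using eq f
proof (induction n arbitrary: f g)
  case 0
  then show ?case using continuous_on_cong[of S S f g] by simp
next
  case (Suc n)
  have df: "f differentiable (at x)" if "x \<in> S" for x
    using Suc.prems that by simp
  have dg: "g differentiable (at x)" if "x \<in> S" for x
    using df[OF that] Suc.prems(1) S that
    unfolding differentiable_def by (meson has_derivative_transform_within_open)
  have D: "frechet_derivative f (at x) = frechet_derivative g (at x)" if "x \<in> S" for x
    by (rule frechet_derivative_transform_within_open[OF df[OF that] S that Suc.prems(1)])
  have "Ck_on n S (\<lambda>x. frechet_derivative f (at x) v)" for v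
    using Suc.prems(2) by simp
  then have "Ck_on n S (\<lambda>x. frechet_derivative g (at x) v)" for v
    by (rule Suc.IH[rotated]) (simp add: D)
  then show ?case using dg by simp
qed

lemma Ck_on_SucD: "Ck_on (Suc n) S f \<Longrightarrow> Ck_on n S f"
proof (induction n arbitrary: f)
  case 0
  then show ?case
    by (auto intro!: continuous_at_imp_continuous_on differentiable_imp_continuous_within)
qed simp

lemma Ck_on_const: "Ck_on n S (\<lambda>x. c)"
proof (induction n arbitrary: c)
  case (Suc n)
  then show ?case by (simp add: frechet_derivative_const)
qed simp

lemma Ck_on_add:
  assumes S: "open S"
  shows "Ck_on n S f \<Longrightarrow> Ck_on n S g \<Longrightarrow> Ck_on n S (\<lambda>x. f x + g x)"
proof (induction n arbitrary: f g)
  case 0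
  then show ?case by (simp add: continuous_on_add)
next
  case (Suc n)
  have d: "frechet_derivative (\<lambda>x. f x + g x) (at x) v
      = frechet_derivative f (at x) v + frechet_derivative g (at x) v" if "x \<in> S" for x v
  proof -
    have "((\<lambda>x. f x + g x) has_derivative (\<lambda>v. frechet_derivative f (at x) v
        + frechet_derivative g (at x) v)) (at x)"
      using Suc.prems that by (intro has_derivative_add) (auto simp: frechet_derivative_works)
    from fun_cong[OF frechet_derivative_at[OF this], of v] show ?thesis by simp
  qed
  have "Ck_on n S (\<lambda>x. frechet_derivative (\<lambda>x. f x + g x) (at x) v)" for v
    by (rule Ck_on_cong[OF S _ Suc.IH]) (use Suc.prems in \<open>auto simp: d\<close>)
  then show ?case using Suc.prems by simp
qed

lemma frechet_derivative_mult_real: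
  fixes f g :: "'v::real_normed_vector \<Rightarrow> real"
  assumes "f differentiable (at x)" "g differentiable (at x)"
  shows "frechet_derivative (\<lambda>x. f x * g x) (at x) v
      = f x * frechet_derivative g (at x) v + frechet_derivative f (at x) v * g x"
proof -
  have "((\<lambda>x. f x * g x) has_derivative (\<lambda>v. f x * frechet_derivative g (at x) v
      + frechet_derivative f (at x) v * g x)) (at x)"
    using assms by (intro has_derivative_mult) (auto simp: frechet_derivative_works)
  from fun_cong[OF frechet_derivative_at[OF this], of v] show ?thesis by simp
qed

lemma Ck_on_mult:
  fixes f g :: "'v::real_normed_vector \<Rightarrow> real"
  assumes S: "open S"
  shows "Ck_on n S f \<Longrightarrow> Ck_on n S g \<Longrightarrow> Ck_on n S (\<lambda>x. f x * g x)"
proof (induction n arbitrary: f g)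
  case 0
  then show ?case by (simp add: continuous_on_mult)
next
  case (Suc n)
  have d: "frechet_derivative (\<lambda>x. f x * g x) (at x) v
      = f x * frechet_derivative g (at x) v + frechet_derivative f (at x) v * g x" if "x \<in> S" for x v
    using Suc.prems that by (intro frechet_derivative_mult_real) auto
  have "Ck_on n S (\<lambda>x. f x * frechet_derivative g (at x) v + frechet_derivative f (at x) v * g x)" for v
    using Suc.prems Ck_on_SucD[OF Suc.prems(1)] Ck_on_SucD[OF Suc.prems(2)]
    by (intro Ck_on_add[OF S] Suc.IH) auto
  then have "Ck_on n S (\<lambda>x. frechet_derivative (\<lambda>x. f x * g x) (at x) v)" for v
    by (rule Ck_on_cong[OF S, rotated]) (simp add: d)
  then show ?case using Suc.prems by simp
qed

lemma Ck_on_inverse: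
  fixes f :: "'v::real_normed_vector \<Rightarrow> real"
  assumes S: "open S" and nz: "\<And>x. x \<in> S \<Longrightarrow> f x \<noteq> 0"
  shows "Ck_on n S f \<Longrightarrow> Ck_on n S (\<lambda>x. inverse (f x))"
proof (induction n)
  case 0
  then show ?case by (auto intro!: continuous_on_inverse nz)
next
  case (Suc n)
  have D: "((\<lambda>x. inverse (f x)) has_derivative
      (\<lambda>h. - (inverse (f x) * frechet_derivative f (at x) h * inverse (f x)))) (at x)" if "x \<in> S" for x
    using Suc.prems that nz[OF that] by (intro Deriv.has_derivative_inverse) (auto simp: frechet_derivative_works)
  have d: "frechet_derivative (\<lambda>x. inverse (f x)) (at x) v
      = (-1) * (inverse (f x) * frechet_derivative f (at x) v * inverse (f x))" if "x \<in> S" for x v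
    using fun_cong[OF frechet_derivative_at[OF D[OF that]], of v] by simp
  have "Ck_on n S (\<lambda>x. (-1) * (inverse (f x) * frechet_derivative f (at x) v * inverse (f x)))" for v
    using Suc.prems Suc.IH[OF Ck_on_SucD[OF Suc.prems]] by (intro Ck_on_mult[OF S] Ck_on_const) auto
  then have "Ck_on n S (\<lambda>x. frechet_derivative (\<lambda>x. inverse (f x)) (at x) v)" for v
    by (rule Ck_on_cong[OF S, rotated]) (simp only: d)
  then show ?case using D by (auto simp: differentiable_def)
qed

lemma Ck_on_linear: "bounded_linear f \<Longrightarrow> Ck_on n S f"
proof (cases n)
  case 0
  assume "bounded_linear f"
  then show ?thesis using 0 by (simp add: linear_continuous_on)
next
  case (Suc m)
  assume "bounded_linear f"
  then have "(f has_derivative f) (at x)" for x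
    by (rule bounded_linear_imp_has_derivative)
  then have "f differentiable (at x)" "frechet_derivative f (at x) = f" for x
    by (auto simp: differentiable_def frechet_derivative_at[symmetric])
  then show ?thesis using Suc by (simp add: Ck_on_const)
qed

lemma smooth_on_differentiable: "smooth_on S f \<Longrightarrow> x \<in> S \<Longrightarrow> f differentiable (at x)"
  unfolding smooth_on_def by (metis Ck_on.simps(2))

lemma smooth_on_has_derivative:
  "smooth_on S f \<Longrightarrow> x \<in> S \<Longrightarrow> (f has_derivative frechet_derivative f (at x)) (at x)"
  using smooth_on_differentiable frechet_derivative_works by blast

lemma smooth_on_frechet_derivative:
  "smooth_on S f \<Longrightarrow> smooth_on S (\<lambda>x. frechet_derivative f (at x) v)"
  unfolding smooth_on_def by (metis Ck_on.simps(2))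

lemma smooth_on_imp_continuous_on: "smooth_on S f \<Longrightarrow> continuous_on S f"
  unfolding smooth_on_def by (metis Ck_on.simps(1))

lemma smooth_on_const: "smooth_on S (\<lambda>x. c)"
  by (simp add: smooth_on_def Ck_on_const)

lemma smooth_on_add:
  "open S \<Longrightarrow> smooth_on S f \<Longrightarrow> smooth_on S g \<Longrightarrow> smooth_on S (\<lambda>x. f x + g x)"
  by (simp add: smooth_on_def Ck_on_add)

lemma smooth_on_mult:
  fixes f g :: "'v::real_normed_vector \<Rightarrow> real"
  shows "open S \<Longrightarrow> smooth_on S f \<Longrightarrow> smooth_on S g \<Longrightarrow> smooth_on S (\<lambda>x. f x * g x)"
  by (simp add: smooth_on_def Ck_on_mult)

lemma smooth_on_inverse:
  fixes f :: "'v::real_normed_vector \<Rightarrow> real"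
  shows "open S \<Longrightarrow> (\<And>x. x \<in> S \<Longrightarrow> f x \<noteq> 0) \<Longrightarrow> smooth_on S f \<Longrightarrow> smooth_on S (\<lambda>x. inverse (f x))"
  by (simp add: smooth_on_def Ck_on_inverse)

lemma smooth_on_divide:
  fixes f g :: "'v::real_normed_vector \<Rightarrow> real"
  shows "open S \<Longrightarrow> (\<And>x. x \<in> S \<Longrightarrow> g x \<noteq> 0) \<Longrightarrow> smooth_on S f \<Longrightarrow> smooth_on S g
    \<Longrightarrow> smooth_on S (\<lambda>x. f x / g x)"
  unfolding divide_inverse by (intro smooth_on_mult smooth_on_inverse) auto

lemma smooth_on_sum:
  fixes f :: "'i \<Rightarrow> 'v::real_normed_vector \<Rightarrow> 'w::real_normed_vector"
  shows "open S \<Longrightarrow> (\<And>i. i \<in> I \<Longrightarrow> smooth_on S (f i)) \<Longrightarrow> smooth_on S (\<lambda>x. \<Sum>i\<in>I. f i x)"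
  by (induction I rule: infinite_finite_induct) (auto intro: smooth_on_const smooth_on_add)

lemma smooth_on_linear: "bounded_linear f \<Longrightarrow> smooth_on S f"
  by (simp add: smooth_on_def Ck_on_linear)

subsection \<open>Smooth bump functions\<close>

text \<open>The flat function exp(-1/t) and its multiples by negative powers of t. The span of this
  family is closed under differentiation, which is why k is a parameter although only k = 0 enters
  the bump function.\<close>

definition exp_inv :: "nat \<Rightarrow> real \<Rightarrow> real" where
  "exp_inv k t = (if t > 0 then inverse t ^ k * exp (- inverse t) else 0)"

lemma exp_inv_tendsto_0: "(exp_inv k \<longlongrightarrow> 0) (at_right 0)"
proof -
  have "((\<lambda>t::real. inverse t ^ k / exp (inverse t)) \<longlongrightarrow> 0) (at_right 0)"
    using tendsto_power_div_exp_0 filterlim_inverse_at_top_right by (rule filterlim_compose)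
  then show ?thesis
    by (rule Lim_transform_eventually)
      (auto simp: exp_inv_def exp_minus divide_inverse eventually_at_right_less
        intro!: eventually_mono[OF eventually_at_right_less])
qed

lemma exp_inv_DERIV: "(exp_inv k has_real_derivative exp_inv (k + 2) t - real k * exp_inv (k + 1) t) (at t)"
proof -
  consider "t > 0" | "t < 0" | "t = 0" by linarith
  then show ?thesis
  proof cases
    case 1
    have "((\<lambda>t. inverse t ^ k * exp (- inverse t)) has_real_derivative
        real k * inverse t ^ (k - 1) * (- (inverse t)\<^sup>2) * exp (- inverse t)
        + inverse t ^ k * (exp (- inverse t) * (inverse t)\<^sup>2)) (at t)"
      using 1 by (auto intro!: derivative_eq_intros simp: power2_eq_square)
    also have "real k * inverse t ^ (k - 1) * (- (inverse t)\<^sup>2) * exp (- inverse t)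
        + inverse t ^ k * (exp (- inverse t) * (inverse t)\<^sup>2)
        = exp_inv (k + 2) t - real k * exp_inv (k + 1) t"
      using 1 by (cases k) (simp_all add: exp_inv_def power2_eq_square)
    finally show ?thesis
      by (rule has_field_derivative_transform_within_open[where S = "{0<..}"])
        (use 1 in \<open>auto simp: exp_inv_def\<close>)
  next
    case 2
    have "((\<lambda>t. 0) has_real_derivative exp_inv (k + 2) t - real k * exp_inv (k + 1) t) (at t)"
      using 2 by (auto simp: exp_inv_def)
    then show ?thesis
      by (rule has_field_derivative_transform_within_open[where S = "{..<0}"])
        (use 2 in \<open>auto simp: exp_inv_def\<close>)
  next
    case 3
    \<comment> \<open>For h > 0 the quotient is \<open>exp_inv (Suc k) h\<close>.\<close>
    have "((\<lambda>h. exp_inv k h / h) \<longlongrightarrow> 0) (at_right 0)"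
      by (rule Lim_transform_eventually[OF exp_inv_tendsto_0[of "Suc k"]])
        (auto simp: exp_inv_def field_simps intro!: eventually_mono[OF eventually_at_right_less])
    moreover have "((\<lambda>h. exp_inv k h / h) \<longlongrightarrow> 0) (at_left 0)"
      by (rule tendsto_eventually)
        (auto simp: exp_inv_def eventually_at intro!: exI[of _ 1])
    ultimately have "((\<lambda>h. exp_inv k h / h) \<longlongrightarrow> 0) (at 0)"
      by (simp add: filterlim_split_at)
    then show ?thesis
      using 3 by (simp add: DERIV_def exp_inv_def)
  qed
qed

text \<open>The induction keeps k arbitrary because each differentiation raises it by 1 and by
  2.\<close>

lemma Ck_on_exp_inv:
  fixes q :: "'v::real_normed_vector \<Rightarrow> real"
  assumes S: "open S" and q: "smooth_on S q"
  shows "Ck_on n S (\<lambda>x. exp_inv k (q x))"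
proof (induction n arbitrary: k)
  case 0
  have "isCont (exp_inv k) t" for t
    using exp_inv_DERIV by (rule DERIV_isCont)
  then have "continuous_on UNIV (exp_inv k)"
    by (simp add: continuous_at_imp_continuous_on)
  then show ?case
    using continuous_on_compose2[OF _ smooth_on_imp_continuous_on[OF q]] by auto
next
  case (Suc n)
  have D: "((\<lambda>x. exp_inv k (q x)) has_derivative (\<lambda>h. frechet_derivative q (at x) h *
      (exp_inv (k + 2) (q x) - real k * exp_inv (k + 1) (q x)))) (at x)" if "x \<in> S" for x
    using has_derivative_compose[OF smooth_on_has_derivative[OF q that]
        exp_inv_DERIV[of k "q x", unfolded has_field_derivative_def]]
    by (simp add: mult.commute)
  have d: "frechet_derivative (\<lambda>x. exp_inv k (q x)) (at x) v = frechet_derivative q (at x) v *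
      (exp_inv (k + 2) (q x) + (- real k) * exp_inv (k + 1) (q x))" if "x \<in> S" for x v
    using fun_cong[OF frechet_derivative_at[OF D[OF that]], of v] by simp
  have "Ck_on n S (\<lambda>x. frechet_derivative q (at x) v *
      (exp_inv (k + 2) (q x) + (- real k) * exp_inv (k + 1) (q x)))" for v
    using smooth_on_frechet_derivative[OF q]
    by (intro Ck_on_mult[OF S] Ck_on_add[OF S] Ck_on_const Suc.IH) (auto simp: smooth_on_def)
  then have "Ck_on n S (\<lambda>x. frechet_derivative (\<lambda>x. exp_inv k (q x)) (at x) v)" for v
    by (rule Ck_on_cong[OF S, rotated]) (simp only: d)
  then show ?case using D by (auto simp: differentiable_def)
qed

lemma exists_bump:
  fixes x0 :: "'v::euclidean_space"
  assumes S: "open S" and r: "r > 0"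
  obtains \<phi> :: "'v \<Rightarrow> real" where "smooth_on S \<phi>" "\<And>x. \<phi> x \<ge> 0" "\<phi> x0 > 0" "\<And>x. x \<notin> cball x0 r \<Longrightarrow> \<phi> x = 0"
proof -
  \<comment> \<open>This is r^2 - |x - x0|^2, spelled out in sums and products to which the closure
    rules for smooth functions apply.\<close>
  define q where "q x = r\<^sup>2 + (-1) * (\<Sum>b\<in>Basis. (x \<bullet> b + (- (x0 \<bullet> b))) * (x \<bullet> b + (- (x0 \<bullet> b))))" for x
  have q: "q x = r\<^sup>2 - (dist x0 x)\<^sup>2" for x
  proof -
    have "(dist x0 x)\<^sup>2 = (x - x0) \<bullet> (x - x0)"
      unfolding dist_norm norm_minus_commute[of x0] by (rule power2_norm_eq_inner)
    also have "\<dots> = (\<Sum>b\<in>Basis. ((x - x0) \<bullet> b) * ((x - x0) \<bullet> b))"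
      by (rule euclidean_inner)
    finally show ?thesis by (simp add: q_def inner_diff_left)
  qed
  have "smooth_on S q"
    unfolding q_def
    by (intro smooth_on_add smooth_on_mult smooth_on_sum smooth_on_const S smooth_on_linear bounded_linear_inner_left)
  then have "smooth_on S (\<lambda>x. exp_inv 0 (q x))"
    using Ck_on_exp_inv[OF S] by (simp add: smooth_on_def)
  moreover have "exp_inv 0 (q x) \<ge> 0" for x
    by (simp add: exp_inv_def)
  moreover have "exp_inv 0 (q x0) > 0"
    using r by (simp add: exp_inv_def q)
  moreover have "exp_inv 0 (q x) = 0" if "x \<notin> cball x0 r" for x
  proof -
    have "r\<^sup>2 \<le> (dist x0 x)\<^sup>2"
      using that r by (intro power_mono) auto
    then show ?thesis by (simp add: exp_inv_def q)
  qed
  ultimately show ?thesis by (rule that)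
qed

subsection \<open>The exterior derivative\<close>

lemma smooth_form_onD:
  "smooth_form_on k S \<alpha> \<Longrightarrow> x \<in> S \<Longrightarrow> alternating_form k (\<alpha> x)"
  "smooth_form_on k S \<alpha> \<Longrightarrow> smooth_on S (\<lambda>x. \<alpha> x v)"
  by (auto simp: smooth_form_on_def)

lemma frechet_derivative_eqI:
  "(f has_derivative f') (at x) \<Longrightarrow> frechet_derivative f (at x) = f'"
  by (rule frechet_derivative_at[symmetric])

lemma frechet_derivative_cong_open:
  assumes "smooth_on S f" "open S" "x \<in> S" "\<And>y. y \<in> S \<Longrightarrow> f y = g y"
  shows "frechet_derivative f (at x) = frechet_derivative g (at x)"
  by (rule frechet_derivative_transform_within_open[OF smooth_on_differentiable]) (use assms in auto)

text \<open>Linearity and alternation are identities that hold throughout the open set, hence pass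
  to derivatives.\<close>

lemma alternating_form_frechet_derivative:
  assumes S: "open S" and \<alpha>: "smooth_form_on k S \<alpha>" and x: "x \<in> S"
  shows "alternating_form k (\<lambda>w. frechet_derivative (\<lambda>y. \<alpha> y w) (at x) u)"
  unfolding alternating_form_def
proof (intro conjI allI impI)
  fix v w :: "nat \<Rightarrow> complex^3" assume vw: "\<forall>i<k. v i = w i"
  have "\<alpha> y v = \<alpha> y w" if "y \<in> S" for y
    by (rule multilinear_form_cong[OF alternating_imp_multilinear[OF smooth_form_onD(1)[OF \<alpha> that]]])
      (use vw in auto)
  then show "frechet_derivative (\<lambda>y. \<alpha> y v) (at x) u = frechet_derivative (\<lambda>y. \<alpha> y w) (at x) u"
    using frechet_derivative_cong_open[OF smooth_form_onD(2)[OF \<alpha>] S x] by metis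
next
  fix v :: "nat \<Rightarrow> complex^3" and i assume i: "i < k"
  have lin: "linear (\<lambda>z. \<alpha> y (v(i := z)))" if "y \<in> S" for y
    by (rule multilinear_form_linear[OF alternating_imp_multilinear[OF smooth_form_onD(1)[OF \<alpha> that]] i])
  note D = smooth_on_has_derivative[OF smooth_form_onD(2)[OF \<alpha>] x]
  show "linear (\<lambda>z. frechet_derivative (\<lambda>y. \<alpha> y (v(i := z))) (at x) u)"
  proof (rule linearI)
    fix a b
    have "frechet_derivative (\<lambda>y. \<alpha> y (v(i := a + b))) (at x) =
        frechet_derivative (\<lambda>y. \<alpha> y (v(i := a)) + \<alpha> y (v(i := b))) (at x)"
      by (rule frechet_derivative_cong_open[OF smooth_form_onD(2)[OF \<alpha>] S x]) (simp only: linear_add[OF lin])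
    also have "\<dots> = (\<lambda>u. frechet_derivative (\<lambda>y. \<alpha> y (v(i := a))) (at x) u
        + frechet_derivative (\<lambda>y. \<alpha> y (v(i := b))) (at x) u)"
      by (intro frechet_derivative_eqI has_derivative_add D)
    finally show "frechet_derivative (\<lambda>y. \<alpha> y (v(i := a + b))) (at x) u =
        frechet_derivative (\<lambda>y. \<alpha> y (v(i := a))) (at x) u + frechet_derivative (\<lambda>y. \<alpha> y (v(i := b))) (at x) u"
      by (rule fun_cong)
  next
    fix r a
    have "frechet_derivative (\<lambda>y. \<alpha> y (v(i := r *\<^sub>R a))) (at x) =
        frechet_derivative (\<lambda>y. r *\<^sub>R \<alpha> y (v(i := a))) (at x)"
      by (rule frechet_derivative_cong_open[OF smooth_form_onD(2)[OF \<alpha>] S x]) (simp only: linear_cmul[OF lin])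
    also have "\<dots> = (\<lambda>u. r *\<^sub>R frechet_derivative (\<lambda>y. \<alpha> y (v(i := a))) (at x) u)"
      by (intro frechet_derivative_eqI has_derivative_scaleR_right D)
    finally show "frechet_derivative (\<lambda>y. \<alpha> y (v(i := r *\<^sub>R a))) (at x) u =
        r *\<^sub>R frechet_derivative (\<lambda>y. \<alpha> y (v(i := a))) (at x) u"
      by (rule fun_cong)
  qed
next
  fix v :: "nat \<Rightarrow> complex^3" and i j assume ij: "i < k" "j < k" "i \<noteq> j \<and> v i = v j"
  have "frechet_derivative (\<lambda>y. \<alpha> y v) (at x) = frechet_derivative (\<lambda>y. 0) (at x)"
    by (rule frechet_derivative_cong_open[OF smooth_form_onD(2)[OF \<alpha>] S x])
      (use ij alternating_form_eq_0[OF smooth_form_onD(1)[OF \<alpha>]] in blast)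
  then show "frechet_derivative (\<lambda>y. \<alpha> y v) (at x) u = 0"
    by (simp add: frechet_derivative_const)
qed

text \<open>The flat covariant derivative of \<alpha>, as a tensor with the direction of
  differentiation in slot 0.\<close>

definition deriv_form :: "(complex^3 \<Rightarrow> mform) \<Rightarrow> complex^3 \<Rightarrow> mform" where
  "deriv_form \<alpha> x w = frechet_derivative (\<lambda>y. \<alpha> y (\<lambda>j. w (Suc j))) (at x) (w 0)"

lemma ext_d_omit:
  "ext_d k \<alpha> x v = (\<Sum>i\<le>k. (-1) ^ i * frechet_derivative (\<lambda>y. \<alpha> y (omit i v)) (at x) (v i))"
  by (simp add: ext_d_def omit_def[abs_def])

text \<open>The derivative in a fixed direction is already alternating, so antisymmetrising the
  other k slots only multiplies by \<open>fact k\<close>.\<close>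

lemma ext_d_eq_Alt:
  assumes S: "open S" and \<alpha>: "smooth_form_on k S \<alpha>" and x: "x \<in> S"
  shows "ext_d k \<alpha> x v = Alt (Suc k) (deriv_form \<alpha> x) v / fact k"
proof -
  have "Alt k (\<lambda>w. deriv_form \<alpha> x (case_nat u w)) w = fact k * frechet_derivative (\<lambda>y. \<alpha> y w) (at x) u" for u w
    using Alt_alternating_form[OF alternating_form_frechet_derivative[OF assms]]
    by (simp add: deriv_form_def)
  then show ?thesis
    by (simp add: ext_d_omit Alt_Suc sum_divide_distrib)
qed

lemma multilinear_form_deriv_form:
  assumes S: "open S" and \<alpha>: "smooth_form_on k S \<alpha>" and x: "x \<in> S"
  shows "multilinear_form (Suc k) (deriv_form \<alpha> x)"
  unfolding multilinear_form_def
proof (intro conjI allI impI)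
  note alt = alternating_imp_multilinear[OF alternating_form_frechet_derivative[OF assms]]
  fix v w :: "nat \<Rightarrow> complex^3" assume vw: "\<forall>i<Suc k. v i = w i"
  then show "deriv_form \<alpha> x v = deriv_form \<alpha> x w"
    using multilinear_form_cong[OF alt, of "\<lambda>j. v (Suc j)" "\<lambda>j. w (Suc j)"]
    by (simp add: deriv_form_def)
next
  note alt = alternating_imp_multilinear[OF alternating_form_frechet_derivative[OF assms]]
  fix v :: "nat \<Rightarrow> complex^3" and i assume i: "i < Suc k"
  show "linear (\<lambda>z. deriv_form \<alpha> x (v(i := z)))"
  proof (cases i)
    case 0
    then show ?thesis
      using has_derivative_linear[OF smooth_on_has_derivative[OF smooth_form_onD(2)[OF \<alpha>] x]]
      by (simp add: deriv_form_def)
  next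
    case (Suc m)
    have "(\<lambda>j. (v(i := z)) (Suc j)) = (\<lambda>j. v (Suc j))(m := z)" for z
      by (auto simp: Suc)
    moreover have "linear (\<lambda>z. frechet_derivative (\<lambda>y. \<alpha> y ((\<lambda>j. v (Suc j))(m := z))) (at x) (v 0))"
      by (rule multilinear_form_linear[OF alt]) (use i Suc in simp)
    ultimately show ?thesis
      using Suc by (simp add: deriv_form_def)
  qed
qed

lemma smooth_form_on_ext_d:
  assumes S: "open S" and \<alpha>: "smooth_form_on k S \<alpha>"
  shows "smooth_form_on (Suc k) S (ext_d k \<alpha>)"
  unfolding smooth_form_on_def
proof (intro conjI ballI allI)
  fix x assume x: "x \<in> S"
  have "ext_d k \<alpha> x = (\<lambda>v. (1 / fact k) * Alt (Suc k) (deriv_form \<alpha> x) v)"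
    by (simp add: ext_d_eq_Alt[OF S \<alpha> x] fun_eq_iff)
  then show "alternating_form (Suc k) (ext_d k \<alpha> x)"
    using alternating_form_cmult[OF alternating_form_Alt[OF multilinear_form_deriv_form[OF S \<alpha> x]]] by metis
next
  fix v
  show "smooth_on S (\<lambda>x. ext_d k \<alpha> x v)"
    unfolding ext_d_omit
    by (intro smooth_on_sum smooth_on_mult smooth_on_const smooth_on_frechet_derivative S smooth_form_onD(2)[OF \<alpha>])
qed

lemma smooth_form_on_wedge:
  assumes S: "open S" and \<alpha>: "smooth_form_on k S \<alpha>" and \<beta>: "smooth_form_on l S \<beta>"
  shows "smooth_form_on (k + l) S (\<lambda>x. wedge k l (\<alpha> x) (\<beta> x))"
  unfolding smooth_form_on_def
proof (intro conjI ballI allI)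
  fix x assume "x \<in> S"
  then show "alternating_form (k + l) (wedge k l (\<alpha> x) (\<beta> x))"
    using \<alpha> \<beta> by (intro alternating_form_wedge alternating_imp_multilinear) (auto dest: smooth_form_onD(1))
next
  fix v
  show "smooth_on S (\<lambda>x. wedge k l (\<alpha> x) (\<beta> x) v)"
    unfolding wedge_def
    by (intro smooth_on_sum smooth_on_divide smooth_on_mult smooth_on_const S smooth_form_onD(2)[OF \<alpha>]
        smooth_form_onD(2)[OF \<beta>]) auto
qed

lemma smooth_form_on_cmult:
  assumes S: "open S" and f: "smooth_on S f" and \<alpha>: "smooth_form_on k S \<alpha>"
  shows "smooth_form_on k S (\<lambda>x v. f x * \<alpha> x v)"
  using \<alpha> by (auto simp: smooth_form_on_def intro!: alternating_form_cmult smooth_on_mult S f)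

lemma smooth_form_on_uminus:
  "open S \<Longrightarrow> smooth_form_on k S \<alpha> \<Longrightarrow> smooth_form_on k S (\<lambda>x v. - \<alpha> x v)"
  using smooth_form_on_cmult[of S "\<lambda>_. -1" k \<alpha>] by (simp add: smooth_on_const)

lemma smooth_form_on_diff:
  assumes S: "open S" and \<alpha>: "smooth_form_on k S \<alpha>" and \<beta>: "smooth_form_on k S \<beta>"
  shows "smooth_form_on k S (\<lambda>x v. \<alpha> x v - \<beta> x v)"
  unfolding smooth_form_on_def
proof (intro conjI ballI allI)
  show "alternating_form k (\<lambda>v. \<alpha> x v - \<beta> x v)" if "x \<in> S" for x
    using smooth_form_onD(1)[OF \<alpha> that] smooth_form_onD(1)[OF \<beta> that] by (rule alternating_form_diff)
  show "smooth_on S (\<lambda>x. \<alpha> x v - \<beta> x v)" for v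
    using smooth_on_add[OF S smooth_form_onD(2)[OF \<alpha>] smooth_form_onD(2)[OF smooth_form_on_uminus[OF S \<beta>]]]
    by simp
qed

lemma ext_d_cong:
  assumes S: "open S" and \<alpha>: "smooth_form_on k S \<alpha>" and eq: "\<And>x. x \<in> S \<Longrightarrow> \<alpha> x = \<beta> x" and x: "x \<in> S"
  shows "ext_d k \<alpha> x = ext_d k \<beta> x"
proof -
  have "frechet_derivative (\<lambda>y. \<alpha> y w) (at x) = frechet_derivative (\<lambda>y. \<beta> y w) (at x)" for w
    by (rule frechet_derivative_cong_open[OF smooth_form_onD(2)[OF \<alpha>] S x]) (simp add: eq)
  then show ?thesis by (simp add: ext_d_def fun_eq_iff)
qed

lemma ext_d_uminus:
  assumes S: "open S" and \<alpha>: "smooth_form_on k S \<alpha>" and x: "x \<in> S"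
  shows "ext_d k (\<lambda>x v. - \<alpha> x v) x v = - ext_d k \<alpha> x v"
proof -
  have "frechet_derivative (\<lambda>y. - \<alpha> y w) (at x) = (\<lambda>u. - frechet_derivative (\<lambda>y. \<alpha> y w) (at x) u)" for w
    by (intro frechet_derivative_eqI has_derivative_minus smooth_on_has_derivative[OF smooth_form_onD(2)[OF \<alpha>] x])
  then show ?thesis by (simp add: ext_d_def sum_negf)
qed

lemma frechet_derivative_wedge:
  assumes \<alpha>: "smooth_form_on k S \<alpha>" and \<beta>: "smooth_form_on l S \<beta>" and x: "x \<in> S"
  shows "frechet_derivative (\<lambda>y. wedge k l (\<alpha> y) (\<beta> y) v) (at x) u =
    Alt (k + l) (\<lambda>w. frechet_derivative (\<lambda>y. \<alpha> y w) (at x) u * \<beta> x (\<lambda>i. w (k + i))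
      + \<alpha> x w * frechet_derivative (\<lambda>y. \<beta> y (\<lambda>i. w (k + i))) (at x) u) v / (fact k * fact l)"
proof -
  note D = smooth_on_has_derivative[OF smooth_form_onD(2)[OF \<alpha>] x] smooth_on_has_derivative[OF smooth_form_onD(2)[OF \<beta>] x]
  have "((\<lambda>y. (\<Sum>p | p permutes {..<k+l}. of_int (sign p) * (\<alpha> y (\<lambda>i. v (p i)) * \<beta> y (\<lambda>i. v (p (k + i))))) * (1 / (fact k * fact l)))
    has_derivative (\<lambda>u. (\<Sum>p | p permutes {..<k+l}. of_int (sign p) *
      (\<alpha> x (\<lambda>i. v (p i)) * frechet_derivative (\<lambda>y. \<beta> y (\<lambda>i. v (p (k + i)))) (at x) u
      + frechet_derivative (\<lambda>y. \<alpha> y (\<lambda>i. v (p i))) (at x) u * \<beta> x (\<lambda>i. v (p (k + i))))) * (1 / (fact k * fact l)))) (at x)"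
    by (intro has_derivative_mult_left has_derivative_sum has_derivative_mult_right has_derivative_mult D)
  from fun_cong[OF frechet_derivative_eqI[OF this], of u] show ?thesis
    by (simp add: wedge_def Alt_def mult.assoc add.commute)
qed

text \<open>The product rule gives two tensors \<open>F\<close> and \<open>G\<close> with the
  direction in slot 0. In \<open>G\<close> it has to be moved behind the k slots of \<alpha>, by the
  cycle \<open>front k\<close>, whose sign is the factor (-1)^k.\<close>

lemma ext_d_wedge:
  assumes S: "open S" and \<alpha>: "smooth_form_on k S \<alpha>" and \<beta>: "smooth_form_on l S \<beta>" and x: "x \<in> S"
  shows "ext_d (k + l) (\<lambda>x. wedge k l (\<alpha> x) (\<beta> x)) x v =
     wedge (Suc k) l (ext_d k \<alpha> x) (\<beta> x) v + (-1) ^ k * wedge k (Suc l) (\<alpha> x) (ext_d l \<beta> x) v"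
proof -
  let ?c = "fact k * fact l :: real"
  define F where "F w = deriv_form \<alpha> x w * \<beta> x (\<lambda>i. w (Suc k + i))" for w
  define G where "G w = \<alpha> x (\<lambda>j. w (Suc j)) * frechet_derivative (\<lambda>y. \<beta> y (\<lambda>i. w (Suc k + i))) (at x) (w 0)" for w
  define H where "H w = \<alpha> x w * deriv_form \<beta> x (\<lambda>i. w (k + i))" for w
  have dep: "\<alpha> x v = \<alpha> x w" if "\<And>i. i < k \<Longrightarrow> v i = w i" for v w
    by (rule multilinear_form_cong[OF alternating_imp_multilinear[OF smooth_form_onD(1)[OF \<alpha> x]]]) (rule that)
  have "ext_d (k + l) (\<lambda>x. wedge k l (\<alpha> x) (\<beta> x)) x v = Alt (Suc (k + l)) (\<lambda>w. F w + G w) v / ?c"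
    unfolding ext_d_omit frechet_derivative_wedge[OF \<alpha> \<beta> x] Alt_Suc
    by (simp add: F_def G_def deriv_form_def sum_divide_distrib)
  also have "\<dots> = Alt (Suc (k + l)) F v / ?c + Alt (Suc (k + l)) G v / ?c"
    by (simp add: Alt_add add_divide_distrib)
  also have "Alt (Suc (k + l)) F v / ?c = wedge (Suc k) l (ext_d k \<alpha> x) (\<beta> x) v"
  proof -
    have "wedge (Suc k) l (ext_d k \<alpha> x) (\<beta> x) v =
      Alt (Suc k + l) (\<lambda>w. Alt (Suc k) (deriv_form \<alpha> x) w * \<beta> x (\<lambda>i. w (Suc k + i)) / fact k) v / (fact (Suc k) * fact l)"
      by (simp add: wedge_Alt ext_d_eq_Alt[OF S \<alpha> x])
    also have "\<dots> = Alt (Suc k + l) F v / ?c"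
      unfolding Alt_divide Alt_Alt_left F_def by simp
    finally show ?thesis by simp
  qed
  also have "Alt (Suc (k + l)) G v / ?c = (-1) ^ k * wedge k (Suc l) (\<alpha> x) (ext_d l \<beta> x) v"
  proof -
    have "H w = G (\<lambda>i. w (front k i))" for w
    proof -
      have "\<alpha> x (\<lambda>j. w (front k (Suc j))) = \<alpha> x w"
        by (rule dep) simp
      then show ?thesis by (simp add: H_def G_def deriv_form_def)
    qed
    then have H: "H = (\<lambda>w. G (\<lambda>i. w (front k i)))" by blast
    have "wedge k (Suc l) (\<alpha> x) (ext_d l \<beta> x) v =
      Alt (k + Suc l) (\<lambda>w. \<alpha> x w * Alt (Suc l) (deriv_form \<beta> x) (\<lambda>i. w (k + i)) / fact l) v / (fact k * fact (Suc l))"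
      by (simp add: wedge_Alt ext_d_eq_Alt[OF S \<beta> x])
    also have "\<dots> = Alt (k + Suc l) (\<lambda>w. \<alpha> x w * Alt (Suc l) (deriv_form \<beta> x) (\<lambda>i. w (k + i))) v
        / fact l / (fact k * fact (Suc l))"
      by (simp only: Alt_divide)
    also have "Alt (k + Suc l) (\<lambda>w. \<alpha> x w * Alt (Suc l) (deriv_form \<beta> x) (\<lambda>i. w (k + i))) v
        = fact (Suc l) * Alt (k + Suc l) H v"
      unfolding H_def by (rule Alt_Alt_right) (rule dep)
    also have "\<dots> / fact l / (fact k * fact (Suc l)) = Alt (k + Suc l) H v / ?c"
      by (simp del: fact_Suc add: field_simps)
    also have "\<dots> = (-1) ^ k * Alt (Suc (k + l)) G v / ?c"
      unfolding H using Alt_permute_fun[OF front_permutes[of k "k + Suc l"], of G v]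
      by (simp add: sign_front)
    finally show ?thesis
      by (simp flip: mult.assoc)
  qed
  finally show ?thesis .
qed

subsection \<open>Integration by parts\<close>

lemma set_integrable_compact_support:
  fixes f :: "'v::euclidean_space \<Rightarrow> real"
  assumes f: "continuous_on S f" and K: "compact K" "K \<subseteq> S" and 0: "\<And>x. x \<in> S - K \<Longrightarrow> f x = 0"
  shows "set_integrable lborel S f"
proof -
  have "(\<lambda>x. indicator S x *\<^sub>R f x) = (\<lambda>x. indicator K x *\<^sub>R f x)"
    using K 0 by (fastforce simp: indicator_def)
  then show ?thesis
    using borel_integrable_compact[OF K(1) continuous_on_subset[OF f K(2)]]
    by (simp add: set_integrable_def)
qed

lemma integrable_compact_support:
  fixes f :: "'v::euclidean_space \<Rightarrow> real"
  assumes "continuous_on UNIV f" "compact K" "\<And>x. x \<notin> K \<Longrightarrow> f x = 0"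
  shows "integrable lborel f"
  using set_integrable_compact_support[of UNIV f K] assms by (simp add: set_integrable_def)

lemma integral_translate:
  fixes f :: "'v::euclidean_space \<Rightarrow> real"
  assumes "f \<in> borel_measurable borel"
  shows "integral\<^sup>L lborel (\<lambda>x. f (c + x)) = integral\<^sup>L lborel f"
  using integral_distr[of "(+) c" lborel borel f] assms by (simp add: lborel_distr_plus)

text \<open>The difference quotients of a compactly supported function have integral zero by translation
  invariance, and they converge dominatedly to the directional derivative.\<close>

lemma integral_directional_derivative_eq_0:
  fixes U D :: "'v::euclidean_space \<Rightarrow> real"
  assumes U: "\<And>x. (U has_derivative U' x) (at x)" and D: "\<And>x. U' x b = D x" "continuous_on UNIV D"
    and K: "compact K" and U0: "\<And>x. x \<notin> K \<Longrightarrow> U x = 0" and D0: "\<And>x. x \<notin> K \<Longrightarrow> D x = 0"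
  shows "integral\<^sup>L lborel D = 0"
proof -
  have contU: "continuous_on UNIV U"
    using U has_derivative_continuous by (blast intro: continuous_at_imp_continuous_on)
  have [measurable]: "U \<in> borel_measurable borel" "D \<in> borel_measurable borel"
    using contU D(2) by (auto intro: borel_measurable_continuous_onI)
  have "bounded (D ` K)"
    using K D(2) by (intro compact_imp_bounded compact_continuous_image continuous_on_subset[OF D(2)]) auto
  then obtain M where M: "M > 0" "\<And>x. x \<in> K \<Longrightarrow> \<bar>D x\<bar> \<le> M"
    by (auto simp: bounded_pos)
  then have M': "\<bar>D x\<bar> \<le> M" for x
    using D0[of x] by (cases "x \<in> K") auto
  \<comment> \<open>Contains the supports of all difference quotients with step in [0, 1], so that a
    multiple of its indicator dominates them at once.\<close>
  define K' where "K' = (\<lambda>(y, s). y - s *\<^sub>R b) ` (K \<times> {0..1})"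
  have K': "compact K'"
    unfolding K'_def using K
    by (intro compact_continuous_image compact_Times) (auto simp: case_prod_unfold intro!: continuous_intros)
  define t where "t n = 1 / real (Suc n)" for n
  have t: "t n > 0" "t n \<le> 1" for n
    by (auto simp: t_def)
  define q where "q n x = (U (t n *\<^sub>R b + x) - U x) / t n" for n x
  have line: "((\<lambda>s. U (s *\<^sub>R b + x)) has_real_derivative D (s *\<^sub>R b + x)) (at s)" for s x
  proof -
    have "((\<lambda>s. U (s *\<^sub>R b + x)) has_derivative (\<lambda>h. U' (s *\<^sub>R b + x) (h *\<^sub>R b))) (at s)"
      by (rule has_derivative_compose[OF _ U]) (auto intro!: derivative_eq_intros)
    moreover have "U' (s *\<^sub>R b + x) (h *\<^sub>R b) = D (s *\<^sub>R b + x) * h" for h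
      using linear_cmul[OF has_derivative_linear[OF U]] D(1) by simp
    ultimately show ?thesis by (simp add: has_field_derivative_def)
  qed
  have bound: "norm (q n x) \<le> M * indicator K' x" for n x
  proof (cases "x \<in> K'")
    case True
    \<comment> \<open>The mean value theorem along the segment turns the difference quotient into a
      value of \<open>D\<close>, which is bounded by \<open>M\<close>.\<close>
    obtain s where "U (t n *\<^sub>R b + x) - U (0 *\<^sub>R b + x) = (t n - 0) * D (s *\<^sub>R b + x)"
      using MVT2[of 0 "t n" "\<lambda>s. U (s *\<^sub>R b + x)" "\<lambda>s. D (s *\<^sub>R b + x)"] line t by blast
    then have "q n x = D (s *\<^sub>R b + x)"
      using t[of n] by (simp add: q_def)
    then show ?thesis using M' True by simp
  next
    case False
    have "s *\<^sub>R b + x \<notin> K" if "0 \<le> s" "s \<le> 1" for s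
    proof
      assume "s *\<^sub>R b + x \<in> K"
      then have "x \<in> K'"
        unfolding K'_def using that by (intro image_eqI[of _ _ "(s *\<^sub>R b + x, s)"]) auto
      then show False using False by simp
    qed
    from this[of "t n"] this[of 0] have "U (t n *\<^sub>R b + x) = 0" "U x = 0"
      using U0 t[of n] by auto
    then show ?thesis using False by (simp add: q_def)
  qed
  have "(\<lambda>n. integral\<^sup>L lborel (q n)) \<longlonglongrightarrow> integral\<^sup>L lborel D"
  proof (rule integral_dominated_convergence)
    show "integrable lborel (\<lambda>x. M * indicator K' x)"
      using borel_integrable_compact[OF K', of "\<lambda>_. M"] by (simp add: mult.commute)
    show "AE x in lborel. (\<lambda>n. q n x) \<longlonglongrightarrow> D x"
    proof (rule AE_I2)
      fix x
      have "((\<lambda>h. (U (h *\<^sub>R b + x) - U x) / h) \<longlongrightarrow> D x) (at 0)"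
        using line[of x 0] by (simp add: DERIV_def)
      moreover have "filterlim t (at 0) sequentially"
        unfolding t_def using LIMSEQ_inverse_real_of_nat
        by (auto simp: filterlim_at inverse_eq_divide)
      ultimately show "(\<lambda>n. q n x) \<longlonglongrightarrow> D x"
        unfolding q_def by (rule filterlim_compose)
    qed
  qed (use bound in \<open>auto simp: q_def[abs_def]\<close>)
  moreover have "integral\<^sup>L lborel (q n) = 0" for n
  proof -
    have int: "integrable lborel U"
      by (rule integrable_compact_support[OF contU K U0])
    have "integrable lborel (\<lambda>x. U (t n *\<^sub>R b + x))"
      using integrable_distr_eq[of "(+) (t n *\<^sub>R b)" lborel borel U] int by (simp add: lborel_distr_plus)
    then show ?thesis
      using int by (simp add: q_def[abs_def] integral_translate)
  qed
  ultimately show ?thesis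
    by (simp add: LIMSEQ_const_iff)
qed

text \<open>Extended by zero, \<open>u\<close> is differentiable on the whole space with continuous
  directional derivative, because the open sets \<open>S\<close> and the complement of
  \<open>K\<close> cover it.\<close>

lemma set_integral_frechet_derivative_eq_0:
  fixes u :: "'v::euclidean_space \<Rightarrow> real"
  assumes S: "open S" and u: "smooth_on S u" and K: "compact K" "K \<subseteq> S" and 0: "\<And>x. x \<in> S - K \<Longrightarrow> u x = 0"
  shows "set_integrable lborel S (\<lambda>x. frechet_derivative u (at x) b)"
    "(LINT x:S|lborel. frechet_derivative u (at x) b) = 0"
proof -
  have cont: "continuous_on S (\<lambda>x. frechet_derivative u (at x) b)"
    by (rule smooth_on_imp_continuous_on[OF smooth_on_frechet_derivative[OF u]])
  have SK: "open (S - K)" "open (- K)"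
    using S K(1) by (auto simp: compact_imp_closed open_Diff open_Compl)
  have D0: "frechet_derivative u (at x) = (\<lambda>_. 0)" if "x \<in> S - K" for x
  proof -
    have "frechet_derivative u (at x) = frechet_derivative (\<lambda>_. 0) (at x)"
      by (rule frechet_derivative_transform_within_open[OF smooth_on_differentiable[OF u] SK(1) that 0])
        (use that in auto)
    then show ?thesis by (simp add: frechet_derivative_const)
  qed
  show "set_integrable lborel S (\<lambda>x. frechet_derivative u (at x) b)"
    by (rule set_integrable_compact_support[OF cont K]) (simp add: D0)
  define U where "U x = (if x \<in> S then u x else 0)" for x
  define U' where "U' x = (if x \<in> S then frechet_derivative u (at x) else (\<lambda>_. 0))" for x
  have U: "(U has_derivative U' x) (at x)" for x
  proof (cases "x \<in> S")
    case True
    show ?thesis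
      by (rule has_derivative_transform_within_open[OF _ S True])
        (use smooth_on_has_derivative[OF u True] True in \<open>auto simp: U_def U'_def\<close>)
  next
    case False
    then have "x \<in> - K" using K by auto
    show ?thesis
      by (rule has_derivative_transform_within_open[OF _ SK(2) \<open>x \<in> - K\<close>, of "\<lambda>_. 0"])
        (use False 0 in \<open>auto simp: U_def U'_def\<close>)
  qed
  have U': "continuous_on UNIV (\<lambda>x. U' x b)"
  proof -
    have "continuous_on S (\<lambda>x. U' x b)"
      by (rule continuous_on_eq[OF cont]) (simp add: U'_def)
    moreover have "continuous_on (- K) (\<lambda>x. U' x b)"
      by (rule continuous_on_eq[of _ "\<lambda>_. 0"]) (auto simp: U'_def D0)
    ultimately have "continuous_on (S \<union> - K) (\<lambda>x. U' x b)"
      using continuous_on_open_Un[OF S SK(2)] by blast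
    moreover have "S \<union> - K = UNIV" using K by auto
    ultimately show ?thesis by simp
  qed
  have "integral\<^sup>L lborel (\<lambda>x. U' x b) = 0"
    by (rule integral_directional_derivative_eq_0[OF U refl U' K(1)])
      (use K 0 D0 in \<open>auto simp: U_def U'_def\<close>)
  moreover have "(\<lambda>x. U' x b) = (\<lambda>x. indicator S x *\<^sub>R frechet_derivative u (at x) b)"
    by (auto simp: U'_def indicator_def)
  ultimately show "(LINT x:S|lborel. frechet_derivative u (at x) b) = 0"
    by (simp add: set_lebesgue_integral_def)
qed

text \<open>Stokes for compact support: at constant arguments \<open>v\<close>, each summand of the
  exterior derivative is a directional derivative of one coefficient.\<close>

lemma set_integral_ext_d_eq_0:
  assumes S: "open S" and \<eta>: "smooth_form_on k S \<eta>" and K: "compact K" "K \<subseteq> S"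
    and 0: "\<And>x. x \<in> S - K \<Longrightarrow> \<eta> x = (\<lambda>_. 0)"
  shows "(LINT x:S|lborel. ext_d k \<eta> x v) = 0"
proof -
  have *: "set_integrable lborel S (\<lambda>x. frechet_derivative (\<lambda>y. \<eta> y w) (at x) b)"
    "(LINT x:S|lborel. frechet_derivative (\<lambda>y. \<eta> y w) (at x) b) = 0" for w b
    using set_integral_frechet_derivative_eq_0[OF S smooth_form_onD(2)[OF \<eta>] K] 0 by auto
  have "(LINT x:S|lborel. ext_d k \<eta> x v) =
      (\<Sum>i\<le>k. LINT x:S|lborel. (-1) ^ i * frechet_derivative (\<lambda>y. \<eta> y (omit i v)) (at x) (v i))"
    unfolding ext_d_omit set_lebesgue_integral_def scaleR_sum_right
    using set_integrable_mult_right[OF *(1)]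
    by (intro Bochner_Integration.integral_sum) (simp add: set_integrable_def)
  then show ?thesis by (simp add: *)
qed

text \<open>If \<open>f\<close> were positive at x, it would be positive on a nonempty open set,
  which is not a null set.\<close>

lemma nonneg_continuous_integral_eq_0:
  fixes f :: "'v::euclidean_space \<Rightarrow> real"
  assumes S: "open S" and f: "continuous_on S f" and int: "set_integrable lborel S f"
    and nonneg: "\<And>x. x \<in> S \<Longrightarrow> f x \<ge> 0" and 0: "(LINT x:S|lborel. f x) = 0" and x: "x \<in> S"
  shows "f x = 0"
proof (rule ccontr)
  assume "f x \<noteq> 0"
  define T where "T = S \<inter> f -` {0<..}"
  have "open T"
    unfolding T_def using S f by (intro continuous_open_preimage) auto
  moreover have "x \<in> T" using nonneg[OF x] \<open>f x \<noteq> 0\<close> x by (auto simp: T_def)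
  ultimately have "\<not> negligible T"
    using open_not_negligible by blast
  moreover have "AE x in lborel. indicator S x *\<^sub>R f x = 0"
    using integral_nonneg_eq_0_iff_AE[of lborel "\<lambda>x. indicator S x *\<^sub>R f x"] int 0 nonneg
    by (auto simp: set_integrable_def set_lebesgue_integral_def indicator_def)
  then have "AE x in lborel. x \<notin> T"
    by (rule AE_mp) (auto simp: T_def indicator_def intro!: AE_I2)
  then have "T \<in> null_sets lborel"
    using \<open>open T\<close> by (simp add: AE_iff_null_sets)
  then have "negligible T"
    by (simp add: negligible_iff_null_sets null_sets_completionI)
  ultimately show False by blast
qed

subsection \<open>The codifferential on a Kaehler domain\<close>

lemma form_inner_cmult_left: "form_inner g k (\<lambda>v. r * a v) b = r * form_inner g k a b"
  by (simp add: form_inner_def Let_def sum_distrib_left mult.assoc)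

lemma form_inner_commute: "form_inner g k a b = form_inner g k b a"
  by (simp add: form_inner_def mult.commute)

lemma form_inner_zero_left: "form_inner g k (\<lambda>_. 0) b = 0"
  by (simp add: form_inner_def)

lemma form_inner_diff_right:
  "form_inner g k a (\<lambda>v. b v - c v) = form_inner g k a b - form_inner g k a c"
  by (simp add: form_inner_commute[of g k a] form_inner_diff_left)

lemma ext_d_eq_0_open:
  assumes "open T" "x \<in> T" "\<And>y. y \<in> T \<Longrightarrow> \<alpha> y = (\<lambda>_. 0)"
  shows "ext_d k \<alpha> x = (\<lambda>_. 0)"
proof -
  have "frechet_derivative (\<lambda>y. 0::real) (at x) = frechet_derivative (\<lambda>y. \<alpha> y w) (at x)" for w
    by (rule frechet_derivative_transform_within_open[OF _ assms(1,2)]) (simp_all add: assms(3))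
  then have "frechet_derivative (\<lambda>y. \<alpha> y w) (at x) = (\<lambda>_. 0)" for w
    by (simp add: frechet_derivative_const)
  then show ?thesis by (simp add: ext_d_def fun_eq_iff)
qed

text \<open>The image of a single chart, with the Kaehler metric read in its coordinates.\<close>

locale kahler_domain =
  fixes S :: "(complex^3) set" and g :: "complex^3 \<Rightarrow> bform"
  assumes open_S: "open S" and herm: "x \<in> S \<Longrightarrow> hermitian_inner (g x)"
    and smooth_g: "smooth_on S (\<lambda>x. g x v w)"
    and closed: "x \<in> S \<Longrightarrow> ext_d 2 (\<lambda>x. kahler_form (g x)) x = (\<lambda>_. 0)"
begin

lemma smooth_kahler: "smooth_form_on 2 S (\<lambda>x. kahler_form (g x))"
  using alternating_form_kahler[OF herm] smooth_g by (simp add: smooth_form_on_def kahler_form_def)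

lemma smooth_kahler_sq: "smooth_form_on 4 S (\<lambda>x. kahler_sq (g x))"
  using smooth_form_on_wedge[OF open_S smooth_kahler smooth_kahler] by (simp add: kahler_sq_def)

lemma smooth_vol_density: "smooth_on S (\<lambda>x. vol_density (g x))"
proof -
  have "smooth_form_on 6 S (\<lambda>x. kahler_cube (g x))"
    using smooth_form_on_wedge[OF open_S smooth_kahler smooth_kahler_sq] by (simp add: kahler_cube_eq)
  then show ?thesis
    unfolding vol_density_eq vol_form_def
    by (intro smooth_on_divide open_S smooth_form_onD(2) smooth_on_const) auto
qed

lemma smooth_wedge_top:
  assumes "smooth_form_on k S \<alpha>" "smooth_form_on l S \<beta>"
  shows "smooth_on S (\<lambda>x. wedge k l (\<alpha> x) (\<beta> x) v)"
  using smooth_form_on_wedge[OF open_S assms] by (rule smooth_form_onD(2))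

text \<open>The definition of \<open>form_inner\<close> uses an arbitrary frame at each point, so
  continuity is not visible from it. By \<open>wedge_hodge_1\<close> the expression is the value on
  \<open>coord_frame\<close> of \<alpha> \<and> \<star>\<gamma>, which involves no frame
  choice.\<close>

lemma continuous_form_inner_1:
  assumes \<alpha>: "smooth_form_on 1 S \<alpha>" and \<gamma>: "smooth_form_on 1 S \<gamma>"
  shows "continuous_on S (\<lambda>x. form_inner (g x) 1 (\<alpha> x) (\<gamma> x) * vol_density (g x))"
proof -
  have J: "smooth_form_on 1 S (\<lambda>x. Jstar (\<gamma> x))"
    using \<gamma> by (auto simp: smooth_form_on_def alternating_form_Jstar) (simp add: Jstar_def)
  have "smooth_form_on 5 S (\<lambda>x. wedge 1 4 (Jstar (\<gamma> x)) (kahler_sq (g x)))"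
    using smooth_form_on_wedge[OF open_S J smooth_kahler_sq] by simp
  then have "smooth_form_on 5 S (\<lambda>x v. - wedge 1 4 (Jstar (\<gamma> x)) (kahler_sq (g x)) v / 2)"
    using smooth_form_on_cmult[OF open_S smooth_on_const, of 5 _ "- 1 / 2"] by fastforce
  note smooth_wedge_top[OF \<alpha> this, of coord_frame]
  then have "continuous_on S (\<lambda>x. wedge 1 5 (\<alpha> x) (\<lambda>v. - wedge 1 4 (Jstar (\<gamma> x)) (kahler_sq (g x)) v / 2) coord_frame)"
    by (rule smooth_on_imp_continuous_on)
  then show ?thesis
    by (rule continuous_on_eq)
      (simp only: wedge_hodge_1[OF herm smooth_form_onD(1)[OF \<gamma>] smooth_form_onD(1)[OF \<alpha>]] vol_density_eq)
qed

text \<open>Fundamental lemma of the calculus of variations: the difference of two adjoints, cut off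
  by a bump function around x0, is itself taken as the test form.\<close>

lemma codiff_unique:
  assumes \<gamma>: "is_codiff_on 1 S g \<beta> \<gamma>" and \<gamma>': "is_codiff_on 1 S g \<beta> \<gamma>'" and x0: "x0 \<in> S"
  shows "\<gamma> x0 = \<gamma>' x0"
proof -
  define \<delta> where "\<delta> x v = \<gamma> x v - \<gamma>' x v" for x v
  let ?vd = "\<lambda>x. vol_density (g x)"
  have s: "smooth_form_on 1 S \<gamma>" "smooth_form_on 1 S \<gamma>'"
    using \<gamma> \<gamma>' by (auto simp: is_codiff_on_def)
  then have \<delta>: "smooth_form_on 1 S \<delta>"
    unfolding \<delta>_def[abs_def] by (rule smooth_form_on_diff[OF open_S])
  obtain r where r: "r > 0" "cball x0 r \<subseteq> S"
    using open_S x0 open_contains_cball by blast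
  obtain \<phi> :: "complex^3 \<Rightarrow> real" where \<phi>: "smooth_on S \<phi>" "\<And>x. \<phi> x \<ge> 0" "\<phi> x0 > 0"
    "\<And>x. x \<notin> cball x0 r \<Longrightarrow> \<phi> x = 0"
    using exists_bump[OF open_S r(1)] by blast
  \<comment> \<open>The factor \<open>vol_density\<close> makes the integrand nonnegative whatever the sign of the density.\<close>
  define \<alpha> where "\<alpha> x v = \<phi> x * (?vd x * \<delta> x v)" for x v
  have \<alpha>: "smooth_form_on 1 S \<alpha>"
    unfolding \<alpha>_def[abs_def]
    by (intro smooth_form_on_cmult open_S \<phi> smooth_vol_density \<delta>)
  have \<alpha>0: "\<alpha> x = (\<lambda>_. 0)" if "x \<in> S - cball x0 r" for x
    using \<phi>(4)[of x] that by (simp add: \<alpha>_def[abs_def])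
  have test: "test_form 1 S \<alpha>"
    unfolding test_form_def using \<alpha> \<alpha>0 r by (intro conjI exI[of _ "cball x0 r"]) auto
  have int: "set_integrable lborel S (\<lambda>x. form_inner (g x) 1 (\<alpha> x) (\<epsilon> x) * ?vd x)"
    if "smooth_form_on 1 S \<epsilon>" for \<epsilon>
    by (rule set_integrable_compact_support[OF continuous_form_inner_1[OF \<alpha> that], of "cball x0 r"])
      (use r \<alpha>0 in \<open>auto simp: form_inner_zero_left\<close>)
  have "(LINT x:S|lborel. form_inner (g x) (Suc 1) (ext_d 1 \<alpha> x) (\<beta> x) * ?vd x) =
      (LINT x:S|lborel. form_inner (g x) 1 (\<alpha> x) (\<epsilon> x) * ?vd x)"
    if "is_codiff_on 1 S g \<beta> \<epsilon>" for \<epsilon>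
    using that test unfolding is_codiff_on_def by blast
  from this[OF \<gamma>] this[OF \<gamma>']
  have "(LINT x:S|lborel. form_inner (g x) 1 (\<alpha> x) (\<gamma> x) * ?vd x) =
      (LINT x:S|lborel. form_inner (g x) 1 (\<alpha> x) (\<gamma>' x) * ?vd x)"
    by (rule trans[OF sym])
  then have "(LINT x:S|lborel. form_inner (g x) 1 (\<alpha> x) (\<gamma> x) * ?vd x
      - form_inner (g x) 1 (\<alpha> x) (\<gamma>' x) * ?vd x) = 0"
    using set_integral_diff(2)[OF int[OF s(1)] int[OF s(2)]] by simp
  then have 0: "(LINT x:S|lborel. form_inner (g x) 1 (\<alpha> x) (\<delta> x) * ?vd x) = 0"
    by (simp add: \<delta>_def[abs_def] form_inner_diff_right left_diff_distrib)
  have eq: "form_inner (g x) 1 (\<alpha> x) (\<delta> x) * ?vd x = \<phi> x * (?vd x)\<^sup>2 * form_inner (g x) 1 (\<delta> x) (\<delta> x)" for x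
    by (simp add: \<alpha>_def[abs_def] form_inner_cmult_left power2_eq_square)
  have "form_inner (g x) 1 (\<alpha> x) (\<delta> x) * ?vd x \<ge> 0" if "x \<in> S" for x
    unfolding eq
    by (intro mult_nonneg_nonneg \<phi>(2) zero_le_power2
        form_inner_self_nonneg[OF herm[OF that] smooth_form_onD(1)[OF \<delta> that]])
  then have "form_inner (g x0) 1 (\<alpha> x0) (\<delta> x0) * ?vd x0 = 0"
    by (rule nonneg_continuous_integral_eq_0[OF open_S continuous_form_inner_1[OF \<alpha> \<delta>] int[OF \<delta>] _ 0 x0])
  then have "form_inner (g x0) 1 (\<delta> x0) (\<delta> x0) = 0"
    unfolding eq using \<phi>(3) vol_density_nonzero[OF herm[OF x0]] by simp
  then have "\<delta> x0 = (\<lambda>_. 0)"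
    by (rule form_inner_self_eq_0[OF herm[OF x0] smooth_form_onD(1)[OF \<delta> x0]])
  then show ?thesis by (simp add: \<delta>_def[abs_def] fun_eq_iff)
qed

end

section \<open>A primitive (1,1)-form on a Kaehler domain\<close>

locale primitive_11_form = kahler_domain +
  fixes \<beta> :: "complex^3 \<Rightarrow> mform"
  assumes smooth_b: "smooth_form_on 2 S \<beta>"
    and J_b: "x \<in> S \<Longrightarrow> Jstar (\<beta> x) = \<beta> x"
    and prim_b: "x \<in> S \<Longrightarrow> wedge 2 4 (\<beta> x) (kahler_sq (g x)) = (\<lambda>_. 0)"
begin

definition star_b :: "complex^3 \<Rightarrow> mform" where
  "star_b x = (\<lambda>v. - wedge 2 2 (\<beta> x) (kahler_form (g x)) v)"

definition d_star_b :: "complex^3 \<Rightarrow> mform" where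
  "d_star_b x = (\<lambda>v. - wedge 3 2 (ext_d 2 \<beta> x) (kahler_form (g x)) v)"

definition codiff_b :: "complex^3 \<Rightarrow> mform" where
  "codiff_b x = hodge_inv_5 (g x) (d_star_b x)"

lemma smooth_ext_d_b: "smooth_form_on 3 S (ext_d 2 \<beta>)"
  using smooth_form_on_ext_d[OF open_S smooth_b] by (simp add: numeral_3_eq_3)

lemma smooth_wedge_b: "smooth_form_on 4 S (\<lambda>x. wedge 2 2 (\<beta> x) (kahler_form (g x)))"
  using smooth_form_on_wedge[OF open_S smooth_b smooth_kahler] by simp

lemma smooth_star_b: "smooth_form_on 4 S star_b"
  using smooth_form_on_uminus[OF open_S smooth_wedge_b] by (simp add: star_b_def[abs_def])

lemma smooth_d_star_b: "smooth_form_on 5 S d_star_b"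
  using smooth_form_on_uminus[OF open_S smooth_form_on_wedge[OF open_S smooth_ext_d_b smooth_kahler]]
  by (simp add: d_star_b_def[abs_def])

lemma hodge_b: "x \<in> S \<Longrightarrow> hodge (g x) 2 (\<beta> x) = star_b x"
  unfolding star_b_def
  by (intro hodge_primitive_11 herm smooth_form_onD(1)[OF smooth_b] J_b prim_b)

lemma ext_d_star_b: "x \<in> S \<Longrightarrow> ext_d 4 star_b x = d_star_b x"
proof
  fix v assume x: "x \<in> S"
  have "ext_d (2 + 2) (\<lambda>x. wedge 2 2 (\<beta> x) (kahler_form (g x))) x v =
      wedge 3 2 (ext_d 2 \<beta> x) (kahler_form (g x)) v"
    by (subst ext_d_wedge[OF open_S smooth_b smooth_kahler x])
      (simp add: closed[OF x] numeral_3_eq_3)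
  then show "ext_d 4 star_b x v = d_star_b x v"
    using ext_d_uminus[OF open_S smooth_wedge_b x, of v]
    by (simp add: star_b_def[abs_def] d_star_b_def)
qed

lemma smooth_codiff_b: "smooth_form_on 1 S codiff_b"
  unfolding smooth_form_on_def
proof (intro conjI ballI allI)
  show "alternating_form 1 (codiff_b x)" if "x \<in> S" for x
    unfolding codiff_b_def by (rule alternating_form_hodge_inv_5[OF herm[OF that]])
  fix v :: "nat \<Rightarrow> complex^3"
  have "smooth_form_on 1 S (\<lambda>x w. g x (v 0) (w 0))"
    unfolding smooth_form_on_def
    using alternating_form_1[of "g _ (v 0)"] hermitian_innerD(1)[OF herm] smooth_g
    by (simp add: bilinear_def)
  then show "smooth_on S (\<lambda>x. codiff_b x v)"
    unfolding codiff_b_def hodge_inv_5_def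
    by (intro smooth_on_divide open_S smooth_wedge_top smooth_d_star_b smooth_vol_density
        vol_density_nonzero herm)
qed

lemma wedge_codiff_b:
  assumes "x \<in> S" "alternating_form 1 a"
  shows "wedge 1 5 a (d_star_b x) = (\<lambda>v. form_inner (g x) 1 a (codiff_b x) * vol_form (g x) v)"
  unfolding codiff_b_def
  by (rule wedge_hodge_inv_5[OF herm smooth_form_onD(1)[OF smooth_d_star_b]]) (use assms in auto)

lemma hodge_codiff_b: "x \<in> S \<Longrightarrow> hodge (g x) 1 (codiff_b x) = d_star_b x"
  unfolding codiff_b_def
  by (rule hodge_hodge_inv_5[OF herm smooth_form_onD(1)[OF smooth_d_star_b]])

text \<open>The exterior derivative of \<alpha> \<and> \<star>\<beta> is d\<alpha> \<and>
  \<star>\<beta> - \<alpha> \<and> d\<star>\<beta> and has integral zero. Evaluated on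
  \<open>coord_frame\<close>, its two terms are the two integrands of the adjointness
  relation.\<close>

lemma is_codiff_b: "is_codiff_on 1 S g \<beta> codiff_b"
  unfolding is_codiff_on_def
proof (intro conjI allI impI smooth_codiff_b)
  fix \<alpha> assume "test_form 1 S \<alpha>"
  then obtain K where \<alpha>: "smooth_form_on 1 S \<alpha>" and K: "compact K" "K \<subseteq> S"
    and \<alpha>0: "\<And>x. x \<in> S - K \<Longrightarrow> \<alpha> x = (\<lambda>_. 0)"
    by (auto simp: test_form_def)
  have d\<alpha>: "smooth_form_on 2 S (ext_d 1 \<alpha>)"
    using smooth_form_on_ext_d[OF open_S \<alpha>] by (simp add: numeral_2_eq_2)
  have d\<alpha>0: "ext_d 1 \<alpha> x = (\<lambda>_. 0)" if "x \<in> S - K" for x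
    using open_Diff[OF open_S compact_imp_closed[OF K(1)]] that \<alpha>0 by (rule ext_d_eq_0_open)
  define \<eta> where "\<eta> x = wedge 1 4 (\<alpha> x) (star_b x)" for x
  let ?l = "\<lambda>x. wedge 2 4 (ext_d 1 \<alpha> x) (star_b x) coord_frame"
  let ?r = "\<lambda>x. wedge 1 5 (\<alpha> x) (d_star_b x) coord_frame"
  have \<eta>: "smooth_form_on 5 S \<eta>"
    using smooth_form_on_wedge[OF open_S \<alpha> smooth_star_b] by (simp add: \<eta>_def[abs_def])
  have d\<eta>: "ext_d 5 \<eta> x coord_frame = ?l x - ?r x" if x: "x \<in> S" for x
    using ext_d_wedge[OF open_S \<alpha> smooth_star_b x, of coord_frame] ext_d_star_b[OF x]
    by (simp add: \<eta>_def[abs_def] numeral_2_eq_2)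
  have int: "set_integrable lborel S ?l" "set_integrable lborel S ?r"
    by (rule set_integrable_compact_support[OF smooth_on_imp_continuous_on[OF smooth_wedge_top] K];
        use \<alpha> d\<alpha> smooth_star_b smooth_d_star_b \<alpha>0 d\<alpha>0 in simp)+
  have "(LINT x:S|lborel. ?l x - ?r x) = (LINT x:S|lborel. ext_d 5 \<eta> x coord_frame)"
    by (rule set_lebesgue_integral_cong) (use open_S d\<eta> in auto)
  also have "\<dots> = 0"
    by (rule set_integral_ext_d_eq_0[OF open_S \<eta> K]) (simp add: \<eta>_def \<alpha>0)
  finally have "(LINT x:S|lborel. ?l x) = (LINT x:S|lborel. ?r x)"
    using set_integral_diff(2)[OF int] by simp
  moreover have "(LINT x:S|lborel. form_inner (g x) (Suc 1) (ext_d 1 \<alpha> x) (\<beta> x) * vol_density (g x)) =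
      (LINT x:S|lborel. ?l x)"
  proof (rule set_lebesgue_integral_cong; clarify?)
    fix x assume x: "x \<in> S"
    have "wedge 2 4 (ext_d 1 \<alpha> x) (star_b x) = (\<lambda>v. form_inner (g x) 2 (ext_d 1 \<alpha> x) (\<beta> x) * vol_form (g x) v)"
      unfolding star_b_def
      by (intro wedge_primitive_11 herm smooth_form_onD(1)[OF smooth_b] smooth_form_onD(1)[OF d\<alpha>] J_b prim_b x)
    then show "form_inner (g x) (Suc 1) (ext_d 1 \<alpha> x) (\<beta> x) * vol_density (g x) = ?l x"
      by (simp add: vol_density_eq numeral_2_eq_2)
  qed (use open_S in simp)
  moreover have "(LINT x:S|lborel. form_inner (g x) 1 (\<alpha> x) (codiff_b x) * vol_density (g x)) =
      (LINT x:S|lborel. ?r x)"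
  proof (rule set_lebesgue_integral_cong; clarify?)
    fix x assume x: "x \<in> S"
    show "form_inner (g x) 1 (\<alpha> x) (codiff_b x) * vol_density (g x) = ?r x"
      unfolding wedge_codiff_b[OF x smooth_form_onD(1)[OF \<alpha> x]] by (simp add: vol_density_eq)
  qed (use open_S in simp)
  ultimately show "(LINT x:S|lborel. form_inner (g x) (Suc 1) (ext_d 1 \<alpha> x) (\<beta> x) * vol_density (g x)) =
      (LINT x:S|lborel. form_inner (g x) 1 (\<alpha> x) (codiff_b x) * vol_density (g x))"
    by simp
qed

lemma codiff_on_b:
  assumes "x \<in> S"
  shows "codiff_on 1 S g \<beta> x = codiff_b x"
proof -
  have "is_codiff_on 1 S g \<beta> (codiff_on 1 S g \<beta>)"
    unfolding codiff_on_def by (rule someI[of "is_codiff_on 1 S g \<beta>", OF is_codiff_b])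
  then show ?thesis using is_codiff_b assms by (rule codiff_unique)
qed

lemma ext_d_hodge_b:
  assumes x: "x \<in> S"
  shows "ext_d 4 (\<lambda>x. hodge (g x) 2 (\<beta> x)) x = hodge (g x) 1 (codiff_on 1 S g \<beta> x)"
proof -
  have "ext_d 4 star_b x = ext_d 4 (\<lambda>x. hodge (g x) 2 (\<beta> x)) x"
    by (rule ext_d_cong[OF open_S smooth_star_b _ x]) (simp add: hodge_b)
  then show ?thesis
    unfolding codiff_on_b[OF x] hodge_codiff_b[OF x] ext_d_star_b[OF x] by (rule sym)
qed

text \<open>\<open>P\<close> stands for the real or imaginary part of the volume form. By type,
  \<beta> \<and> P vanishes on all of \<open>S\<close>, so it may be differentiated, and dP = 0
  leaves only d\<beta> \<and> P.\<close>

lemma wedge_ext_d_b_eq_0: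
  assumes P: "smooth_form_on 3 S P" and dP: "\<And>x. x \<in> S \<Longrightarrow> ext_d 3 P x = (\<lambda>_. 0)"
    and JP: "\<And>x u v w. x \<in> S \<Longrightarrow> P x (\<lambda>m. [\<i> *s u, \<i> *s v, w] ! m) = - P x (\<lambda>m. [u, v, w] ! m)"
    and x: "x \<in> S"
  shows "wedge 2 3 (kahler_form (g x)) (P x) = (\<lambda>_. 0)" "wedge 3 3 (ext_d 2 \<beta> x) (P x) = (\<lambda>_. 0)"
proof -
  show "wedge 2 3 (kahler_form (g x)) (P x) = (\<lambda>_. 0)"
    by (rule wedge_11_type_30_eq_0[OF herm[OF x] alternating_form_kahler[OF herm[OF x]]
        Jstar_kahler[OF herm[OF x]] smooth_form_onD(1)[OF P x] JP[OF x]])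
  have bP: "wedge 2 3 (\<beta> y) (P y) = (\<lambda>_. 0)" if "y \<in> S" for y
    by (rule wedge_11_type_30_eq_0[OF herm[OF that] smooth_form_onD(1)[OF smooth_b that] J_b[OF that]
        smooth_form_onD(1)[OF P that] JP[OF that]])
  show "wedge 3 3 (ext_d 2 \<beta> x) (P x) = (\<lambda>_. 0)"
  proof
    fix v
    have "0 = ext_d (2 + 3) (\<lambda>x. wedge 2 3 (\<beta> x) (P x)) x v"
      by (subst ext_d_eq_0_open[OF open_S x]) (simp_all add: bP)
    also have "\<dots> = wedge (Suc 2) 3 (ext_d 2 \<beta> x) (P x) v"
      by (subst ext_d_wedge[OF open_S smooth_b P x]) (simp add: dP[OF x])
    finally show "wedge 3 3 (ext_d 2 \<beta> x) (P x) v = 0" by (simp add: numeral_3_eq_3)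
  qed
qed

end

subsection \<open>Holomorphic volume forms\<close>

lemma dz123_det: "dz123 v = v 0 $ 1 * v 1 $ 2 * v 2 $ 3 + v 0 $ 2 * v 1 $ 3 * v 2 $ 1 + v 0 $ 3 * v 1 $ 1 * v 2 $ 2
    - v 0 $ 1 * v 1 $ 3 * v 2 $ 2 - v 0 $ 2 * v 1 $ 1 * v 2 $ 3 - v 0 $ 3 * v 1 $ 2 * v 2 $ 1"
  by (simp add: dz123_def det_3)

lemma dz123_J: "dz123 (\<lambda>m. [\<i> *s u, \<i> *s v, w] ! m) = - dz123 (\<lambda>m. [u, v, w] ! m)"
  by (simp add: dz123_det algebra_simps)

lemma complex_linear_expansion:
  fixes D :: "complex^3 \<Rightarrow> complex"
  assumes lin: "linear D" and J: "\<And>v. D (\<i> *s v) = \<i> * D v"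
  shows "D u = u $ 1 * D (axis 1 1) + u $ 2 * D (axis 2 1) + u $ 3 * D (axis 3 1)"
proof -
  have u: "u = (Re (u $ 1) *\<^sub>R axis 1 1 + Im (u $ 1) *\<^sub>R (\<i> *s axis 1 1))
      + (Re (u $ 2) *\<^sub>R axis 2 1 + Im (u $ 2) *\<^sub>R (\<i> *s axis 2 1))
      + (Re (u $ 3) *\<^sub>R axis 3 1 + Im (u $ 3) *\<^sub>R (\<i> *s axis 3 1))"
    by (simp add: vec_eq_iff forall_3 axis_def complex_eq_iff)
  have "Re z *\<^sub>R d + Im z *\<^sub>R (\<i> * d) = z * d" for z d :: complex
    by (simp add: complex_eq_iff)
  then show ?thesis
    by (subst u) (simp only: linear_add[OF lin] linear_cmul[OF lin] J)
qed

text \<open>The derivative of a holomorphic f is complex linear, hence a combination of dz1, dz2 and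
  dz3, so its product with their wedge product is zero. The constant \<open>c\<close> covers the
  real part (c = 1) and the imaginary part (c = -\<i>) together.\<close>

lemma ext_d_holomorphic_volume:
  assumes f: "holo_on S f" and x: "x \<in> S"
  shows "ext_d 3 (\<lambda>x v. Re (c * (f x * dz123 v))) x = (\<lambda>_. 0)"
proof
  fix v
  define D where "D = frechet_derivative f (at x)"
  have D: "(f has_derivative D) (at x)"
    using f x smooth_on_has_derivative unfolding holo_on_def D_def by blast
  have J: "D (\<i> *s u) = \<i> * D u" for u
    using f x by (simp add: holo_on_def D_def)
  have Dx: "D u = u $ 1 * D (axis 1 1) + u $ 2 * D (axis 2 1) + u $ 3 * D (axis 3 1)" for u
    by (rule complex_linear_expansion[OF has_derivative_linear[OF D] J])
  have "((\<lambda>y. Re (c * (f y * z))) has_derivative (\<lambda>u. Re (c * (D u * z)))) (at x)" for z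
    by (intro has_derivative_Re has_derivative_mult_right has_derivative_mult_left D)
  then have "frechet_derivative (\<lambda>y. Re (c * (f y * z))) (at x) = (\<lambda>u. Re (c * (D u * z)))" for z
    by (rule frechet_derivative_eqI)
  then have "ext_d 3 (\<lambda>x v. Re (c * (f x * dz123 v))) x v =
      (\<Sum>i\<le>3. (-1) ^ i * Re (c * (D (v i) * dz123 (omit i v))))"
    by (simp add: ext_d_omit)
  also have "\<dots> = Re (c * (D (v 0) * dz123 (omit 0 v) - D (v 1) * dz123 (omit 1 v)
      + D (v 2) * dz123 (omit 2 v) - D (v 3) * dz123 (omit 3 v)))"
    by (simp add: numeral_3_eq_3 numeral_2_eq_2 algebra_simps)
  \<comment> \<open>Laplace expansion of a 4 by 4 determinant whose row D(v_0), ..., D(v_3) is a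
    combination of the other three.\<close>
  also have "D (v 0) * dz123 (omit 0 v) - D (v 1) * dz123 (omit 1 v)
      + D (v 2) * dz123 (omit 2 v) - D (v 3) * dz123 (omit 3 v) = 0"
    unfolding Dx[of "v _"] by (simp add: dz123_det omit_def numeral_3_eq_3 numeral_2_eq_2 algebra_simps)
  finally show "ext_d 3 (\<lambda>x v. Re (c * (f x * dz123 v))) x v = 0" by simp
qed

lemma holomorphic_volume_closed:
  assumes S: "open S" and f: "holo_on S f" and P: "smooth_form_on 3 S P"
    and eq: "\<And>x v. x \<in> S \<Longrightarrow> P x v = Re (c * (f x * dz123 v))" and x: "x \<in> S"
  shows "ext_d 3 P x = (\<lambda>_. 0)" "P x (\<lambda>m. [\<i> *s u, \<i> *s v, w] ! m) = - P x (\<lambda>m. [u, v, w] ! m)"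
proof -
  have "P y = (\<lambda>v. Re (c * (f y * dz123 v)))" if "y \<in> S" for y
    using eq[OF that] by blast
  then show "ext_d 3 P x = (\<lambda>_. 0)"
    using ext_d_cong[OF S P _ x, of "\<lambda>x v. Re (c * (f x * dz123 v))"] ext_d_holomorphic_volume[OF f x] by simp
  show "P x (\<lambda>m. [\<i> *s u, \<i> *s v, w] ! m) = - P x (\<lambda>m. [u, v, w] ! m)"
    by (simp add: eq[OF x] dz123_J)
qed

section \<open>Assembly over the charts\<close>

theorem lemma6p4:
  fixes A :: "('a::{t2_space,second_countable_topology}) chart set"
    and h :: "'a dmetric" and \<Omega> :: "'a dcform" and \<beta> :: "'a dform"
  assumes "calabi_yau A h \<Omega>"
    and "\<beta> \<in> Forms2_8 A h"
  shows "eq_form A (Ext_d 2 \<beta>)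
           (add_form (Wedge 1 2 (scale_form (1/2) (JStar (d8_6 h \<beta>))) (Kahler h)) (d8_12 h \<Omega> \<beta>))
       \<and> eq_form A (Ext_d 4 (Hodge h 2 \<beta>)) (Hodge h 1 (d8_6 h \<beta>))"
proof -
  have "ext_d 2 (\<beta> c) x v =
        wedge 1 2 (\<lambda>v. 1 / 2 * Jstar (codiff_on 1 (cimg c) (h c) (\<beta> c) x) v) (kahler_form (h c x)) v
        + proj3_12 (h c x) (\<Omega> c x) (ext_d 2 (\<beta> c) x) v" (is ?decomp)
    and "ext_d 4 (\<lambda>x. hodge (h c x) 2 (\<beta> c x)) x = hodge (h c x) 1 (codiff_on 1 (cimg c) (h c) (\<beta> c) x)" (is ?star)
    if c: "c \<in> A" and x: "x \<in> cimg c" for c x v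
  proof -
    have "open (cimg c)"
      using assms(1) c by (auto simp: calabi_yau_def complex_atlas_def is_chart_def)
    \<comment> \<open>Every locale hypothesis is the reading in this chart of a clause of
      \<open>calabi_yau\<close> or of \<open>Forms2_8\<close>.\<close>
    then interpret primitive_11_form "cimg c" "h c" "\<beta> c"
      using assms c unfolding primitive_11_form_def kahler_domain_def primitive_11_form_axioms_def
      by (auto simp: calabi_yau_def hermitian_metric_def eq_form_def Ext_d_def Kahler_def zero_form_def
          Forms2_8_def Forms_def JStar_def Wedge_def kahler_sq_def)
    show ?star by (rule ext_d_hodge_b[OF x])
    obtain f where f: "holo_on (cimg c) f" "\<And>x v. x \<in> cimg c \<Longrightarrow> \<Omega> c x v = f x * dz123 v"
      using assms(1) c by (auto simp: calabi_yau_def holomorphic_volume_form_def)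
    have P: "smooth_form_on 3 (cimg c) (\<lambda>x. re_form (\<Omega> c x))" "smooth_form_on 3 (cimg c) (\<lambda>x. im_form (\<Omega> c x))"
      using assms(1) c
      by (auto simp: calabi_yau_def holomorphic_volume_form_def Forms_def Re_form_def Im_form_def)
    \<comment> \<open>Both parts are put into the shape Re(c f dz123); multiplication by -\<i> turns
      the imaginary part into a real part.\<close>
    have re: "re_form (\<Omega> c x) v = Re (1 * (f x * dz123 v))" and im: "im_form (\<Omega> c x) v = Re (- \<i> * (f x * dz123 v))"
      if "x \<in> cimg c" for x v
      using f(2)[OF that] by (simp_all add: re_form_def im_form_def)
    note closed_re = holomorphic_volume_closed[OF open_S f(1) P(1) re]
      and closed_im = holomorphic_volume_closed[OF open_S f(1) P(2) im]
    show ?decomp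
      unfolding codiff_on_b[OF x]
      by (rule three_form_decomposition[OF herm[OF x] smooth_form_onD(1)[OF smooth_codiff_b x]
            smooth_form_onD(1)[OF smooth_ext_d_b x] hodge_codiff_b[OF x, unfolded d_star_b_def]
            wedge_ext_d_b_eq_0(1)[OF P(1) closed_re x] wedge_ext_d_b_eq_0(1)[OF P(2) closed_im x]
            wedge_ext_d_b_eq_0(2)[OF P(1) closed_re x] wedge_ext_d_b_eq_0(2)[OF P(2) closed_im x]])
  qed
  then show ?thesis
    by (simp add: eq_form_def add_form_def Wedge_def scale_form_def JStar_def d8_6_def Codiff_def Kahler_def
        d8_12_def Proj3_12_def Ext_d_def Hodge_def fun_eq_iff)
qed

end
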